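(* Let $\mathcal P,\mathcal H,\mathcal M,\mathcal Q$ and $\mathcal A,\mathcal K,\mathcal D,\mathcal B$ satisfy the assumptions listed in the context, and let $T>0$. Let $g=g_1+g_2$ with $g_1\in H^2(0,T;\mathcal P^* )$, $g_2\in H^1(0,T;\mathcal H^* )$, $f\in H^1(0,T;\mathcal M^* )$, $h\in H^2(0,T;\mathcal Q^* )$. Let $p(0)\in\mathcal P$ with $\mathcal B p(0)=h(0)$, let $m(0)\in\mathcal M$, and assume there exists $m^\star\in\mathcal H_{\ker}$ with $$(m^\star,q_{\ker})_{\mathcal H}=\langle \mathcal K^*m(0)+g_1(0),q_{\ker}\rangle\qquad\text{for all }q_{\ker}\in\mathcal P_{\ker}.$$ For $\varepsilon>0$ let $(p,m,\lambda)$ be the classical solution of $$\dot p+\mathcal A p-\mathcal K^*m+\mathcal B^*\lambda=g\ \text{ in }\mathcal P^*,\qquad \varepsilon\dot m+\mathcal K p+\mathcal D m=f\ \text{ in }\mathcal M^*,\qquad \mathcal B p=h\ \text{ in }\mathcal Q^*$$ with initial values $p(0),m(0)$, and let $(p_0,m_0,\lambda_0)$ be the weak solution of $$\dot p_0+\mathcal A p_0-\mathcal K^*m_0+\mathcal B^*\lambda_0=g\ \text{ in }\mathcal P^*,\qquad \mathcal K p_0+\mathcal D m_0=f\ \text{ in }\mathcal M^*,\qquad \mathcal B p_0=h\ \text{ in }\mathcal Q^*$$ with $p_0(0)=p(0)$. Then for $0\le t\le T$ $$\|(p-p_0)(t)\|_{\mathcal H}^2+c_{\mathcal L}\int_0^t\|(p-p_0)(s)\|_{\mathcal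 P}^2\,ds+c_{\mathcal D}\int_0^t\|(m-m_0)(s)\|_{\mathcal M}^2\,ds$$ $$\lesssim\ \varepsilon\,e^{(1+4C_{\mathcal A})t}\,\|f(0)-\mathcal K p(0)-\mathcal D m(0)\|_{\mathcal M^*}^2+\varepsilon^2\,e^{(1+4C_{\mathcal A})t}\,\widetilde C_{\rm data},$$ where the constant $\widetilde C_{\rm data}$ depends only on $\|p(0)\|_{\mathcal H}$, $\|m^\star\|_{\mathcal H}$, $\|g_1\|_{H^2(0,T;\mathcal P^* )}$, $\|g_2\|_{H^1(0,T;\mathcal H^* )}$, $\|f\|_{H^1(0,T;\mathcal M^* )}$ and $\|h\|_{H^2(0,T;\mathcal Q^* )}$.
   Context: Spaces: $\mathcal P,\mathcal H,\mathcal M,\mathcal Q$ are real Hilbert spaces; $\mathcal P\hookrightarrow\mathcal H\cong\mathcal H^*\hookrightarrow\mathcal P^*$ is a Gelfand triple with dense embeddings; $\mathcal M$ is identified with its dual, $\mathcal M\cong\mathcal M^*$. $H^k(0,T;X)$, $L^2(0,T;X)$ are Sobolev–Bochner spaces; dots denote time derivatives. Operators: $\mathcal A:\mathcal H\to\mathcal H^*$, $\mathcal K:\mathcal P\to\mathcal M^*$, $\mathcal D:\mathcal M\to\mathcal M^*$, $\mathcal B:\mathcal P\to\mathcal Q^*$ are linear and bounded with operator norms $C_{\mathcal A},C_{\mathcal K},C_{\mathcal D},C_{\mathcal B}$. $\mathcal D$ is elliptic: $c_{\mathcal D}\|m\|_{\mathcal M}^2\le\langle\mathcal D m,m\rangle$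 for all $m\in\mathcal M$, with $c_{\mathcal D}>0$. $\mathcal B$ is inf-sup stable: $\inf_{\mu\in\mathcal Q\setminus\{0\}}\sup_{q\in\mathcal P\setminus\{0\}}\frac{\langle\mathcal B q,\mu\rangle}{\|q\|_{\mathcal P}\|\mu\|_{\mathcal Q}}=\beta>0$. With $\mathcal P_{\ker}:=\ker\mathcal B\subseteq\mathcal P$ there is $c_{\mathcal K}>0$ with $c_{\mathcal K}\|q\|_{\mathcal P}\le\|\mathcal K q\|_{\mathcal M^*}$ for all $q\in\mathcal P_{\ker}$. $\mathcal H_{\ker}$ is the closure of $\mathcal P_{\ker}$ in $\mathcal H$. An identity in $\mathcal P_{\ker}^*$ means that it is tested with elements of $\mathcal P_{\ker}$ only. $c_{\mathcal L}>0$ denotes the ellipticity constant of $\mathcal L:=\mathcal K^*\mathcal D^{-1}\mathcal K:\mathcal P\to\mathcal P^*$ on $\mathcal P_{\ker}$, i.e. $\langle\mathcal L q,q\rangle\ge c_{\mathcal L}\|q\|_{\mathcal P}^2$ for all $q\in\mathcal P_{\ker}$. Classical solution of the $\varepsilon$-system: $p\in C([0,T],\mathcal P)\cap C^1([0,T],\mathcal H)$, $m\in C^1([0,T],\mathcal M)$, $\lambda\in C([0,T],\mathcal Q)$ satisfying the equations for all $t$ and the initial conditions; under the hypotheses it exists and is unique. Weak solution of the limit system: $p_0\in L^2(0,T;\mathcal P)\cap C([0,T],\mathcal H)$, $m_0\in L^2(0,T;\mathcal M)$, with the first equation holding in $\mathcal P_{\ker}^*$ (with distributional time derivative; $\lambda_0$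 then drops out), the second and third equations for a.e. $t$, and the initial condition for $p_0$; the multiplier $\lambda_0$ exists in a distributional sense. Under the hypotheses the weak solution exists and is unique. Notation: $a\lesssim b$ means $a\le c\,b$ with a generic constant $c>0$, which here depends only on $T$ and on the spaces and operators, but not on $\varepsilon$, $t$, the right-hand sides or the initial data. Likewise $\widetilde C_{\rm data}$ is independent of $\varepsilon$ and $t$. *)

theory Defs
  imports "HOL-Analysis.Analysis"
begin

text \<open>
  Real Hilbert spaces are types of sort \<open>{real_inner, banach}\<close>; the dual of \<open>'x\<close> is
  \<open>'x \<Rightarrow>\<^sub>L real\<close>, with the operator norm.  The Riesz identification of a Hilbert space with its
  dual is \<^const>\<open>blinfun_inner_right\<close>.
\<close>

text \<open>The embedding of the pivot space \<open>H = H\<^sup>*\<close> into \<open>P\<^sup>*\<close> sends a functional \<open>\<phi>\<close> to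
  \<open>\<phi> o\<^sub>L \<iota>\<close>; as \<open>P\<close> is reflexive, it has dense range because \<open>\<iota>\<close> is injective.\<close>

definition gelfand_embedding :: "('p::{real_inner,banach} \<Rightarrow>\<^sub>L 'h::{real_inner,banach}) \<Rightarrow> bool" where
  "gelfand_embedding \<iota> \<longleftrightarrow> inj (blinfun_apply \<iota>) \<and> closure (range (blinfun_apply \<iota>)) = UNIV"

text \<open>Dual operator of \<open>K : X \<rightarrow> Y\<^sup>*\<close> as a map \<open>Y \<rightarrow> X\<^sup>*\<close>, where the reflexive space \<open>Y\<close> is
  identified with its bidual.\<close>

definition dual_op ::
  "('x::real_normed_vector \<Rightarrow>\<^sub>L ('y::real_normed_vector \<Rightarrow>\<^sub>L real)) \<Rightarrow> 'y \<Rightarrow> 'x \<Rightarrow>\<^sub>L real" where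
  "dual_op K y = Blinfun (\<lambda>x. K x y)"

lemma dual_op_apply [simp]: "dual_op K y x = K x y"
proof -
  have "bounded_linear (\<lambda>x. K x y)"
    by (intro bounded_linear_intros)
  then show ?thesis
    by (simp add: dual_op_def bounded_linear_Blinfun_apply)
qed

definition op_ker ::
  "('p::real_normed_vector \<Rightarrow>\<^sub>L ('q::real_normed_vector \<Rightarrow>\<^sub>L real)) \<Rightarrow> 'p set" where
  "op_ker B = {q. B q = 0}"

text \<open>Taken in the extended reals, so that the infimum and the supremum over an empty index set
  (trivial spaces) have their usual values \<open>\<infinity>\<close> and \<open>-\<infinity>\<close>.\<close>

definition inf_sup_const ::
  "('p::real_normed_vector \<Rightarrow>\<^sub>L ('q::real_normed_vector \<Rightarrow>\<^sub>L real)) \<Rightarrow> ereal" where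
  "inf_sup_const B = (INF \<mu>\<in>UNIV - {0}. SUP q\<in>UNIV - {0}. ereal (B q \<mu> / (norm q * norm \<mu>)))"

text \<open>\<open>L = K\<^sup>* D\<^sup>-\<^sup>1 K\<close>.  An elliptic \<open>D\<close> is bijective (Lax-Milgram), so that \<^const>\<open>inv\<close> is its
  genuine inverse.\<close>

definition op_L ::
  "('p::real_normed_vector \<Rightarrow>\<^sub>L ('m::real_normed_vector \<Rightarrow>\<^sub>L real)) \<Rightarrow> ('m \<Rightarrow>\<^sub>L ('m \<Rightarrow>\<^sub>L real)) \<Rightarrow>
   'p \<Rightarrow> 'p \<Rightarrow>\<^sub>L real" where
  "op_L K D q = dual_op K (inv (blinfun_apply D) (K q))"

text \<open>The Hilbert spaces are not assumed separable.  \<open>u measurable_on S\<close> (almost everywhere limit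
  of continuous functions) is strong measurability.  The integral is the Henstock-Kurzweil one,
  which is available for functions with values in an arbitrary normed space and which agrees with
  the Bochner integral on Bochner integrable functions.\<close>

definition bochner_L2 :: "real \<Rightarrow> (real \<Rightarrow> 'x::real_normed_vector) set" where
  "bochner_L2 T = {u. u measurable_on {0..T} \<and> (\<lambda>t. (norm (u t))\<^sup>2) integrable_on {0..T}}"

definition bochner_L2_norm :: "real \<Rightarrow> (real \<Rightarrow> 'x::real_normed_vector) \<Rightarrow> real" where
  "bochner_L2_norm T u = sqrt (integral {0..T} (\<lambda>t. (norm (u t))\<^sup>2))"

definition test_functions :: "real \<Rightarrow> (real \<Rightarrow> real) set" where
  "test_functions T = {\<phi>. (\<forall>n. (deriv ^^ n) \<phi> differentiable_on UNIV) \<and>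
     (\<exists>a b. 0 < a \<and> b < T \<and> (\<forall>t. t \<notin> {a..b} \<longrightarrow> \<phi> t = 0))}"

text \<open>\<open>v\<close> is the \<open>j\<close>-th distributional derivative of \<open>u\<close> on \<open>(0,T)\<close>:
  \<open>\<integral> \<phi>\<^sup>(\<^sup>j\<^sup>) u = (-1)\<^sup>j \<integral> \<phi> v\<close> for all test functions \<open>\<phi>\<close>.\<close>

definition has_weak_deriv ::
  "real \<Rightarrow> nat \<Rightarrow> (real \<Rightarrow> 'x::real_normed_vector) \<Rightarrow> (real \<Rightarrow> 'x) \<Rightarrow> bool" where
  "has_weak_deriv T j u v \<longleftrightarrow> (\<forall>\<phi>\<in>test_functions T.
     ((\<lambda>t. (deriv ^^ j) \<phi> t *\<^sub>R u t - ((-1) ^ j * \<phi> t) *\<^sub>R v t) has_integral 0) {0..T})"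

text \<open>\<open>H\<^sup>k(0,T;X)\<close>.  For \<open>k \<ge> 1\<close> the class of \<open>u\<close> modulo null sets has exactly one
  representative that is continuous on \<open>[0,T]\<close>; the elements of the space are these
  representatives, so that point values such as \<open>u 0\<close> are meaningful.\<close>

definition sobolev_bochner :: "nat \<Rightarrow> real \<Rightarrow> (real \<Rightarrow> 'x::real_normed_vector) set" where
  "sobolev_bochner k T = {u. u \<in> bochner_L2 T \<and> (0 < k \<longrightarrow> continuous_on {0..T} u) \<and>
     (\<forall>j\<le>k. \<exists>v\<in>bochner_L2 T. has_weak_deriv T j u v)}"

text \<open>The choice is unique up to null sets.\<close>

definition weak_deriv ::
  "real \<Rightarrow> nat \<Rightarrow> (real \<Rightarrow> 'x::real_normed_vector) \<Rightarrow> real \<Rightarrow> 'x" where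
  "weak_deriv T j u = (SOME v. v \<in> bochner_L2 T \<and> has_weak_deriv T j u v)"

definition sobolev_norm :: "nat \<Rightarrow> real \<Rightarrow> (real \<Rightarrow> 'x::real_normed_vector) \<Rightarrow> real" where
  "sobolev_norm k T u = sqrt (\<Sum>j\<le>k. (bochner_L2_norm T (weak_deriv T j u))\<^sup>2)"

text \<open>\<open>pd\<close> is the time derivative of \<open>p\<close> as a function with values in \<open>H\<close>.\<close>

definition classical_solution ::
  "real \<Rightarrow> ('p::{real_inner,banach} \<Rightarrow>\<^sub>L 'h::{real_inner,banach}) \<Rightarrow>
   ('h \<Rightarrow>\<^sub>L ('h \<Rightarrow>\<^sub>L real)) \<Rightarrow> ('p \<Rightarrow>\<^sub>L ('m::{real_inner,banach} \<Rightarrow>\<^sub>L real)) \<Rightarrow>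
   ('m \<Rightarrow>\<^sub>L ('m \<Rightarrow>\<^sub>L real)) \<Rightarrow> ('p \<Rightarrow>\<^sub>L ('q::{real_inner,banach} \<Rightarrow>\<^sub>L real)) \<Rightarrow>
   real \<Rightarrow> (real \<Rightarrow> 'p \<Rightarrow>\<^sub>L real) \<Rightarrow> (real \<Rightarrow> 'm \<Rightarrow>\<^sub>L real) \<Rightarrow> (real \<Rightarrow> 'q \<Rightarrow>\<^sub>L real) \<Rightarrow>
   'p \<Rightarrow> 'm \<Rightarrow> (real \<Rightarrow> 'p) \<Rightarrow> (real \<Rightarrow> 'm) \<Rightarrow> (real \<Rightarrow> 'q) \<Rightarrow> bool" where
  "classical_solution T \<iota> A K D B \<epsilon> g f h p_init m_init p m lam \<longleftrightarrow>
     continuous_on {0..T} p \<and> continuous_on {0..T} lam \<and>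
     (\<exists>pd md.
        continuous_on {0..T} pd \<and> continuous_on {0..T} md \<and>
        (\<forall>t\<in>{0..T}.
           ((\<lambda>s. \<iota> (p s)) has_vector_derivative pd t) (at t within {0..T}) \<and>
           (m has_vector_derivative md t) (at t within {0..T}) \<and>
           (blinfun_inner_right (pd t) o\<^sub>L \<iota>) + (A (\<iota> (p t)) o\<^sub>L \<iota>) - dual_op K (m t)
             + dual_op B (lam t) = g t \<and>
           \<epsilon> *\<^sub>R blinfun_inner_right (md t) + K (p t) + D (m t) = f t \<and>
           B (p t) = h t)) \<and>
     p 0 = p_init \<and> m 0 = m_init"

text \<open>Weak solution of the limit system.  The component \<open>p\<^sub>0\<close> in the intersection of
  \<open>L\<^sup>2(0,T;P)\<close> and \<open>C([0,T],H)\<close> is given by two functions: \<open>p0\<close> with values in \<open>P\<close>, defined up to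
  null sets, and its continuous \<open>H\<close>-valued representative \<open>u0\<close>, which need not lie in \<open>P\<close> at
  every time.  The first equation is tested with the kernel of \<open>B\<close> only; the multiplier does not
  contribute there.\<close>

definition weak_limit_solution ::
  "real \<Rightarrow> ('p::{real_inner,banach} \<Rightarrow>\<^sub>L 'h::{real_inner,banach}) \<Rightarrow>
   ('h \<Rightarrow>\<^sub>L ('h \<Rightarrow>\<^sub>L real)) \<Rightarrow> ('p \<Rightarrow>\<^sub>L ('m::{real_inner,banach} \<Rightarrow>\<^sub>L real)) \<Rightarrow>
   ('m \<Rightarrow>\<^sub>L ('m \<Rightarrow>\<^sub>L real)) \<Rightarrow> ('p \<Rightarrow>\<^sub>L ('q::{real_inner,banach} \<Rightarrow>\<^sub>L real)) \<Rightarrow>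
   (real \<Rightarrow> 'p \<Rightarrow>\<^sub>L real) \<Rightarrow> (real \<Rightarrow> 'm \<Rightarrow>\<^sub>L real) \<Rightarrow> (real \<Rightarrow> 'q \<Rightarrow>\<^sub>L real) \<Rightarrow>
   'p \<Rightarrow> (real \<Rightarrow> 'p) \<Rightarrow> (real \<Rightarrow> 'h) \<Rightarrow> (real \<Rightarrow> 'm) \<Rightarrow> bool" where
  "weak_limit_solution T \<iota> A K D B g f h p_init p0 u0 m0 \<longleftrightarrow>
     p0 \<in> bochner_L2 T \<and> continuous_on {0..T} u0 \<and>
     (AE t in lebesgue_on {0..T}. \<iota> (p0 t) = u0 t) \<and>
     m0 \<in> bochner_L2 T \<and>
     (\<forall>q\<in>op_ker B. has_weak_deriv T 1 (\<lambda>t. u0 t \<bullet> \<iota> q)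
        (\<lambda>t. (g t - (A (u0 t) o\<^sub>L \<iota>) + dual_op K (m0 t)) q)) \<and>
     (AE t in lebesgue_on {0..T}. K (p0 t) + D (m0 t) = f t) \<and>
     (AE t in lebesgue_on {0..T}. B (p0 t) = h t) \<and>
     u0 0 = \<iota> p_init"

end

theory Submission
  imports Defs
begin

text \<open>
  Throughout, \<open>R\<close> is a bounded right inverse of \<open>B\<close>, which exists by inf-sup stability
  (\<open>inf_sup_imp_right_inverse\<close>), \<open>r\<close> is the norm of the initial residual \<open>f(0) - K p(0) - D m(0)\<close>, and
  \<open>s\<close> is the sum of the norms of the data.

  The difference \<open>p - p0\<close> lies in the kernel of \<open>B\<close> almost everywhere.  Together with \<open>m - m0\<close> it
  solves, tested with that kernel, the limit system with right-hand side \<open>0\<close> in the first and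
  \<open>- \<epsilon> m'\<close> in the second equation.  Testing with the differences themselves makes the
  coupling terms \<open>K\<close> and \<open>K\<^sup>*\<close> cancel, and Gronwall bounds \<open>\<parallel>p - p0\<parallel>\<^sub>H\<^sup>2\<close> and the integral of
  \<open>\<parallel>m - m0\<parallel>\<^sup>2\<close> by \<open>\<epsilon>\<^sup>2 \<integral> \<parallel>m'\<parallel>\<^sup>2\<close>; the norm of \<open>p - p0\<close> in \<open>P\<close> is recovered from
  \<open>K (p - p0) = - \<epsilon> m' - D (m - m0)\<close>, as \<open>K\<close> is bounded below on the kernel
  (\<open>limit_error_estimate\<close>).  It remains to show \<open>\<integral> \<parallel>m'\<parallel>\<^sup>2 \<lesssim> s\<^sup>2 + r\<^sup>2 / \<epsilon>\<close>, uniformly in \<open>\<epsilon> > 0\<close>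
  (\<open>eps_velocity_bound\<close>).

  For this bound, put \<open>z = p - R h\<close>.  The time derivatives \<open>z'\<close>, \<open>m'\<close> solve the
  differentiated system, and the same test yields a bound for
  \<open>X = sup (\<parallel>z'\<parallel>\<^sub>H\<^sup>2 + \<epsilon> \<parallel>m'\<parallel>\<^sup>2) + \<integral> \<parallel>m'\<parallel>\<^sup>2\<close>.  The initial value \<open>\<epsilon> \<parallel>m'(0)\<parallel>\<^sup>2\<close> is exactly
  \<open>r\<^sup>2 / \<epsilon>\<close>, and \<open>z'(0)\<close> is controlled in \<open>H\<close> because \<open>m_star\<close> represents \<open>K\<^sup>* m(0) + g1(0)\<close>
  there.  In the term \<open>\<langle>g1', z'\<rangle>\<close> the velocity would be needed in \<open>P\<close>; integrating by parts in time
  costs \<open>s Z\<close> with \<open>Z = sup \<parallel>z\<parallel>\<^sub>P\<close>.  By the second equation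
  \<open>Z \<lesssim> s + r + sqrt X + sqrt \<epsilon> sqrt X\<close>, so that \<open>X \<lesssim> (1 + \<epsilon>) s\<^sup>2 + r\<^sup>2 / \<epsilon>\<close> after absorption
  (\<open>absorb_velocity_bound\<close>).  The factor \<open>1 + \<epsilon>\<close> is harmless, since \<open>X\<close> bounds both \<open>\<integral> \<parallel>m'\<parallel>\<^sup>2\<close>
  and \<open>\<epsilon> \<parallel>m'\<parallel>\<^sup>2\<close> pointwise, hence \<open>(1 + \<epsilon>) \<integral> \<parallel>m'\<parallel>\<^sup>2 \<lesssim> X\<close> (\<open>velocity_bound\<close>).

  The velocities are not regular enough to be tested with, and neither are
  the error functions.  Both arguments therefore run on differences of step \<open>\<delta>\<close> in time: in the
  first case of the solution itself, in the second case of the primitives in time of the error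
  functions, which solve the same kind of system with \<open>\<epsilon> = 0\<close>.  One lemma
  (\<open>quotient_energy_estimate\<close>) serves both, and \<open>energy_limit\<close> lets \<open>\<delta>\<close> tend to \<open>0\<close>.  As the spaces
  need not be separable, primitives are defined weakly through the Riesz representation, and the
  lower semicontinuity of the \<open>L\<^sup>2\<close> norm is replaced by the density of continuous functions
  (\<open>difference_quotients_bound_L2\<close>).

  A weak derivative is only ever evaluated on test functions that approximate
  the indicator of an interval or the difference of two ramps.  The former bound increments of the
  function by the integral of the norm of its first derivative, the latter bound differences of
  slopes by that of its second derivative, which makes \<open>H\<^sup>2\<close> functions continuously differentiable.
\<close>

section \<open>Smooth steps and ramps\<close>

text \<open>Smoothness with a finite order, so that closure under products and antiderivatives can be
  proved by induction on the order.\<close>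

definition diff_upto :: "nat \<Rightarrow> (real \<Rightarrow> real) \<Rightarrow> bool" where
  "diff_upto n \<phi> \<longleftrightarrow> (\<forall>j\<le>n. (deriv ^^ j) \<phi> differentiable_on UNIV)"

lemma diff_upto_0: "diff_upto 0 \<phi> \<longleftrightarrow> \<phi> differentiable_on UNIV"
  by (simp add: diff_upto_def)

lemma diff_upto_Suc: "diff_upto (Suc n) \<phi> \<longleftrightarrow> \<phi> differentiable_on UNIV \<and> diff_upto n (deriv \<phi>)"
proof -
  have "(\<forall>j\<le>Suc n. Q j) \<longleftrightarrow> Q 0 \<and> (\<forall>j\<le>n. Q (Suc j))" for Q :: "nat \<Rightarrow> bool"
    by (metis Suc_le_mono le_0_eq not0_implies_Suc zero_le)
  from this[of "\<lambda>j. (deriv ^^ j) \<phi> differentiable_on UNIV"] show ?thesis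
    unfolding diff_upto_def by (simp add: funpow_Suc_right del: funpow.simps)
qed

lemma diff_upto_differentiable: "diff_upto n \<phi> \<Longrightarrow> \<phi> differentiable_on UNIV"
  by (cases n) (simp_all add: diff_upto_0 diff_upto_Suc)

lemma diff_upto_DERIV: "diff_upto n \<phi> \<Longrightarrow> (\<phi> has_real_derivative deriv \<phi> x) (at x)"
  using diff_upto_differentiable[of n \<phi>] unfolding differentiable_on_def
  by (metis UNIV_I DERIV_deriv_iff_real_differentiable)

lemma diff_upto_mono: "diff_upto n \<phi> \<Longrightarrow> m \<le> n \<Longrightarrow> diff_upto m \<phi>"
  by (simp add: diff_upto_def)

lemma diff_upto_0I:
  assumes "\<And>x. (\<phi> has_real_derivative \<phi>' x) (at x)" shows "diff_upto 0 \<phi>"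
  unfolding diff_upto_0 differentiable_on_def
  using assms by (auto simp: real_differentiable_def)

lemma diff_upto_SucI:
  assumes "\<And>x. (\<phi> has_real_derivative \<phi>' x) (at x)" "diff_upto n \<phi>'"
  shows "diff_upto (Suc n) \<phi>"
proof -
  have "deriv \<phi> = \<phi>'" using assms(1) DERIV_imp_deriv by blast
  then show ?thesis using assms diff_upto_0I[of \<phi> \<phi>'] by (simp add: diff_upto_Suc diff_upto_0)
qed

lemma diff_upto_add: "diff_upto n \<phi> \<Longrightarrow> diff_upto n \<psi> \<Longrightarrow> diff_upto n (\<lambda>x. \<phi> x + \<psi> x)"
proof (induction n arbitrary: \<phi> \<psi>)
  case 0
  then show ?case by (intro diff_upto_0I[of _ "\<lambda>x. deriv \<phi> x + deriv \<psi> x"] DERIV_add diff_upto_DERIV)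
next
  case (Suc n)
  have "((\<lambda>x. \<phi> x + \<psi> x) has_real_derivative deriv \<phi> x + deriv \<psi> x) (at x)" for x
    by (rule DERIV_add[OF Suc.prems[THEN diff_upto_DERIV]])
  moreover have "diff_upto n (\<lambda>x. deriv \<phi> x + deriv \<psi> x)"
    using Suc.prems by (intro Suc.IH) (simp_all add: diff_upto_Suc)
  ultimately show ?case by (rule diff_upto_SucI)
qed

lemma diff_upto_affine: "diff_upto n \<phi> \<Longrightarrow> diff_upto n (\<lambda>x. c * \<phi> (a * x + b))"
proof (induction n arbitrary: \<phi> c)
  case 0
  have "((\<lambda>x. c * \<phi> (a * x + b)) has_real_derivative c * a * deriv \<phi> (a * x + b)) (at x)" for x
    using diff_upto_DERIV[OF 0, of "a*x+b"]
    by (auto intro!: derivative_eq_intros DERIV_chain2[where f=\<phi>])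
  then show ?case by (rule diff_upto_0I)
next
  case (Suc n)
  have "((\<lambda>x. c * \<phi> (a * x + b)) has_real_derivative c * a * deriv \<phi> (a * x + b)) (at x)" for x
    using diff_upto_DERIV[OF Suc.prems, of "a*x+b"]
    by (auto intro!: derivative_eq_intros DERIV_chain2[where f=\<phi>])
  moreover have "diff_upto n (\<lambda>x. c * a * deriv \<phi> (a * x + b))"
    using Suc by (simp add: diff_upto_Suc)
  ultimately show ?case by (rule diff_upto_SucI)
qed

lemma diff_upto_cmult: "diff_upto n \<phi> \<Longrightarrow> diff_upto n (\<lambda>x. c * \<phi> x)"
  using diff_upto_affine[of n \<phi> c 1 0] by simp

lemma diff_upto_mult: "diff_upto n \<phi> \<Longrightarrow> diff_upto n \<psi> \<Longrightarrow> diff_upto n (\<lambda>x. \<phi> x * \<psi> x)"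
proof (induction n arbitrary: \<phi> \<psi>)
  case 0
  show ?case by (rule diff_upto_0I[OF DERIV_mult[OF 0[THEN diff_upto_DERIV]]])
next
  case (Suc n)
  have "diff_upto n (\<lambda>x. deriv \<phi> x * \<psi> x + deriv \<psi> x * \<phi> x)"
    using Suc.prems Suc.prems[THEN diff_upto_mono, of n]
    by (intro diff_upto_add Suc.IH) (simp_all add: diff_upto_Suc)
  then show ?case by (rule diff_upto_SucI[OF DERIV_mult[OF Suc.prems[THEN diff_upto_DERIV]]])
qed

text \<open>The family is closed under differentiation up to linear combinations, which gives the
  smoothness of the member \<open>k = 0\<close>, the classical \<open>exp (-1/x)\<close>, without computing its derivatives.\<close>

definition flat :: "nat \<Rightarrow> real \<Rightarrow> real" where
  "flat k x = (if 0 < x then inverse x ^ k * exp (- inverse x) else 0)"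

text \<open>Substituting \<open>1/x\<close> turns this into the dominance of the exponential over powers at
  infinity.  It is also the derivative at \<open>0\<close> of the preceding member of the family.\<close>

lemma flat_tendsto_0: "(flat k \<longlongrightarrow> 0) (at 0)"
proof -
  have "((\<lambda>x::real. inverse x ^ k / exp (inverse x)) \<longlongrightarrow> 0) (at_right 0)"
    using filterlim_compose[OF tendsto_power_div_exp_0 filterlim_inverse_at_top_right] .
  then have "(flat k \<longlongrightarrow> 0) (at_right 0)"
    by (rule Lim_transform_eventually)
      (auto simp: flat_def eventually_at_right_less exp_minus divide_inverse intro!: eventually_at_rightI[of 0 1])
  moreover have "(flat k \<longlongrightarrow> 0) (at_left 0)"
    by (rule tendsto_eventually) (auto simp: flat_def intro!: eventually_at_leftI[of "-1"])
  ultimately show ?thesis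
    using filterlim_split_at_real by blast
qed

lemma flat_DERIV: "(flat k has_real_derivative (- real k * flat (Suc k) x + flat (Suc (Suc k)) x)) (at x)"
proof -
  consider "x < 0" | "x = 0" | "0 < x" by linarith
  then show ?thesis
  proof cases
    case 1
    have "((\<lambda>x. 0) has_real_derivative 0) (at x)" by simp
    then have "(flat k has_real_derivative 0) (at x)"
      by (rule has_field_derivative_transform_within_open[of _ _ _ "{..<0}"]) (use 1 in \<open>auto simp: flat_def\<close>)
    then show ?thesis using 1 by (simp add: flat_def)
  next
    case 2
    have "((\<lambda>h. (flat k (0 + h) - flat k 0) / h) \<longlongrightarrow> 0) (at 0)"
    proof (rule Lim_transform_eventually[OF flat_tendsto_0[of "Suc k"]])
      show "\<forall>\<^sub>F h in at 0. flat (Suc k) h = (flat k (0 + h) - flat k 0) / h"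
        unfolding eventually_at by (rule exI[of _ 1]) (auto simp: flat_def field_simps)
    qed
    then show ?thesis using 2 unfolding DERIV_def by (simp add: flat_def)
  next
    case 3
    have i: "(inverse has_real_derivative - (inverse x * inverse x)) (at x)"
      using DERIV_inverse[of x] 3 by (simp add: power2_eq_square)
    have p: "((\<lambda>x. inverse x ^ k) has_real_derivative
        real k * inverse x ^ (k - Suc 0) * - (inverse x * inverse x)) (at x)"
      by (rule derivative_eq_intros i refl)+ simp
    have e: "((\<lambda>x. exp (- inverse x)) has_real_derivative
        exp (- inverse x) * (inverse x * inverse x)) (at x)"
      by (rule derivative_eq_intros i refl)+ simp
    have "((\<lambda>x. inverse x ^ k * exp (- inverse x)) has_real_derivative
        (- real k * flat (Suc k) x + flat (Suc (Suc k)) x)) (at x)"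
      using DERIV_mult[OF p e] 3 by (cases k) (simp_all add: flat_def algebra_simps)
    then show ?thesis
      by (rule has_field_derivative_transform_within_open[of _ _ _ "{0<..}"]) (use 3 in \<open>auto simp: flat_def\<close>)
  qed
qed

lemma diff_upto_flat: "diff_upto n (flat k)"
proof (induction n arbitrary: k)
  case 0
  show ?case by (rule diff_upto_0I[OF flat_DERIV])
next
  case (Suc n)
  show ?case
    by (rule diff_upto_SucI[OF flat_DERIV]) (intro diff_upto_add diff_upto_cmult Suc)
qed

definition prebump :: "real \<Rightarrow> real" where
  "prebump x = flat 0 (1 + x) * flat 0 (1 - x)"

lemma diff_upto_prebump: "diff_upto n prebump"
proof -
  have "diff_upto n (\<lambda>x. (1 * flat 0 (1 * x + 1)) * (1 * flat 0 ((-1) * x + 1)))"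
    by (intro diff_upto_mult diff_upto_affine diff_upto_flat)
  then show ?thesis by (simp add: prebump_def[abs_def] add.commute)
qed

lemma diff_upto_continuous: "diff_upto n \<phi> \<Longrightarrow> continuous_on UNIV \<phi>"
  using diff_upto_differentiable differentiable_imp_continuous_on by blast

lemma prebump_nonneg: "0 \<le> prebump x" and prebump_outside: "1 \<le> \<bar>x\<bar> \<Longrightarrow> prebump x = 0"
  and prebump_pos: "\<bar>x\<bar> < 1 \<Longrightarrow> 0 < prebump x"
  by (auto simp: prebump_def flat_def)

definition bump_mass :: real where "bump_mass = integral {-2..2} prebump"

lemma bump_mass_pos: "0 < bump_mass"
proof -
  have c: "continuous_on {-2..2} prebump"
    using diff_upto_continuous[OF diff_upto_prebump[of 0]] continuous_on_subset by blast
  have "0 \<le> bump_mass" unfolding bump_mass_def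
    by (intro integral_nonneg integrable_continuous_interval c prebump_nonneg)
  moreover have "bump_mass \<noteq> 0"
  proof
    assume "bump_mass = 0"
    then have "(prebump has_integral 0) (cbox (-2) 2)"
      using integrable_integral[OF integrable_continuous_interval[OF c]] by (simp add: bump_mass_def)
    from has_integral_0_cbox_imp_0[OF _ _ this, of 0] c
    show False using prebump_pos[of 0] by (auto simp: prebump_nonneg)
  qed
  ultimately show ?thesis by linarith
qed

definition bump :: "real \<Rightarrow> real" where "bump x = prebump x / bump_mass"
lemma bump_le: "bump x \<le> 1 / bump_mass"
proof -
  have "flat 0 y \<le> 1" "0 \<le> flat 0 y" for y by (simp_all add: flat_def)
  then have "prebump x \<le> 1" unfolding prebump_def by (intro mult_le_one) auto
  then show ?thesis using bump_mass_pos by (simp add: bump_def divide_right_mono)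
qed

definition smooth_step :: "real \<Rightarrow> real" where "smooth_step x = integral {-2..x} bump"
definition smooth_ramp :: "real \<Rightarrow> real" where "smooth_ramp x = integral {-2..x} smooth_step"

text \<open>The lower end \<open>-2\<close> lies strictly to the left of the support, so that every point, including
  \<open>-1\<close>, has a neighbourhood on which one of the two descriptions of the primitive applies.\<close>

lemma primitive_from_left:
  fixes \<phi> :: "real \<Rightarrow> real"
  assumes c: "continuous_on UNIV \<phi>" and z: "\<And>x. x \<le> -1 \<Longrightarrow> \<phi> x = 0"
  shows "((\<lambda>x. integral {-2..x} \<phi>) has_real_derivative \<phi> x) (at x)"
    and "x \<le> -1 \<Longrightarrow> integral {-2..x} \<phi> = 0"
proof -
  show i0: "x \<le> -1 \<Longrightarrow> integral {-2..x} \<phi> = 0" for x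
    using integral_cong[of "{-2..x}" \<phi> "\<lambda>_. 0"] z by auto
  show "((\<lambda>x. integral {-2..x} \<phi>) has_real_derivative \<phi> x) (at x)"
  proof (cases "x < -1")
    case True
    have "((\<lambda>x. 0) has_real_derivative 0) (at x)" by simp
    then have "((\<lambda>x. integral {-2..x} \<phi>) has_real_derivative 0) (at x)"
      by (rule has_field_derivative_transform_within_open[of _ _ _ "{..<-1}"]) (use True i0 in auto)
    then show ?thesis using True z by simp
  next
    case False
    have "((\<lambda>x. integral {-2..x} \<phi>) has_real_derivative \<phi> x) (at x within {-2..x+1})"
      by (rule integral_has_real_derivative) (use False c continuous_on_subset in auto)
    moreover have "at x within {-2..x+1} = at x"
      by (rule at_within_interior) (use False in \<open>auto simp: interior_atLeastAtMost_real\<close>)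
    ultimately show ?thesis by simp
  qed
qed

lemma diff_upto_bump: "diff_upto n bump"
  using diff_upto_cmult[OF diff_upto_prebump, of n "inverse bump_mass"]
  by (simp add: bump_def[abs_def] divide_inverse mult.commute)

lemma bump_nonneg: "0 \<le> bump x" and bump_outside: "1 \<le> \<bar>x\<bar> \<Longrightarrow> bump x = 0"
  using bump_mass_pos by (auto simp: bump_def prebump_nonneg prebump_outside)

lemma smooth_step_DERIV: "(smooth_step has_real_derivative bump x) (at x)"
  and smooth_step_left: "x \<le> -1 \<Longrightarrow> smooth_step x = 0"
  using primitive_from_left[OF diff_upto_continuous[OF diff_upto_bump[of 0]]] bump_outside
  by (auto simp: smooth_step_def[abs_def])

lemma smooth_step_mono: "x \<le> y \<Longrightarrow> smooth_step x \<le> smooth_step y"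
  using DERIV_nonneg_imp_nondecreasing[of x y smooth_step] smooth_step_DERIV bump_nonneg by blast

lemma smooth_step_right: assumes "1 \<le> x" shows "smooth_step x = 1"
proof -
  have "smooth_step 2 = integral {-2..2} prebump / bump_mass"
    by (simp add: smooth_step_def bump_def[abs_def])
  then have "smooth_step 2 = 1"
    using bump_mass_pos by (simp add: bump_mass_def)
  moreover have "smooth_step y = smooth_step 2" if "1 \<le> y" for y
  proof -
    have c: "smooth_step a = smooth_step b" if "1 \<le> a" "a < b" for a b
    proof (rule DERIV_isconst_end[OF that(2), symmetric])
      show "continuous_on {a..b} smooth_step"
        by (rule DERIV_continuous_on[OF DERIV_subset[OF smooth_step_DERIV]]) auto
      show "(smooth_step has_real_derivative 0) (at x)" if "a < x" for x
        using smooth_step_DERIV[of x] bump_outside[of x] that \<open>1 \<le> a\<close> by simp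
    qed
    show ?thesis using c[of y 2] c[of 2 y, symmetric] that by (cases y "2::real" rule: linorder_cases) simp_all
  qed
  ultimately show ?thesis using assms by metis
qed

lemma smooth_step_bounds: "0 \<le> smooth_step x" "smooth_step x \<le> 1"
proof -
  show "0 \<le> smooth_step x"
    using smooth_step_mono[of "-1" x] smooth_step_left[of x] smooth_step_left[of "-1"] by linarith
  show "smooth_step x \<le> 1"
    using smooth_step_mono[of x 1] smooth_step_right[of x] smooth_step_right[of 1] by linarith
qed

lemma diff_upto_smooth_step: "diff_upto n smooth_step"
  by (rule diff_upto_mono[OF diff_upto_SucI[OF smooth_step_DERIV diff_upto_bump, of n]]) simp

lemma smooth_ramp_DERIV: "(smooth_ramp has_real_derivative smooth_step x) (at x)"
  and smooth_ramp_left: "x \<le> -1 \<Longrightarrow> smooth_ramp x = 0"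
  using primitive_from_left[OF diff_upto_continuous[OF diff_upto_smooth_step[of 0]]] smooth_step_left
  by (auto simp: smooth_ramp_def[abs_def])

lemma diff_upto_smooth_ramp: "diff_upto n smooth_ramp"
  by (rule diff_upto_mono[OF diff_upto_SucI[OF smooth_ramp_DERIV diff_upto_smooth_step, of n]]) simp

lemma smooth_ramp_right: assumes "1 \<le> x" "x \<le> y" shows "smooth_ramp y - smooth_ramp x = y - x"
proof (cases "x = y")
  case False
  have d: "((\<lambda>x. smooth_ramp x - x) has_real_derivative smooth_step u - 1) (at u)" for u
    by (rule DERIV_diff[OF smooth_ramp_DERIV DERIV_ident])
  have "smooth_ramp y - y = smooth_ramp x - x"
  proof (rule DERIV_isconst_end[of x y "\<lambda>x. smooth_ramp x - x"])
    show "x < y" using False assms by simp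
    show "continuous_on {x..y} (\<lambda>x. smooth_ramp x - x)"
      by (rule DERIV_continuous_on[OF DERIV_subset[OF d]]) auto
    show "((\<lambda>x. smooth_ramp x - x) has_real_derivative 0) (at u)" if "x < u" for u
      using d[of u] smooth_step_right[of u] that assms by simp
  qed
  then show ?thesis by simp
qed simp

lemma smooth_ramp_incr: assumes "x \<le> y"
  shows "0 \<le> smooth_ramp y - smooth_ramp x" "smooth_ramp y - smooth_ramp x \<le> y - x"
proof -
  have "smooth_ramp x \<le> smooth_ramp y"
    using DERIV_nonneg_imp_nondecreasing[OF assms, of smooth_ramp] smooth_ramp_DERIV smooth_step_bounds
    by blast
  moreover have "((\<lambda>x. x - smooth_ramp x) has_real_derivative 1 - smooth_step u) (at u)" for u
    by (rule DERIV_diff[OF DERIV_ident smooth_ramp_DERIV])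
  then have "x - smooth_ramp x \<le> y - smooth_ramp y"
    using DERIV_nonneg_imp_nondecreasing[OF assms, of "\<lambda>x. x - smooth_ramp x"] smooth_step_bounds
    by (metis diff_ge_0_iff_ge)
  ultimately show "0 \<le> smooth_ramp y - smooth_ramp x" "smooth_ramp y - smooth_ramp x \<le> y - x" by auto
qed

section \<open>Pointwise bounds from weak derivatives\<close>

lemma test_functionsI:
  assumes "\<And>n. diff_upto n \<phi>" "0 < l" "r < T" "\<And>x. x \<notin> {l..r} \<Longrightarrow> \<phi> x = 0"
  shows "\<phi> \<in> test_functions T"
  using assms unfolding test_functions_def diff_upto_def by blast

text \<open>Mass one, concentrated on the \<open>\<eta>\<close>-neighbourhood of \<open>a\<close>.\<close>

definition bump_at :: "real \<Rightarrow> real \<Rightarrow> real \<Rightarrow> real" where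
  "bump_at \<eta> a x = bump ((x - a) / \<eta>) / \<eta>"

text \<open>The primitive of \<^term>\<open>bump_at \<eta> a\<close>: a smooth Heaviside function jumping at \<open>a\<close>.\<close>

definition step_at :: "real \<Rightarrow> real \<Rightarrow> real \<Rightarrow> real" where
  "step_at \<eta> a x = smooth_step ((x - a) / \<eta>)"

text \<open>A smooth version of the function that rises linearly from \<open>0\<close> at \<open>a\<close> to \<open>1\<close> at \<open>b\<close>.  Its second
  derivative is the difference of the bumps at \<open>a\<close> and \<open>b\<close>, divided by \<open>b - a\<close>, so that integrating
  a function against it gives, up to the sign, a smoothed slope.\<close>

definition ramp_on :: "real \<Rightarrow> real \<Rightarrow> real \<Rightarrow> real \<Rightarrow> real" where
  "ramp_on \<eta> a b x = \<eta> * (smooth_ramp ((x - a) / \<eta>) - smooth_ramp ((x - b) / \<eta>)) / (b - a)"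

lemma diff_upto_rescale: "diff_upto n \<phi> \<Longrightarrow> diff_upto n (\<lambda>x. c * \<phi> ((x - a) / \<eta>))"
  using diff_upto_affine[of n \<phi> c "inverse \<eta>" "- a * inverse \<eta>"]
  by (simp add: divide_inverse algebra_simps)

lemma diff_upto_diff: "diff_upto n \<phi> \<Longrightarrow> diff_upto n \<psi> \<Longrightarrow> diff_upto n (\<lambda>x. \<phi> x - \<psi> x)"
  using diff_upto_add[OF _ diff_upto_cmult, of n \<phi> \<psi> "-1"] by simp

lemma diff_upto_bump_at: "diff_upto n (bump_at \<eta> a)"
  using diff_upto_rescale[OF diff_upto_bump, of n "inverse \<eta>" a \<eta>]
  by (simp add: bump_at_def[abs_def] divide_inverse mult.commute)

lemma diff_upto_step_at: "diff_upto n (step_at \<eta> a)"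
  using diff_upto_rescale[OF diff_upto_smooth_step, of n 1 a \<eta>] by (simp add: step_at_def[abs_def])

lemma diff_upto_ramp_on: "diff_upto n (ramp_on \<eta> a b)"
proof -
  have "diff_upto n (\<lambda>x. inverse (b - a) * (\<eta> * smooth_ramp ((x - a) / \<eta>) - \<eta> * smooth_ramp ((x - b) / \<eta>)))"
    by (intro diff_upto_cmult diff_upto_diff diff_upto_rescale diff_upto_smooth_ramp)
  then show ?thesis by (simp add: ramp_on_def[abs_def] divide_inverse algebra_simps)
qed

lemma rescale_DERIV:
  assumes "\<And>x. (\<phi> has_real_derivative \<phi>' x) (at x)" "\<eta> \<noteq> 0"
  shows "((\<lambda>x. \<phi> ((x - a) / \<eta>)) has_real_derivative \<phi>' ((x - a) / \<eta>) / \<eta>) (at x)"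
proof -
  have "((\<lambda>x. (x - a) / \<eta>) has_real_derivative 1 / \<eta>) (at x)"
    using assms(2) by (auto intro!: derivative_eq_intros)
  from DERIV_chain2[OF assms(1) this] show ?thesis by simp
qed

context
  fixes \<eta> :: real
  assumes \<eta>: "0 < \<eta>"
begin

lemma bump_at_nonneg: "0 \<le> bump_at \<eta> a x"
  using \<eta> bump_nonneg by (simp add: bump_at_def)

lemma bump_at_outside: "\<eta> \<le> \<bar>x - a\<bar> \<Longrightarrow> bump_at \<eta> a x = 0"
  using \<eta> by (simp add: bump_at_def bump_outside)

lemma step_at_DERIV: "(step_at \<eta> a has_real_derivative bump_at \<eta> a x) (at x)"
  using rescale_DERIV[OF smooth_step_DERIV, of \<eta> a x] \<eta> by (simp add: step_at_def[abs_def] bump_at_def)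

lemma step_at_left: "x \<le> a - \<eta> \<Longrightarrow> step_at \<eta> a x = 0"
  and step_at_right: "a + \<eta> \<le> x \<Longrightarrow> step_at \<eta> a x = 1"
  and step_at_bounds: "0 \<le> step_at \<eta> a x" "step_at \<eta> a x \<le> 1"
  using \<eta> by (auto simp: step_at_def smooth_step_bounds field_simps intro!: smooth_step_left smooth_step_right)

lemma ramp_on_DERIV:
  "(ramp_on \<eta> a b has_real_derivative (step_at \<eta> a x - step_at \<eta> b x) / (b - a)) (at x)"
proof -
  have "((\<lambda>x. \<eta> * (smooth_ramp ((x - a) / \<eta>) - smooth_ramp ((x - b) / \<eta>)) / (b - a)) has_real_derivative
     \<eta> * (smooth_step ((x - a) / \<eta>) / \<eta> - smooth_step ((x - b) / \<eta>) / \<eta>) / (b - a)) (at x)"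
    by (intro DERIV_cdivide DERIV_cmult DERIV_diff rescale_DERIV smooth_ramp_DERIV) (use \<eta> in auto)
  moreover have "\<eta> * (smooth_step ((x - a) / \<eta>) / \<eta> - smooth_step ((x - b) / \<eta>) / \<eta>) =
      smooth_step ((x - a) / \<eta>) - smooth_step ((x - b) / \<eta>)"
    using \<eta> by (simp add: algebra_simps)
  ultimately show ?thesis by (simp add: ramp_on_def[abs_def] step_at_def)
qed

lemma ramp_on_left: assumes "x \<le> a - \<eta>" "a \<le> b" shows "ramp_on \<eta> a b x = 0"
  using assms \<eta> by (simp add: ramp_on_def smooth_ramp_left field_simps)

lemma ramp_on_right: assumes "b + \<eta> \<le> x" "a < b" shows "ramp_on \<eta> a b x = 1"
proof -
  have "smooth_ramp ((x - a) / \<eta>) - smooth_ramp ((x - b) / \<eta>) = (x - a) / \<eta> - (x - b) / \<eta>"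
    by (rule smooth_ramp_right) (use assms \<eta> in \<open>auto simp: field_simps\<close>)
  also have "\<dots> = (b - a) / \<eta>" by (simp add: diff_divide_distrib)
  finally show ?thesis using assms \<eta> by (simp add: ramp_on_def)
qed

lemma ramp_on_bounds: assumes "a < b" shows "0 \<le> ramp_on \<eta> a b x" "ramp_on \<eta> a b x \<le> 1"
proof -
  have le: "(x - b) / \<eta> \<le> (x - a) / \<eta>" using assms \<eta> by (simp add: divide_right_mono)
  show "0 \<le> ramp_on \<eta> a b x"
    using smooth_ramp_incr(1)[OF le] assms \<eta> by (simp add: ramp_on_def)
  have "smooth_ramp ((x - a) / \<eta>) - smooth_ramp ((x - b) / \<eta>) \<le> (b - a) / \<eta>"
    using smooth_ramp_incr(2)[OF le] by (simp add: diff_divide_distrib)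
  then show "ramp_on \<eta> a b x \<le> 1" using assms \<eta> by (simp add: ramp_on_def field_simps)
qed

text \<open>Tests the first derivative: the integral of \<open>u\<close> against the derivative tends, up to
  the sign, to the increment of \<open>u\<close> between the two jumps.\<close>

lemma step_difference_test:
  assumes "\<eta> < s" "s \<le> t" "t + \<eta> < T"
  shows "(\<lambda>x. step_at \<eta> s x - step_at \<eta> t x) \<in> test_functions T"
    and "(deriv ^^ 1) (\<lambda>x. step_at \<eta> s x - step_at \<eta> t x) x = bump_at \<eta> s x - bump_at \<eta> t x"
    and "\<bar>step_at \<eta> s x - step_at \<eta> t x\<bar> \<le> 1"
    and "x \<notin> {s - \<eta>..t + \<eta>} \<Longrightarrow> step_at \<eta> s x - step_at \<eta> t x = 0"
proof -
  show z: "x \<notin> {s - \<eta>..t + \<eta>} \<Longrightarrow> step_at \<eta> s x - step_at \<eta> t x = 0" for x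
    using assms \<eta> by (cases "x < s - \<eta>") (auto simp: step_at_left step_at_right)
  show "(\<lambda>x. step_at \<eta> s x - step_at \<eta> t x) \<in> test_functions T"
    by (rule test_functionsI[OF diff_upto_diff[OF diff_upto_step_at diff_upto_step_at] _ _ z])
      (use assms in auto)
  show "(deriv ^^ 1) (\<lambda>x. step_at \<eta> s x - step_at \<eta> t x) x = bump_at \<eta> s x - bump_at \<eta> t x"
    using DERIV_imp_deriv[OF DERIV_diff[OF step_at_DERIV step_at_DERIV]] by simp
  show "\<bar>step_at \<eta> s x - step_at \<eta> t x\<bar> \<le> 1"
    using step_at_bounds[of s x] step_at_bounds[of t x] by linarith
qed

text \<open>Tests the second derivative.  A single ramp is not compactly supported, but both ramps are
  \<open>1\<close> on the right of \<open>[l, r]\<close>, so that their difference is; and both take values in \<open>[0, 1]\<close>,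
  which gives the bound \<open>1\<close> regardless of the lengths of the two intervals.\<close>

lemma ramp_difference_test:
  assumes "\<eta> < l" "r + \<eta> < T" "l \<le> a" "a < b" "b \<le> r" "l \<le> c" "c < d" "d \<le> r"
  shows "(\<lambda>x. ramp_on \<eta> a b x - ramp_on \<eta> c d x) \<in> test_functions T"
    and "(deriv ^^ 2) (\<lambda>x. ramp_on \<eta> a b x - ramp_on \<eta> c d x) x =
      (bump_at \<eta> a x - bump_at \<eta> b x) / (b - a) - (bump_at \<eta> c x - bump_at \<eta> d x) / (d - c)"
    and "\<bar>ramp_on \<eta> a b x - ramp_on \<eta> c d x\<bar> \<le> 1"
    and "x \<notin> {l - \<eta>..r + \<eta>} \<Longrightarrow> ramp_on \<eta> a b x - ramp_on \<eta> c d x = 0"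
proof -
  show z: "x \<notin> {l - \<eta>..r + \<eta>} \<Longrightarrow> ramp_on \<eta> a b x - ramp_on \<eta> c d x = 0" for x
    using assms \<eta> by (cases "x < l - \<eta>") (auto simp: ramp_on_left ramp_on_right)
  show "(\<lambda>x. ramp_on \<eta> a b x - ramp_on \<eta> c d x) \<in> test_functions T"
    by (rule test_functionsI[OF diff_upto_diff[OF diff_upto_ramp_on diff_upto_ramp_on] _ _ z])
      (use assms in auto)
  have "deriv (\<lambda>x. ramp_on \<eta> a b x - ramp_on \<eta> c d x) =
      (\<lambda>x. (step_at \<eta> a x - step_at \<eta> b x) / (b - a) - (step_at \<eta> c x - step_at \<eta> d x) / (d - c))"
    by (intro ext DERIV_imp_deriv DERIV_diff ramp_on_DERIV)
  then show "(deriv ^^ 2) (\<lambda>x. ramp_on \<eta> a b x - ramp_on \<eta> c d x) x =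
      (bump_at \<eta> a x - bump_at \<eta> b x) / (b - a) - (bump_at \<eta> c x - bump_at \<eta> d x) / (d - c)"
    by (simp add: numeral_2_eq_2)
      (intro DERIV_imp_deriv DERIV_diff DERIV_cdivide step_at_DERIV)
  show "\<bar>ramp_on \<eta> a b x - ramp_on \<eta> c d x\<bar> \<le> 1"
    using ramp_on_bounds[of a b x] ramp_on_bounds[of c d x] assms by linarith
qed

lemma bump_at_has_integral:
  assumes "\<eta> \<le> a" "a + \<eta> \<le> T" shows "(bump_at \<eta> a has_integral 1) {0..T}"
proof -
  have "(bump_at \<eta> a has_integral step_at \<eta> a T - step_at \<eta> a 0) {0..T}"
    by (rule fundamental_theorem_of_calculus)
      (use assms \<eta> step_at_DERIV in \<open>auto simp: has_real_derivative_iff_has_vector_derivative[symmetric]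
         intro: DERIV_subset\<close>)
  then show ?thesis using assms by (simp add: step_at_left step_at_right)
qed

end

lemma bump_average_integrable:
  fixes u :: "real \<Rightarrow> 'x::banach"
  assumes "continuous_on {0..T} u"
  shows "(\<lambda>x. bump_at \<eta> a x *\<^sub>R u x) integrable_on {0..T}"
  by (intro integrable_continuous_interval continuous_on_scaleR assms
      continuous_on_subset[OF diff_upto_continuous[OF diff_upto_bump_at[of 0]]]) auto

lemma bump_average_near:
  fixes u :: "real \<Rightarrow> 'x::banach"
  assumes u: "continuous_on {0..T} u" and \<eta>: "0 < \<eta>" "\<eta> \<le> a" "a + \<eta> \<le> T"
    and e: "\<And>x. x \<in> {0..T} \<Longrightarrow> \<bar>x - a\<bar> \<le> \<eta> \<Longrightarrow> norm (u x - y) \<le> e"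
  shows "norm (integral {0..T} (\<lambda>x. bump_at \<eta> a x *\<^sub>R u x) - y) \<le> e"
proof -
  note b = bump_at_has_integral[OF \<eta>]
  have "((\<lambda>x. bump_at \<eta> a x *\<^sub>R y) has_integral 1 *\<^sub>R y) {0..T}"
    by (rule has_integral_scaleR_left[OF b])
  from has_integral_diff[OF integrable_integral[OF bump_average_integrable[OF u]] this]
  have h: "((\<lambda>x. bump_at \<eta> a x *\<^sub>R u x - bump_at \<eta> a x *\<^sub>R y) has_integral
     (integral {0..T} (\<lambda>x. bump_at \<eta> a x *\<^sub>R u x) - y)) {0..T}" by simp
  have be: "((\<lambda>x. bump_at \<eta> a x * e) has_integral e) {0..T}"
    using has_integral_mult_left[OF b, of e] by simp
  have "norm (bump_at \<eta> a x *\<^sub>R u x - bump_at \<eta> a x *\<^sub>R y) \<le> bump_at \<eta> a x * e" if "x \<in> {0..T}" for x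
  proof (cases "\<bar>x - a\<bar> \<le> \<eta>")
    case True
    then show ?thesis using e[OF that True] bump_at_nonneg[OF \<eta>(1), of a x]
      by (simp add: scaleR_diff_right[symmetric] mult_left_mono)
  next
    case False
    then show ?thesis by (simp add: bump_at_outside[OF \<eta>(1)])
  qed
  then show ?thesis
    using Henstock_Kurzweil_Integration.integral_norm_bound_integral[of _ "{0..T}" "\<lambda>x. bump_at \<eta> a x * e"]
      h be by (metis (mono_tags, lifting) has_integral_iff)
qed

lemma bump_average_tendsto:
  fixes u :: "real \<Rightarrow> 'x::banach"
  assumes u: "continuous_on {0..T} u" and a: "0 < a" "a < T"
  shows "((\<lambda>\<eta>. integral {0..T} (\<lambda>x. bump_at \<eta> a x *\<^sub>R u x)) \<longlongrightarrow> u a) (at_right 0)"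
proof (rule tendstoI)
  fix e :: real assume "0 < e"
  then obtain d where d: "0 < d" "\<And>x. x \<in> {0..T} \<Longrightarrow> dist x a < d \<Longrightarrow> dist (u x) (u a) < e / 2"
    using u a unfolding continuous_on_iff by (metis atLeastAtMost_iff half_gt_zero less_imp_le)
  define k where "k = min (d / 2) (min a (T - a))"
  have k: "0 < k" using d a by (auto simp: k_def)
  show "\<forall>\<^sub>F \<eta> in at_right 0. dist (integral {0..T} (\<lambda>x. bump_at \<eta> a x *\<^sub>R u x)) (u a) < e"
  proof (rule eventually_at_rightI[OF _ k])
    fix \<eta> assume \<eta>: "\<eta> \<in> {0<..<k}"
    have "norm (integral {0..T} (\<lambda>x. bump_at \<eta> a x *\<^sub>R u x) - u a) \<le> e / 2"
    proof (rule bump_average_near[OF u])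
      show "0 < \<eta>" "\<eta> \<le> a" "a + \<eta> \<le> T" using \<eta> by (auto simp: k_def)
      show "norm (u x - u a) \<le> e / 2" if "x \<in> {0..T}" "\<bar>x - a\<bar> \<le> \<eta>" for x
        using d(2)[OF that(1)] that(2) \<eta> d(1) by (simp add: dist_norm k_def)
    qed
    then show "dist (integral {0..T} (\<lambda>x. bump_at \<eta> a x *\<^sub>R u x)) (u a) < e"
      using \<open>0 < e\<close> by (simp add: dist_norm)
  qed
qed

text \<open>Integrability is taken from the defining identity for \<open>\<phi> v\<close>, and the size from the scalar function
  \<open>\<parallel>v\<parallel>\<close>, for which domination arguments are available whatever the dimension of the space.\<close>

lemma weak_deriv_test_bound:
  fixes u v :: "real \<Rightarrow> 'x::banach"
  assumes wd: "has_weak_deriv T j u v" and \<phi>: "\<phi> \<in> test_functions T"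
    and I: "((\<lambda>t. (deriv ^^ j) \<phi> t *\<^sub>R u t) has_integral I) {0..T}"
    and v: "(\<lambda>t. norm (v t)) integrable_on {0..T}"
    and b: "\<And>t. \<bar>\<phi> t\<bar> \<le> 1" "\<And>t. t \<notin> {l..r} \<Longrightarrow> \<phi> t = 0" and lr: "0 \<le> l" "r \<le> T"
  shows "norm I \<le> integral {l..r} (\<lambda>t. norm (v t))"
proof -
  have sub: "{l..r} \<subseteq> {0..T}" using lr by auto
  then have int: "{l..r} \<inter> {0..T} = {l..r}" by blast
  have "((\<lambda>t. (deriv ^^ j) \<phi> t *\<^sub>R u t - ((-1) ^ j * \<phi> t) *\<^sub>R v t) has_integral 0) {0..T}"
    using wd \<phi> by (simp add: has_weak_deriv_def)
  from has_integral_diff[OF I this]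
  have h: "((\<lambda>t. ((-1) ^ j * \<phi> t) *\<^sub>R v t) has_integral I) {0..T}" by simp
  let ?g = "\<lambda>t. if t \<in> {l..r} then norm (v t) else 0"
  have g: "?g integrable_on {0..T}"
    unfolding integrable_restrict_Int int by (rule integrable_subinterval_real[OF v sub])
  have "norm (integral {0..T} (\<lambda>t. ((-1) ^ j * \<phi> t) *\<^sub>R v t)) \<le> integral {0..T} ?g"
  proof (rule Henstock_Kurzweil_Integration.integral_norm_bound_integral[OF _ g])
    show "(\<lambda>t. ((-1) ^ j * \<phi> t) *\<^sub>R v t) integrable_on {0..T}" using h by blast
    show "norm (((-1) ^ j * \<phi> t) *\<^sub>R v t) \<le> ?g t" for t
      using mult_right_mono[OF b(1)[of t], of "norm (v t)"] b(2)[of t]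
      by (auto simp: abs_mult power_abs)
  qed
  then show ?thesis using h integral_restrict_Int[of "{0..T}" "{l..r}" "\<lambda>t. norm (v t)"]
    unfolding int by (simp add: integral_unique)
qed

text \<open>Test functions vanish near the ends of the interval.  Bounds for interior points are carried to
  the ends by moving all points at once towards the midpoint, which keeps their order.\<close>

lemma nonpos_at_0_by_shrinking:
  fixes F :: "real \<Rightarrow> real"
  assumes "continuous_on {0..1} F" "\<And>\<theta>. \<theta> \<in> {0<..1} \<Longrightarrow> F \<theta> \<le> 0"
  shows "F 0 \<le> 0"
proof (rule continuous_le_on_closure[where S = "{0<..1}" and f = F])
  show "continuous_on (closure {0<..1}) F" "0 \<in> closure {0<..1::real}"
    using assms(1) by (simp_all add: closure_greaterThanAtMost)
qed (use assms(2) in auto)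

definition shrink :: "real \<Rightarrow> real \<Rightarrow> real \<Rightarrow> real" where
  "shrink T x \<theta> = (1 - \<theta>) * x + \<theta> * (T / 2)"

lemma shrink_0: "shrink T x 0 = x" by (simp add: shrink_def)

lemma shrink_interior: assumes "0 < T" "x \<in> {0..T}" "\<theta> \<in> {0<..1}"
  shows "0 < shrink T x \<theta>" "shrink T x \<theta> < T"
proof -
  have "0 \<le> (1 - \<theta>) * x" "(1 - \<theta>) * x \<le> (1 - \<theta>) * T" "0 < \<theta> * (T/2)" "(1-\<theta>) * T + \<theta> * (T/2) = T - \<theta> * (T/2)"
    using assms mult_left_mono[of x T "1 - \<theta>"] mult_right_mono[of \<theta> 1 x] by (auto simp: algebra_simps)
  then show "0 < shrink T x \<theta>" "shrink T x \<theta> < T" unfolding shrink_def by linarith+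
qed

lemma shrink_range: assumes "0 < T" "x \<in> {0..T}" "\<theta> \<in> {0..1}"
  shows "shrink T x \<theta> \<in> {0..T}"
  using shrink_interior[OF assms(1,2), of \<theta>] assms by (cases "\<theta> = 0") (auto simp: shrink_0)

lemma shrink_mono: "x \<le> y \<Longrightarrow> \<theta> \<in> {0..1} \<Longrightarrow> shrink T x \<theta> \<le> shrink T y \<theta>"
  by (auto simp: shrink_def intro: mult_left_mono)

lemma shrink_diff: "shrink T y \<theta> - shrink T x \<theta> = (1 - \<theta>) * (y - x)"
  by (simp add: shrink_def algebra_simps)

lemma continuous_on_shrink_compose:
  assumes "continuous_on {0..T} u" "0 < T" "x \<in> {0..T}"
  shows "continuous_on {0..1} (\<lambda>\<theta>. u (shrink T x \<theta>))"
  by (rule continuous_on_compose2[OF assms(1)])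
    (use shrink_range[OF assms(2,3)] in \<open>auto simp: shrink_def intro!: continuous_intros\<close>)

context
  fixes T :: real and v :: "real \<Rightarrow> 'x::banach" and N :: "real \<Rightarrow> real"
  assumes T: "0 < T" and v: "(\<lambda>t. norm (v t)) integrable_on {0..T}"
  defines "N \<equiv> \<lambda>t. integral {0..t} (\<lambda>s. norm (v s))"
begin

lemma norm_primitive_continuous: "continuous_on {0..T} N"
  unfolding N_def by (rule indefinite_integral_continuous_1[OF v])

lemma norm_primitive_diff: assumes "0 \<le> l" "l \<le> r" "r \<le> T"
  shows "integral {l..r} (\<lambda>s. norm (v s)) = N r - N l"
  using Henstock_Kurzweil_Integration.integral_combine[OF assms(1,2) integrable_subinterval_real[OF v, of 0 r]] assms
  by (simp add: N_def)

lemma norm_primitive_tendsto: assumes "0 < l" "l \<le> r" "r < T"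
  shows "((\<lambda>\<eta>. integral {l - \<eta>..r + \<eta>} (\<lambda>s. norm (v s))) \<longlongrightarrow> N r - N l) (at_right 0)"
proof -
  have c: "isCont N x" if "0 < x" "x < T" for x
    using norm_primitive_continuous that by (simp add: continuous_on_interior)
  have t: "((\<lambda>\<eta>. r + \<eta>) \<longlongrightarrow> r) (at_right 0)" "((\<lambda>\<eta>. l - \<eta>) \<longlongrightarrow> l) (at_right 0)"
    using tendsto_add[OF tendsto_const[of r] tendsto_ident_at[of 0 "{0<..}"]]
      tendsto_diff[OF tendsto_const[of l] tendsto_ident_at[of 0 "{0<..}"]] by simp_all
  have "((\<lambda>\<eta>. N (r + \<eta>) - N (l - \<eta>)) \<longlongrightarrow> N r - N l) (at_right 0)"
    using assms by (intro tendsto_diff isCont_tendsto_compose[OF c] t) simp_all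
  moreover have "\<forall>\<^sub>F \<eta> in at_right 0. N (r + \<eta>) - N (l - \<eta>) = integral {l - \<eta>..r + \<eta>} (\<lambda>s. norm (v s))"
    by (rule eventually_at_rightI[of 0 "min l (T - r)"]) (use assms in \<open>auto simp: norm_primitive_diff\<close>)
  ultimately show ?thesis by (rule Lim_transform_eventually)
qed

lemma weak_deriv1_increment_bound:
  assumes u: "continuous_on {0..T} u" and wd: "has_weak_deriv T 1 u v"
    and st: "0 \<le> s" "s \<le> t" "t \<le> T"
  shows "norm (u t - u s) \<le> N t - N s"
proof -
  have inner: "norm (u s - u t) \<le> N t - N s" if "0 < s" "s \<le> t" "t < T" for s t
  proof (rule tendsto_le[OF _ norm_primitive_tendsto[OF that]])
    show "((\<lambda>\<eta>. norm (integral {0..T} (\<lambda>x. bump_at \<eta> s x *\<^sub>R u x) - integral {0..T} (\<lambda>x. bump_at \<eta> t x *\<^sub>R u x)))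
        \<longlongrightarrow> norm (u s - u t)) (at_right 0)"
      by (intro tendsto_norm tendsto_diff bump_average_tendsto u) (use that in auto)
    show "\<forall>\<^sub>F \<eta> in at_right 0. norm (integral {0..T} (\<lambda>x. bump_at \<eta> s x *\<^sub>R u x)
        - integral {0..T} (\<lambda>x. bump_at \<eta> t x *\<^sub>R u x)) \<le> integral {s - \<eta>..t + \<eta>} (\<lambda>s. norm (v s))"
    proof (rule eventually_at_rightI)
      show "0 < min s (T - t)" using that by auto
      fix \<eta> assume "\<eta> \<in> {0<..<min s (T - t)}"
      then have \<eta>: "0 < \<eta>" "\<eta> < s" "t + \<eta> < T" by auto
      note test = step_difference_test[OF \<eta>(1,2) that(2) \<eta>(3)]
      show "norm (integral {0..T} (\<lambda>x. bump_at \<eta> s x *\<^sub>R u x)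
        - integral {0..T} (\<lambda>x. bump_at \<eta> t x *\<^sub>R u x)) \<le> integral {s - \<eta>..t + \<eta>} (\<lambda>s. norm (v s))"
        by (rule weak_deriv_test_bound[OF wd test(1) _ v test(3,4)])
          (use \<eta> has_integral_diff[OF bump_average_integrable[OF u, THEN integrable_integral]
              bump_average_integrable[OF u, THEN integrable_integral]]
            in \<open>auto simp: test(2)[simplified] scaleR_diff_left\<close>)
    qed
  qed simp
  define F where "F \<theta> = norm (u (shrink T s \<theta>) - u (shrink T t \<theta>)) -
    (N (shrink T t \<theta>) - N (shrink T s \<theta>))" for \<theta>
  have "F 0 \<le> 0"
  proof (rule nonpos_at_0_by_shrinking)
    show "continuous_on {0..1} F" unfolding F_def
      by (intro continuous_intros continuous_on_shrink_compose[OF u T]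
          continuous_on_shrink_compose[OF norm_primitive_continuous T]) (use st in auto)
    show "F \<theta> \<le> 0" if "\<theta> \<in> {0<..1}" for \<theta>
      using inner[of "shrink T s \<theta>" "shrink T t \<theta>"] shrink_interior[OF T _ that, of s]
        shrink_interior[OF T _ that, of t] shrink_mono[OF st(2), of \<theta> T] that st by (simp add: F_def)
  qed
  then show ?thesis by (simp add: F_def shrink_0 norm_minus_commute)
qed

text \<open>As the width of the bumps tends to \<open>0\<close>, the ramp test gives the difference of the two slopes.
  Shrinking multiplies the lengths of all intervals by \<open>1 - \<theta>\<close>, so both sides are multiplied by this
  factor before \<open>\<theta>\<close> tends to \<open>0\<close>.\<close>

lemma weak_deriv2_slope_bound:
  assumes u: "continuous_on {0..T} u" and wd: "has_weak_deriv T 2 u v"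
    and pts: "0 \<le> l" "l \<le> a" "a < b" "b \<le> r" "l \<le> c" "c < d" "d \<le> r" "r \<le> T"
  shows "norm ((u b - u a) /\<^sub>R (b - a) - (u d - u c) /\<^sub>R (d - c)) \<le> N r - N l"
proof -
  define sl where "sl a b = (u a - u b) /\<^sub>R (b - a)" for a b
  define bs where "bs \<eta> a b = (integral {0..T} (\<lambda>x. bump_at \<eta> a x *\<^sub>R u x)
     - integral {0..T} (\<lambda>x. bump_at \<eta> b x *\<^sub>R u x)) /\<^sub>R (b - a)" for \<eta> a b
  have inner: "norm (sl a b - sl c d) \<le> N r - N l"
    if p: "0 < l" "l \<le> a" "a < b" "b \<le> r" "l \<le> c" "c < d" "d \<le> r" "r < T" for a b c d l r
  proof (rule tendsto_le[OF _ norm_primitive_tendsto[of l r]])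
    show "((\<lambda>\<eta>. norm (bs \<eta> a b - bs \<eta> c d)) \<longlongrightarrow> norm (sl a b - sl c d)) (at_right 0)"
      unfolding bs_def sl_def
      by (intro tendsto_norm tendsto_diff tendsto_scaleR tendsto_const bump_average_tendsto u) (use p in auto)
    show "\<forall>\<^sub>F \<eta> in at_right 0. norm (bs \<eta> a b - bs \<eta> c d) \<le> integral {l - \<eta>..r + \<eta>} (\<lambda>s. norm (v s))"
    proof (rule eventually_at_rightI)
      show "0 < min l (T - r)" using p by auto
      fix \<eta> assume "\<eta> \<in> {0<..<min l (T - r)}"
      then have \<eta>: "0 < \<eta>" "\<eta> < l" "r + \<eta> < T" by auto
      note test = ramp_difference_test[OF \<eta> p(2-7)]
      have bs: "((\<lambda>x. ((bump_at \<eta> a x - bump_at \<eta> b x) / (b - a)) *\<^sub>R u x) has_integral bs \<eta> a b) {0..T}" for a b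
        using has_integral_cmul[OF has_integral_diff[OF bump_average_integrable[OF u, THEN integrable_integral]
              bump_average_integrable[OF u, THEN integrable_integral]], of "inverse (b - a)" \<eta> a \<eta> b]
        unfolding bs_def
        by (rule has_integral_eq[rotated]) (simp add: scaleR_diff_left[symmetric] divide_inverse mult.commute)
      show "norm (bs \<eta> a b - bs \<eta> c d) \<le> integral {l - \<eta>..r + \<eta>} (\<lambda>s. norm (v s))"
        by (rule weak_deriv_test_bound[OF wd test(1) _ v test(3,4)])
          (use \<eta> has_integral_diff[OF bs[of a b] bs[of c d]] in \<open>auto simp only: test(2) scaleR_diff_left\<close>)
    qed
  qed (use p in auto)
  define F where "F \<theta> = norm (sl (shrink T a \<theta>) (shrink T b \<theta>) - sl (shrink T c \<theta>) (shrink T d \<theta>)) -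
    (N (shrink T r \<theta>) - N (shrink T l \<theta>))" for \<theta>
  define F' where "F' \<theta> = norm ((u (shrink T a \<theta>) - u (shrink T b \<theta>)) /\<^sub>R (b - a)
     - (u (shrink T c \<theta>) - u (shrink T d \<theta>)) /\<^sub>R (d - c)) -
    (1 - \<theta>) * (N (shrink T r \<theta>) - N (shrink T l \<theta>))" for \<theta>
  have "F' 0 \<le> 0"
  proof (rule nonpos_at_0_by_shrinking)
    show "continuous_on {0..1} F'" unfolding F'_def
      by (intro continuous_intros continuous_on_shrink_compose[OF u T]
          continuous_on_shrink_compose[OF norm_primitive_continuous T]) (use pts in auto)
    show "F' \<theta> \<le> 0" if "\<theta> \<in> {0<..1}" for \<theta>
    proof (cases "\<theta> = 1")
      case True
      then show ?thesis by (simp add: F'_def shrink_def)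
    next
      case False
      with that have th: "0 < 1 - \<theta>" "\<theta> \<in> {0..1}" by auto
      have lt: "x < y \<Longrightarrow> shrink T x \<theta> < shrink T y \<theta>" for x y
        using shrink_diff[of T y \<theta> x] mult_pos_pos[OF th(1), of "y - x"] by linarith
      note int = shrink_interior[OF T _ that]
      have "norm (sl (shrink T a \<theta>) (shrink T b \<theta>) - sl (shrink T c \<theta>) (shrink T d \<theta>))
          \<le> N (shrink T r \<theta>) - N (shrink T l \<theta>)"
        by (rule inner) (use pts lt int shrink_mono[OF _ th(2)] in auto)
      moreover have "F' \<theta> = (1 - \<theta>) * F \<theta>"
      proof -
        have "sl (shrink T x \<theta>) (shrink T y \<theta>) = (u (shrink T x \<theta>) - u (shrink T y \<theta>)) /\<^sub>R (y - x) /\<^sub>R (1 - \<theta>)" for x y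
          by (simp add: sl_def shrink_diff mult.commute)
        then have "norm (sl (shrink T a \<theta>) (shrink T b \<theta>) - sl (shrink T c \<theta>) (shrink T d \<theta>)) =
           norm ((u (shrink T a \<theta>) - u (shrink T b \<theta>)) /\<^sub>R (b - a) - (u (shrink T c \<theta>) - u (shrink T d \<theta>)) /\<^sub>R (d - c)) / (1 - \<theta>)"
          using th by (simp only: scaleR_diff_right[symmetric] norm_scaleR) (simp add: divide_inverse mult.commute)
        then show ?thesis using th by (simp add: F_def F'_def field_simps)
      qed
      ultimately show ?thesis using th by (simp add: F_def mult_nonneg_nonpos)
    qed
  qed
  moreover have "F' 0 = norm (sl a b - sl c d) - (N r - N l)" by (simp add: F'_def sl_def shrink_0)
  moreover have "(u b - u a) /\<^sub>R (b - a) - (u d - u c) /\<^sub>R (d - c) = - (sl a b - sl c d)"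
    by (simp add: sl_def algebra_simps scaleR_diff_right)
  ultimately show ?thesis by (metis diff_le_0_iff_le norm_minus_cancel)
qed
end

section \<open>Continuous differentiability from bounds on slopes\<close>

lemma has_vector_derivative_iff_slope:
  fixes f :: "real \<Rightarrow> 'x::real_normed_vector"
  shows "(f has_vector_derivative D) (at x within S) \<longleftrightarrow>
    ((\<lambda>y. (f y - f x) /\<^sub>R (y - x)) \<longlongrightarrow> D) (at x within S)"
proof -
  have "norm ((f y - f x - (y - x) *\<^sub>R D) /\<^sub>R norm (y - x)) = norm ((f y - f x) /\<^sub>R (y - x) - D)" if "y \<noteq> x" for y
  proof -
    have "(f y - f x) /\<^sub>R (y - x) - D = (f y - f x - (y - x) *\<^sub>R D) /\<^sub>R (y - x)"
      using that by (simp add: scaleR_diff_right)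
    then show ?thesis by simp
  qed
  then have "((\<lambda>y. norm ((f y - f x - (y - x) *\<^sub>R D) /\<^sub>R norm (y - x))) \<longlongrightarrow> 0) (at x within S) \<longleftrightarrow>
     ((\<lambda>y. norm ((f y - f x) /\<^sub>R (y - x) - D)) \<longlongrightarrow> 0) (at x within S)"
    by (intro filterlim_cong refl) (auto simp: eventually_at_filter intro: always_eventually)
  then have "((\<lambda>y. (f y - f x - (y - x) *\<^sub>R D) /\<^sub>R norm (y - x)) \<longlongrightarrow> 0) (at x within S) \<longleftrightarrow>
     ((\<lambda>y. (f y - f x) /\<^sub>R (y - x) - D) \<longlongrightarrow> 0) (at x within S)"
    by (simp only: tendsto_norm_zero_iff)
  then show ?thesis
    unfolding has_vector_derivative_def has_derivative_within
    by (simp add: bounded_linear_scaleR_left LIM_zero_iff diff_diff_eq inverse_eq_divide)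
qed

text \<open>At each point, including the ends, the slopes to nearby points form a Cauchy family, because the
  difference of two of them is at most the oscillation of the continuous function \<open>N\<close> there.\<close>

lemma slope_bound_imp_C1:
  fixes u :: "real \<Rightarrow> 'x::banach" and N :: "real \<Rightarrow> real"
  assumes T: "0 < T" and N: "continuous_on {0..T} N"
    and slopes: "\<And>l r a b c d. \<lbrakk>0 \<le> l; l \<le> a; a < b; b \<le> r; l \<le> c; c < d; d \<le> r; r \<le> T\<rbrakk> \<Longrightarrow>
       norm ((u b - u a) /\<^sub>R (b - a) - (u d - u c) /\<^sub>R (d - c)) \<le> N r - N l"
  obtains G where "\<And>t. t \<in> {0..T} \<Longrightarrow> (u has_vector_derivative G t) (at t within {0..T})"
    and "\<And>s t. \<lbrakk>0 \<le> s; s \<le> t; t \<le> T\<rbrakk> \<Longrightarrow> norm (G t - G s) \<le> N t - N s"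
    and "\<And>t. t \<in> {0..T} \<Longrightarrow> norm (G t - (u T - u 0) /\<^sub>R T) \<le> N T - N 0"
proof -
  define sl where "sl x y = (u y - u x) /\<^sub>R (y - x)" for x y
  have sym: "sl x y = sl y x" for x y
  proof -
    have "sl y x = (- (u y - u x)) /\<^sub>R (- (y - x))" by (simp add: sl_def)
    then show ?thesis
      by (simp only: inverse_minus_eq scaleR_minus_left scaleR_minus_right minus_minus sl_def)
  qed
  have bd: "norm (sl a b - sl c d) \<le> N r - N l"
    if "{a, b, c, d} \<subseteq> {l..r}" "a \<noteq> b" "c \<noteq> d" "0 \<le> l" "r \<le> T" for a b c d l r
  proof -
    have *: "norm (sl a b - sl c d) \<le> N r - N l" if "{a, b, c, d} \<subseteq> {l..r}" "a < b" "c < d" "0 \<le> l" "r \<le> T" for a b c d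
      using slopes[of l a b r c d] that by (simp add: sl_def)
    show ?thesis
    proof -
      have o: "sl x y = sl (min x y) (max x y)" for x y
        by (cases "x \<le> y") (simp_all add: min_def max_def sym[of x y])
      show ?thesis
        unfolding o[of a b] o[of c d] by (rule *) (use that in auto)
    qed
  qed
  have osc: "\<exists>\<rho>>0. \<forall>x\<in>{0..T}. \<forall>y\<in>{0..T}. x \<noteq> t \<longrightarrow> y \<noteq> t \<longrightarrow> \<bar>x - t\<bar> < \<rho> \<longrightarrow> \<bar>y - t\<bar> < \<rho> \<longrightarrow> norm (sl t x - sl t y) < e"
    if t: "t \<in> {0..T}" and e: "0 < e" for t e
  proof -
    obtain \<rho> where \<rho>: "0 < \<rho>" "\<And>x. x \<in> {0..T} \<Longrightarrow> dist x t < \<rho> \<Longrightarrow> dist (N x) (N t) < e / 2"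
      using N t e unfolding continuous_on_iff by (metis half_gt_zero)
    show ?thesis
    proof (intro exI conjI ballI impI)
      show "0 < \<rho>" by fact
      fix x y assume xy: "x \<in> {0..T}" "y \<in> {0..T}" "x \<noteq> t" "y \<noteq> t" "\<bar>x - t\<bar> < \<rho>" "\<bar>y - t\<bar> < \<rho>"
      define l where "l = min t (min x y)" define r where "r = max t (max x y)"
      have lr: "l \<in> {0..T}" "r \<in> {0..T}" "dist l t < \<rho>" "dist r t < \<rho>"
        using xy t \<rho>(1) by (auto simp: l_def r_def dist_real_def min_def max_def)
      have "norm (sl t x - sl t y) \<le> N r - N l"
      proof (rule bd)
        show "{t, x, t, y} \<subseteq> {l..r}"
          by (simp add: l_def r_def min_le_iff_disj le_max_iff_disj)
      qed (use xy lr in auto)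
      also have "\<dots> < e" using \<rho>(2)[OF lr(1,3)] \<rho>(2)[OF lr(2,4)] unfolding dist_real_def by linarith
      finally show "norm (sl t x - sl t y) < e" .
    qed
  qed
  have "\<exists>D. (u has_vector_derivative D) (at t within {0..T})" if t: "t \<in> {0..T}" for t
  proof -
    have nt: "at t within {0..T} \<noteq> bot" using T t by (simp add: trivial_limit_within islimpt_Icc)
    have "cauchy_filter (filtermap (sl t) (at t within {0..T}))"
      unfolding cauchy_filter_metric_filtermap
    proof (intro allI impI)
      fix e :: real assume "0 < e"
      from osc[OF t this] obtain \<rho> where \<rho>: "0 < \<rho>" "\<forall>x\<in>{0..T}. \<forall>y\<in>{0..T}. x \<noteq> t \<longrightarrow> y \<noteq> t \<longrightarrow>
          \<bar>x - t\<bar> < \<rho> \<longrightarrow> \<bar>y - t\<bar> < \<rho> \<longrightarrow> norm (sl t x - sl t y) < e" by blast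
      show "\<exists>P. eventually P (at t within {0..T}) \<and> (\<forall>x y. P x \<and> P y \<longrightarrow> dist (sl t x) (sl t y) < e)"
        by (rule exI[of _ "\<lambda>x. x \<in> {0..T} \<and> x \<noteq> t \<and> \<bar>x - t\<bar> < \<rho>"])
          (use \<rho> in \<open>auto simp: eventually_at dist_norm intro!: exI[of _ \<rho>]\<close>)
    qed
    then have "\<exists>D. (sl t \<longlongrightarrow> D) (at t within {0..T})"
      using complete_uniform[THEN iffD1, OF complete_UNIV, rule_format, of "filtermap (sl t) (at t within {0..T})"] nt
      by (auto simp: filterlim_def filtermap_bot_iff)
    then show ?thesis unfolding has_vector_derivative_iff_slope sl_def by simp
  qed
  then obtain G where G: "\<And>t. t \<in> {0..T} \<Longrightarrow> (u has_vector_derivative G t) (at t within {0..T})" by metis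
  \<comment> \<open>Every bound on slopes passes to the limit, first in one and then in the other argument.\<close>
  have lim: "norm (G t - y) \<le> k" if t: "t \<in> {l..r}" and lr: "0 \<le> l" "l < r" "r \<le> T"
    and b: "\<And>x. x \<in> {l..r} \<Longrightarrow> x \<noteq> t \<Longrightarrow> norm (sl t x - y) \<le> k" for t l r y k
  proof (rule tendsto_upperbound)
    have "(u has_vector_derivative G t) (at t within {l..r})"
      by (rule has_vector_derivative_within_subset[OF G]) (use t lr in auto)
    then show "((\<lambda>x. norm (sl t x - y)) \<longlongrightarrow> norm (G t - y)) (at t within {l..r})"
      unfolding has_vector_derivative_iff_slope sl_def by (intro tendsto_intros)
    show "\<forall>\<^sub>F x in at t within {l..r}. norm (sl t x - y) \<le> k"
      using b by (auto simp: eventually_at_filter intro: always_eventually)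
    show "at t within {l..r} \<noteq> bot" using t lr by (simp add: trivial_limit_within islimpt_Icc)
  qed
  show ?thesis
  proof (rule that[of G])
    show "norm (G t - G s) \<le> N t - N s" if "0 \<le> s" "s \<le> t" "t \<le> T" for s t
    proof (cases "s = t")
      case False
      have "norm (G s - sl t x) \<le> N t - N s" if "x \<in> {s..t}" "x \<noteq> t" for x
        by (rule lim[of _ s t]) (use False that \<open>0 \<le> s\<close> \<open>s \<le> t\<close> \<open>t \<le> T\<close> in \<open>auto intro!: bd\<close>)
      then have "norm (G t - G s) \<le> N t - N s"
        by (intro lim[of _ s t]) (use False that in \<open>auto simp: norm_minus_commute\<close>)
      then show ?thesis .
    qed simp
    show "norm (G t - (u T - u 0) /\<^sub>R T) \<le> N T - N 0" if "t \<in> {0..T}" for t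
    proof (rule lim[of _ 0 T])
      show "norm (sl t x - (u T - u 0) /\<^sub>R T) \<le> N T - N 0" if "x \<in> {0..T}" "x \<noteq> t" for x
        using bd[of t x 0 T 0 T] that \<open>t \<in> {0..T}\<close> T by (simp add: sl_def)
    qed (use that T in auto)
  qed (use G in auto)
qed

section \<open>Square-integrable functions with values in a normed space\<close>

lemma measurable_dominated_integrable:
  fixes f g :: "real \<Rightarrow> real"
  assumes "f measurable_on {a..b}" "g integrable_on {a..b}" "\<And>x. x \<in> {a..b} \<Longrightarrow> \<bar>f x\<bar> \<le> g x"
  shows "f integrable_on {a..b}"
  by (rule measurable_bounded_by_integrable_imp_integrable_real[OF _ assms(2)])
    (use assms measurable_on_iff_borel_measurable[of "{a..b}" f] in auto)

lemma continuous_imp_measurable_on_interval: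
  fixes u :: "real \<Rightarrow> 'x::real_normed_vector"
  assumes "continuous_on {a..b} u"
  shows "u measurable_on {a..b}"
proof (cases "a \<le> b")
  case True
  let ?w = "\<lambda>t. u (max a (min b t))"
  have "continuous_on UNIV ?w"
    by (rule continuous_on_compose2[OF assms]) (use True in \<open>auto intro!: continuous_intros\<close>)
  then have "(\<lambda>t. if t \<in> {a..b} then ?w t else 0) measurable_on UNIV"
    by (intro measurable_on_restrict continuous_imp_measurable_on) auto
  then show ?thesis unfolding measurable_on_UNIV
    by (rule measurable_on_spike[of _ _ "{}"]) (use True in auto)
next
  case False
  then show ?thesis by (intro measurable_on_spike[OF measurable_on_0, of "{}"]) auto
qed

lemma bochner_L2_measurable: "u \<in> bochner_L2 T \<Longrightarrow> u measurable_on {0..T}"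
  and bochner_L2_sq_integrable: "u \<in> bochner_L2 T \<Longrightarrow> (\<lambda>t. (norm (u t))\<^sup>2) integrable_on {0..T}"
  by (auto simp: bochner_L2_def)

lemma bochner_L2_dominated:
  assumes "u measurable_on {0..T}" "g integrable_on {0..T}"
    and "\<And>t. t \<in> {0..T} \<Longrightarrow> (norm (u t))\<^sup>2 \<le> g t"
  shows "u \<in> bochner_L2 T"
proof -
  have "((\<lambda>y. (norm y)\<^sup>2) \<circ> u) measurable_on {0..T}"
    by (intro measurable_on_compose_continuous_0 assms continuous_intros) simp
  then have "(\<lambda>t. (norm (u t))\<^sup>2) integrable_on {0..T}"
    by (intro measurable_dominated_integrable[OF _ assms(2)]) (use assms(3) in \<open>auto simp: o_def\<close>)
  with assms(1) show ?thesis by (simp add: bochner_L2_def)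
qed

lemma continuous_in_bochner_L2: "continuous_on {0..T} u \<Longrightarrow> u \<in> bochner_L2 T"
  by (auto simp: bochner_L2_def intro!: continuous_imp_measurable_on_interval integrable_continuous_interval
      continuous_intros)

abbreviation int_sq :: "real set \<Rightarrow> (real \<Rightarrow> 'x::real_normed_vector) \<Rightarrow> real" where
  "int_sq S u \<equiv> integral S (\<lambda>t. (norm (u t))\<^sup>2)"

lemma power2_norm_diff_le:
  fixes x y :: "'x::real_normed_vector" shows "(norm (x - y))\<^sup>2 \<le> 2 * (norm x)\<^sup>2 + 2 * (norm y)\<^sup>2"
proof -
  have "(norm (x - y))\<^sup>2 \<le> (norm x + norm y)\<^sup>2" by (intro power_mono norm_triangle_ineq4) simp
  also have "\<dots> \<le> 2 * (norm x)\<^sup>2 + 2 * (norm y)\<^sup>2"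
    using zero_le_power2[of "norm x - norm y"] by (simp add: power2_eq_square algebra_simps)
  finally show ?thesis .
qed

lemma bochner_L2_diff:
  assumes "u \<in> bochner_L2 T" "w \<in> bochner_L2 T" shows "(\<lambda>t. u t - w t) \<in> bochner_L2 T"
proof (rule bochner_L2_dominated)
  show "(\<lambda>t. 2 * (norm (u t))\<^sup>2 + 2 * (norm (w t))\<^sup>2) integrable_on {0..T}"
    using assms by (intro integrable_add integrable_on_mult_right bochner_L2_sq_integrable)
qed (use assms in \<open>auto intro: measurable_on_diff bochner_L2_measurable power2_norm_diff_le\<close>)

lemma bochner_L2_norm_integrable:
  assumes "u \<in> bochner_L2 T" shows "(\<lambda>t. norm (u t)) integrable_on {0..T}"
proof (rule measurable_dominated_integrable)
  show "(\<lambda>t. norm (u t)) measurable_on {0..T}"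
    using measurable_on_compose_continuous_0[OF bochner_L2_measurable[OF assms], of norm]
    by (simp add: o_def continuous_on_norm)
  show "(\<lambda>t. 1 + (norm (u t))\<^sup>2) integrable_on {0..T}"
    by (intro integrable_add integrable_const_ivl bochner_L2_sq_integrable assms)
  show "\<bar>norm (u t)\<bar> \<le> 1 + (norm (u t))\<^sup>2" for t
  proof -
    have "2 * norm (u t) \<le> 1 + (norm (u t))\<^sup>2" using sum_squares_bound[of 1 "norm (u t)"] by simp
    then show ?thesis using norm_ge_zero[of "u t"] unfolding abs_norm_cancel by linarith
  qed
qed

lemma bochner_L2_blinfun_integrable:
  fixes \<phi> :: "'x::real_normed_vector \<Rightarrow>\<^sub>L real"
  assumes "u \<in> bochner_L2 T" shows "(\<lambda>t. \<phi> (u t)) integrable_on {0..T}"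
proof (rule measurable_dominated_integrable)
  show "(\<lambda>t. \<phi> (u t)) measurable_on {0..T}"
    using measurable_on_compose_continuous_0[OF bochner_L2_measurable[OF assms], of \<phi>]
    by (simp add: o_def blinfun.continuous_on continuous_on_id)
  show "(\<lambda>t. norm \<phi> * norm (u t)) integrable_on {0..T}"
    by (intro integrable_on_mult_right bochner_L2_norm_integrable assms)
  show "\<bar>\<phi> (u t)\<bar> \<le> norm \<phi> * norm (u t)" for t using norm_blinfun[of \<phi> "u t"] by simp
qed

lemma square_integral_le:
  fixes f :: "real \<Rightarrow> real"
  assumes "a \<le> b" "f integrable_on {a..b}" "(\<lambda>t. (f t)\<^sup>2) integrable_on {a..b}"
  shows "(integral {a..b} f)\<^sup>2 \<le> (b - a) * integral {a..b} (\<lambda>t. (f t)\<^sup>2)"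
proof (cases "a = b")
  case False
  define I where "I = integral {a..b} f"
  define m where "m = I / (b - a)"
  have "((\<lambda>t. (f t)\<^sup>2 - 2 * m * f t + m\<^sup>2) has_integral
      integral {a..b} (\<lambda>t. (f t)\<^sup>2) - 2 * m * I + (b - a) * m\<^sup>2) {a..b}"
    using has_integral_const_real[of "m\<^sup>2" a b] assms(1) unfolding I_def
    by (intro has_integral_add has_integral_diff has_integral_mult_right integrable_integral assms) auto
  then have "0 \<le> integral {a..b} (\<lambda>t. (f t)\<^sup>2) - 2 * m * I + (b - a) * m\<^sup>2"
    by (rule has_integral_nonneg)
      (use zero_le_power2[of "f _ - m"] in \<open>simp add: power2_eq_square algebra_simps\<close>)
  also have "(b - a) * m\<^sup>2 = m * I" using False by (simp add: m_def power2_eq_square)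
  also have "integral {a..b} (\<lambda>t. (f t)\<^sup>2) - 2 * m * I + m * I = integral {a..b} (\<lambda>t. (f t)\<^sup>2) - I\<^sup>2 / (b - a)"
    by (simp add: m_def power2_eq_square)
  finally show ?thesis using False assms(1) by (simp add: I_def field_simps)
qed simp

text \<open>Cauchy-Schwarz, written with the primitive of the squared norm for later use as an energy
  modulus.\<close>

lemma bochner_L2_increment:
  assumes "u \<in> bochner_L2 T" "0 \<le> s" "s \<le> t" "t \<le> T"
  shows "(integral {s..t} (\<lambda>r. norm (u r)))\<^sup>2 \<le> (t - s) *
    (int_sq {0..t} u - int_sq {0..s} u)"
proof -
  note sub = integrable_subinterval_real[OF bochner_L2_sq_integrable[OF assms(1)]]
    integrable_subinterval_real[OF bochner_L2_norm_integrable[OF assms(1)]]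
  have "int_sq {0..s} u + int_sq {s..t} u = int_sq {0..t} u"
    by (rule Henstock_Kurzweil_Integration.integral_combine) (use assms sub in auto)
  then have eq: "int_sq {0..t} u - int_sq {0..s} u =
      int_sq {s..t} u" by simp
  show ?thesis unfolding eq
    by (rule square_integral_le) (use assms sub in auto)
qed

text \<open>The radial retraction onto the ball of radius \<open>k\<close>.\<close>

definition radial_cut :: "real \<Rightarrow> 'x::real_normed_vector \<Rightarrow> 'x" where
  "radial_cut k y = (k / max k (norm y)) *\<^sub>R y"

lemma radial_cut:
  fixes y :: "'x::real_normed_vector"
  assumes "0 < k"
  shows "continuous_on UNIV (radial_cut k :: 'x \<Rightarrow> 'x)" "radial_cut k (0 :: 'x) = 0" "norm (radial_cut k y) \<le> k"
    "norm y \<le> k \<Longrightarrow> radial_cut k y = y" "norm (y - radial_cut k y) \<le> norm y"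
proof -
  show "continuous_on UNIV (radial_cut k :: 'x \<Rightarrow> 'x)" unfolding radial_cut_def
    by (intro continuous_intros) (use assms in \<open>auto simp: max_def\<close>)
  have q: "0 \<le> k / max k (norm y)" "k / max k (norm y) \<le> 1" for y :: 'x using assms by (auto simp: field_simps)
  have "norm (radial_cut k y) = k * (norm y / max k (norm y))" using assms q(1)[of y] by (simp add: radial_cut_def)
  also have "\<dots> \<le> k * 1" using assms by (intro mult_left_mono) (auto simp: field_simps)
  finally show "norm (radial_cut k y) \<le> k" by simp
  have "y - radial_cut k y = (1 - k / max k (norm y)) *\<^sub>R y" by (simp add: radial_cut_def scaleR_diff_left)
  then have "norm (y - radial_cut k y) = (1 - k / max k (norm y)) * norm y" using q(2)[of y] by simp
  also have "\<dots> \<le> 1 * norm y" using q(1)[of y] by (intro mult_right_mono) auto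
  finally show "norm (y - radial_cut k y) \<le> norm y" by simp
qed (use assms in \<open>auto simp: radial_cut_def max_def\<close>)

lemma integral_tendsto_0_dominated:
  fixes f :: "nat \<Rightarrow> real \<Rightarrow> real"
  assumes "\<And>n. f n integrable_on {a..b}" "g integrable_on {a..b}" "\<And>n x. x \<in> {a..b} \<Longrightarrow> \<bar>f n x\<bar> \<le> g x"
    and "negligible N" "\<And>x. x \<in> {a..b} \<Longrightarrow> x \<notin> N \<Longrightarrow> (\<lambda>n. f n x) \<longlonglongrightarrow> 0"
  shows "(\<lambda>n. integral {a..b} (f n)) \<longlonglongrightarrow> 0"
proof -
  let ?h = "\<lambda>n x. if x \<in> N then 0 else f n x"
  have eq: "integral {a..b} (?h n) = integral {a..b} (f n)" for n
    by (rule integral_spike[OF assms(4)]) auto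
  have int: "?h n integrable_on {a..b}" for n
    by (rule integrable_spike[OF assms(1,4)]) auto
  have "(\<lambda>n. integral {a..b} (?h n)) \<longlonglongrightarrow> integral {a..b} (\<lambda>_. 0)"
  proof (rule dominated_convergence(2)[OF int assms(2)])
    show "norm (?h n x) \<le> g x" if "x \<in> {a..b}" for n x
      using assms(3)[OF that, of n] abs_ge_zero[of "f n x"] by auto
    show "(\<lambda>n. ?h n x) \<longlonglongrightarrow> 0" if "x \<in> {a..b}" for x
      using assms(5)[OF that] by (cases "x \<in> N") auto
  qed
  then show ?thesis by (simp add: eq)
qed

text \<open>Strong measurability provides continuous functions that converge almost everywhere.  Truncating
  them, and the limit, at a common radius makes dominated convergence for the scalar squared
  distance applicable; truncating \<open>u\<close> itself costs little by the same theorem.\<close>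

lemma continuous_dense_in_bochner_L2:
  fixes u :: "real \<Rightarrow> 'x::real_normed_vector"
  assumes u: "u \<in> bochner_L2 T" and e: "0 < e"
  obtains w where "continuous_on UNIV w" "integral {0..T} (\<lambda>t. (norm (u t - w t))\<^sup>2) \<le> e"
proof -
  obtain N g where N: "negligible N" and g: "\<And>n. continuous_on UNIV (g n :: real \<Rightarrow> 'x)"
    and lim: "\<And>t. t \<notin> N \<Longrightarrow> (\<lambda>n. g n t) \<longlonglongrightarrow> (if t \<in> {0..T} then u t else 0)"
    using bochner_L2_measurable[OF u] unfolding measurable_on_def by metis
  have cut_L2: "(\<lambda>t. radial_cut k (f t)) \<in> bochner_L2 T" if "f measurable_on {0..T}" "0 < k" for f :: "real \<Rightarrow> 'x" and k
  proof (rule bochner_L2_dominated)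
    show "(\<lambda>t. radial_cut k (f t)) measurable_on {0..T}"
      using measurable_on_compose_continuous_0[OF that(1), of "radial_cut k"] radial_cut(1,2)[OF that(2), where 'x='x]
      by (simp add: o_def)
    show "(norm (radial_cut k (f t)))\<^sup>2 \<le> k\<^sup>2" for t by (intro power_mono radial_cut that) auto
  qed (rule integrable_const_ivl)
  have "(\<lambda>n. integral {0..T} (\<lambda>t. (norm (u t - radial_cut (real (Suc n)) (u t)))\<^sup>2)) \<longlonglongrightarrow> 0"
  proof (rule integral_tendsto_0_dominated[OF _ bochner_L2_sq_integrable[OF u] _ negligible_empty])
    show "(\<lambda>t. (norm (u t - radial_cut (real (Suc n)) (u t)))\<^sup>2) integrable_on {0..T}" for n
      by (intro bochner_L2_sq_integrable bochner_L2_diff cut_L2 bochner_L2_measurable u) simp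
    show "\<bar>(norm (u t - radial_cut (real (Suc n)) (u t)))\<^sup>2\<bar> \<le> (norm (u t))\<^sup>2" for n t
      by (simp del: of_nat_Suc) (intro power_mono radial_cut, auto)
    show "(\<lambda>n. (norm (u t - radial_cut (real (Suc n)) (u t)))\<^sup>2) \<longlonglongrightarrow> 0" for t
    proof (rule tendsto_eventually)
      obtain n0 where "norm (u t) \<le> real n0" using real_arch_simple by blast
      then show "\<forall>\<^sub>F n in sequentially. (norm (u t - radial_cut (real (Suc n)) (u t)))\<^sup>2 = 0"
        by (intro eventually_sequentiallyI[of n0]) (simp add: radial_cut(4))
    qed
  qed
  then have "\<forall>\<^sub>F n in sequentially. integral {0..T} (\<lambda>t. (norm (u t - radial_cut (real (Suc n)) (u t)))\<^sup>2) < e / 4"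
    using e by (intro order_tendstoD) auto
  then obtain n where n: "integral {0..T} (\<lambda>t. (norm (u t - radial_cut (real (Suc n)) (u t)))\<^sup>2) < e / 4"
    unfolding eventually_sequentially by blast
  define k where "k = real (Suc n)"
  have k: "0 < k" by (simp add: k_def)
  have gm: "g j measurable_on {0..T}" for j
    by (rule continuous_imp_measurable_on_interval) (use g continuous_on_subset in blast)
  have i2: "(\<lambda>t. (norm (radial_cut k (u t) - radial_cut k (g j t)))\<^sup>2) integrable_on {0..T}" for j
    by (intro bochner_L2_sq_integrable bochner_L2_diff cut_L2 bochner_L2_measurable u gm k)
  have "(\<lambda>j. integral {0..T} (\<lambda>t. (norm (radial_cut k (u t) - radial_cut k (g j t)))\<^sup>2)) \<longlonglongrightarrow> 0"
  proof (rule integral_tendsto_0_dominated[OF i2 integrable_const_ivl _ N])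
    show "\<bar>(norm (radial_cut k (u t) - radial_cut k (g j t)))\<^sup>2\<bar> \<le> (2 * k)\<^sup>2" for j t
      unfolding abs_power2 using norm_triangle_ineq4[of "radial_cut k (u t)" "radial_cut k (g j t)"]
        radial_cut(3)[OF k, of "u t"] radial_cut(3)[OF k, of "g j t"] by (intro power_mono) auto
    show "(\<lambda>j. (norm (radial_cut k (u t) - radial_cut k (g j t)))\<^sup>2) \<longlonglongrightarrow> 0" if "t \<in> {0..T}" "t \<notin> N" for t
    proof -
      have "(\<lambda>j. g j t) \<longlonglongrightarrow> u t" using lim[OF that(2)] that(1) by simp
      from continuous_on_tendsto_compose[OF radial_cut(1)[OF k] this]
      have "(\<lambda>j. radial_cut k (g j t)) \<longlonglongrightarrow> radial_cut k (u t)" by simp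
      then have "(\<lambda>j. (norm (radial_cut k (u t) - radial_cut k (g j t)))\<^sup>2) \<longlonglongrightarrow> (norm (radial_cut k (u t) - radial_cut k (u t)))\<^sup>2"
        by (intro tendsto_intros)
      then show ?thesis by simp
    qed
  qed
  then have "\<forall>\<^sub>F j in sequentially. integral {0..T} (\<lambda>t. (norm (radial_cut k (u t) - radial_cut k (g j t)))\<^sup>2) < e / 4"
    using e by (intro order_tendstoD) auto
  then obtain j where j: "integral {0..T} (\<lambda>t. (norm (radial_cut k (u t) - radial_cut k (g j t)))\<^sup>2) < e / 4"
    unfolding eventually_sequentially by blast
  have i1: "(\<lambda>t. (norm (u t - radial_cut k (u t)))\<^sup>2) integrable_on {0..T}"
    by (intro bochner_L2_sq_integrable bochner_L2_diff cut_L2 bochner_L2_measurable u k)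
  have "integral {0..T} (\<lambda>t. (norm (u t - radial_cut k (g j t)))\<^sup>2) \<le>
     integral {0..T} (\<lambda>t. 2 * (norm (u t - radial_cut k (u t)))\<^sup>2 + 2 * (norm (radial_cut k (u t) - radial_cut k (g j t)))\<^sup>2)"
  proof (rule integral_le)
    show "(norm (u t - radial_cut k (g j t)))\<^sup>2 \<le>
        2 * (norm (u t - radial_cut k (u t)))\<^sup>2 + 2 * (norm (radial_cut k (u t) - radial_cut k (g j t)))\<^sup>2" for t
      using power2_norm_diff_le[of "u t - radial_cut k (u t)" "radial_cut k (g j t) - radial_cut k (u t)"]
      by (simp add: norm_minus_commute)
  qed (intro bochner_L2_sq_integrable bochner_L2_diff cut_L2 bochner_L2_measurable u k gm
      integrable_add integrable_on_mult_right i1 i2)+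
  also have "\<dots> = 2 * integral {0..T} (\<lambda>t. (norm (u t - radial_cut k (u t)))\<^sup>2)
      + 2 * integral {0..T} (\<lambda>t. (norm (radial_cut k (u t) - radial_cut k (g j t)))\<^sup>2)"
    by (simp add: Henstock_Kurzweil_Integration.integral_add integrable_on_mult_right i1 i2)
  also have "\<dots> \<le> e" using n[folded k_def] j by linarith
  finally show ?thesis
    by (intro that[of "\<lambda>t. radial_cut k (g j t)"])
      (auto intro: continuous_on_compose2[OF radial_cut(1)[OF k] g])
qed

section \<open>Functions of finite energy on an interval\<close>

text \<open>The modulus of continuity that a bound \<open>\<integral> \<parallel>F'\<parallel>\<^sup>2 \<le> E\<close> implies by Cauchy-Schwarz, with the primitive
  of \<open>\<parallel>F'\<parallel>\<^sup>2\<close> for \<open>N\<close>.  It passes to differences and to images under bounded linear maps, and it is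
  the form in which the estimates for differences in time use the bound.\<close>

definition h1_energy_le :: "real \<Rightarrow> (real \<Rightarrow> 'x::real_normed_vector) \<Rightarrow> real \<Rightarrow> bool" where
  "h1_energy_le T F E \<longleftrightarrow> (\<exists>N. continuous_on {0..T} N \<and> mono_on {0..T} N \<and> N T - N 0 \<le> E \<and>
     (\<forall>s t. 0 \<le> s \<longrightarrow> s \<le> t \<longrightarrow> t \<le> T \<longrightarrow> (norm (F t - F s))\<^sup>2 \<le> (t - s) * (N t - N s)))"

lemma h1_energy_le_trans: "h1_energy_le T F E \<Longrightarrow> E \<le> E' \<Longrightarrow> h1_energy_le T F E'"
  unfolding h1_energy_le_def by (meson order_trans)

lemma h1_energy_le_of_L2:
  assumes v: "v \<in> bochner_L2 T"
    and F: "\<And>s t. \<lbrakk>0 \<le> s; s \<le> t; t \<le> T\<rbrakk> \<Longrightarrow> norm (F t - F s) \<le> integral {s..t} (\<lambda>r. norm (v r))"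
  shows "h1_energy_le T F (int_sq {0..T} v)"
  unfolding h1_energy_le_def
proof (intro exI conjI allI impI)
  let ?N = "\<lambda>t. int_sq {0..t} v"
  note int = bochner_L2_sq_integrable[OF v]
  show "continuous_on {0..T} ?N" by (rule indefinite_integral_continuous_1[OF int])
  show "mono_on {0..T} ?N"
    by (intro mono_onI integral_subset_le integrable_subinterval_real[OF int]) auto
  show "?N T - ?N 0 \<le> int_sq {0..T} v" by simp
  show "(norm (F t - F s))\<^sup>2 \<le> (t - s) * (?N t - ?N s)" if "0 \<le> s" "s \<le> t" "t \<le> T" for s t
    using power_mono[OF F[OF that] norm_ge_zero, of 2] bochner_L2_increment[OF v that] by linarith
qed

lemma h1_energy_le_Lipschitz:
  assumes "0 \<le> T" "\<And>s t. \<lbrakk>0 \<le> s; s \<le> t; t \<le> T\<rbrakk> \<Longrightarrow> norm (F t - F s) \<le> W * (t - s)"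
  shows "h1_energy_le T F (W\<^sup>2 * T)"
  unfolding h1_energy_le_def
proof (intro exI[of _ "\<lambda>t. W\<^sup>2 * t"] conjI allI impI)
  show "(norm (F t - F s))\<^sup>2 \<le> (t - s) * (W\<^sup>2 * t - W\<^sup>2 * s)" if "0 \<le> s" "s \<le> t" "t \<le> T" for s t
    using power_mono[OF assms(2)[OF that] norm_ge_zero, of 2] by (simp add: power2_eq_square algebra_simps)
qed (auto intro!: continuous_intros mono_onI mult_left_mono)

lemma h1_energy_le_linear:
  assumes "h1_energy_le T F E" and L: "\<And>x y. norm (L x - L y) \<le> k * norm (x - y)"
  shows "h1_energy_le T (\<lambda>t. L (F t)) (k\<^sup>2 * E)"
proof -
  obtain N where N: "continuous_on {0..T} N" "mono_on {0..T} N" "N T - N 0 \<le> E"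
    "\<And>s t. \<lbrakk>0 \<le> s; s \<le> t; t \<le> T\<rbrakk> \<Longrightarrow> (norm (F t - F s))\<^sup>2 \<le> (t - s) * (N t - N s)"
    using assms(1) unfolding h1_energy_le_def by blast
  show ?thesis unfolding h1_energy_le_def
  proof (intro exI[of _ "\<lambda>t. k\<^sup>2 * N t"] conjI allI impI)
    show "continuous_on {0..T} (\<lambda>t. k\<^sup>2 * N t)" by (intro continuous_intros N)
    show "mono_on {0..T} (\<lambda>t. k\<^sup>2 * N t)" using N(2) by (auto simp: mono_on_def intro!: mult_left_mono)
    show "k\<^sup>2 * N T - k\<^sup>2 * N 0 \<le> k\<^sup>2 * E" using mult_left_mono[OF N(3), of "k\<^sup>2"] by (simp add: algebra_simps)
    show "(norm (L (F t) - L (F s)))\<^sup>2 \<le> (t - s) * (k\<^sup>2 * N t - k\<^sup>2 * N s)" if st: "0 \<le> s" "s \<le> t" "t \<le> T" for s t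
    proof -
      have "(norm (L (F t) - L (F s)))\<^sup>2 \<le> (k * norm (F t - F s))\<^sup>2" by (intro power_mono L) simp
      also have "\<dots> \<le> k\<^sup>2 * ((t - s) * (N t - N s))"
        using mult_left_mono[OF N(4)[OF st], of "k\<^sup>2"] by (simp add: power_mult_distrib)
      finally show ?thesis by (simp add: algebra_simps)
    qed
  qed
qed

lemma h1_energy_le_diff:
  assumes "h1_energy_le T F E" "h1_energy_le T F' E'"
  shows "h1_energy_le T (\<lambda>t. F t - F' t) (2 * E + 2 * E')"
proof -
  obtain N where N: "continuous_on {0..T} N" "mono_on {0..T} N" "N T - N 0 \<le> E"
    "\<And>s t. \<lbrakk>0 \<le> s; s \<le> t; t \<le> T\<rbrakk> \<Longrightarrow> (norm (F t - F s))\<^sup>2 \<le> (t - s) * (N t - N s)"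
    using assms(1) unfolding h1_energy_le_def by blast
  obtain N' where N': "continuous_on {0..T} N'" "mono_on {0..T} N'" "N' T - N' 0 \<le> E'"
    "\<And>s t. \<lbrakk>0 \<le> s; s \<le> t; t \<le> T\<rbrakk> \<Longrightarrow> (norm (F' t - F' s))\<^sup>2 \<le> (t - s) * (N' t - N' s)"
    using assms(2) unfolding h1_energy_le_def by blast
  show ?thesis unfolding h1_energy_le_def
  proof (intro exI[of _ "\<lambda>t. 2 * N t + 2 * N' t"] conjI allI impI)
    show "continuous_on {0..T} (\<lambda>t. 2 * N t + 2 * N' t)" by (intro continuous_intros N N')
    show "mono_on {0..T} (\<lambda>t. 2 * N t + 2 * N' t)" using N(2)[THEN mono_onD] N'(2)[THEN mono_onD]
      by (intro mono_onI add_mono mult_left_mono) auto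
    show "2 * N T + 2 * N' T - (2 * N 0 + 2 * N' 0) \<le> 2 * E + 2 * E'" using N(3) N'(3) by simp
    show "(norm (F t - F' t - (F s - F' s)))\<^sup>2 \<le> (t - s) * (2 * N t + 2 * N' t - (2 * N s + 2 * N' s))"
      if st: "0 \<le> s" "s \<le> t" "t \<le> T" for s t
      using power2_norm_diff_le[of "F t - F s" "F' t - F' s"] N(4)[OF st] N'(4)[OF st]
      by (simp add: algebra_simps)
  qed
qed

lemma h1_energy_le_continuous:
  assumes "h1_energy_le T F E" shows "continuous_on {0..T} F"
proof -
  obtain N where N: "continuous_on {0..T} N" "mono_on {0..T} N"
    "\<And>s t. \<lbrakk>0 \<le> s; s \<le> t; t \<le> T\<rbrakk> \<Longrightarrow> (norm (F t - F s))\<^sup>2 \<le> (t - s) * (N t - N s)"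
    using assms(1) unfolding h1_energy_le_def by blast
  show ?thesis unfolding continuous_on_def
  proof
    fix t assume t: "t \<in> {0..T}"
    have b: "(norm (F x - F t))\<^sup>2 \<le> (x - t) * (N x - N t)" if "x \<in> {0..T}" for x
      using N(3)[of t x] N(3)[of x t] that t by (cases "x \<le> t") (auto simp: norm_minus_commute algebra_simps)
    have up: "((\<lambda>x. (x - t) * (N x - N t)) \<longlongrightarrow> (t - t) * (N t - N t)) (at t within {0..T})"
      using N(1) t by (intro tendsto_intros) (auto simp: continuous_on_def)
    have "((\<lambda>x. (norm (F x - F t))\<^sup>2) \<longlongrightarrow> 0) (at t within {0..T})"
    proof (rule tendsto_sandwich[of "\<lambda>_. 0" _ _ "\<lambda>x. (x - t) * (N x - N t)", OF _ _ tendsto_const])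
      show "((\<lambda>x. (x - t) * (N x - N t)) \<longlongrightarrow> 0) (at t within {0..T})" using up by simp
      show "\<forall>\<^sub>F x in at t within {0..T}. (norm (F x - F t))\<^sup>2 \<le> (x - t) * (N x - N t)"
        unfolding eventually_at_filter by (intro always_eventually allI impI b)
    qed auto
    then have "((\<lambda>x. sqrt ((norm (F x - F t))\<^sup>2)) \<longlongrightarrow> sqrt 0) (at t within {0..T})" by (rule tendsto_real_sqrt)
    then show "(F \<longlongrightarrow> F t) (at t within {0..T})" by (simp add: tendsto_norm_zero_iff LIM_zero_iff)
  qed
qed

lemma continuous_on_shift:
  fixes F :: "real \<Rightarrow> 'x::real_normed_vector"
  assumes "continuous_on {0..T} F" "0 \<le> \<delta>" "\<tau> + \<delta> \<le> T"
  shows "continuous_on {0..\<tau>} (\<lambda>t. F (t + \<delta>))" "continuous_on {0..\<tau>} F"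
proof -
  show "continuous_on {0..\<tau>} (\<lambda>t. F (t + \<delta>))"
    by (rule continuous_on_compose2[OF assms(1)]) (use assms in \<open>auto intro!: continuous_intros\<close>)
  show "continuous_on {0..\<tau>} F"
    by (rule continuous_on_subset[OF assms(1)]) (use assms in auto)
qed

text \<open>By the modulus, the integrand is at most \<open>\<delta> (N(t + \<delta>) - N(t))\<close>, whose integral telescopes to
  integrals of \<open>N\<close> over two intervals of length \<open>\<delta>\<close>.\<close>

lemma h1_energy_difference_integral:
  assumes E: "h1_energy_le T F E" and \<delta>: "0 < \<delta>" and \<tau>: "0 \<le> \<tau>" "\<tau> + \<delta> \<le> T"
  shows "integral {0..\<tau>} (\<lambda>t. (norm (F (t + \<delta>) - F t))\<^sup>2) \<le> \<delta>\<^sup>2 * E"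
proof -
  obtain N where N: "continuous_on {0..T} N" "mono_on {0..T} N" "N T - N 0 \<le> E"
    "\<And>s t. \<lbrakk>0 \<le> s; s \<le> t; t \<le> T\<rbrakk> \<Longrightarrow> (norm (F t - F s))\<^sup>2 \<le> (t - s) * (N t - N s)"
    using E unfolding h1_energy_le_def by blast
  note Nc = continuous_on_shift[OF N(1) less_imp_le[OF \<delta>] \<tau>(2)]
    and Fc = continuous_on_shift[OF h1_energy_le_continuous[OF E] less_imp_le[OF \<delta>] \<tau>(2)]
  have mono: "x \<le> y \<Longrightarrow> 0 \<le> x \<Longrightarrow> y \<le> T \<Longrightarrow> N x \<le> N y" for x y
    using N(2) by (auto simp: mono_on_def)
  \<comment> \<open>The primitive of the increment of N telescopes.\<close>
  define P where "P x = integral {0..x} N" for x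
  have P: "(P has_vector_derivative N x) (at x within {0..T})" if "x \<in> {0..T}" for x
    unfolding P_def by (rule integral_has_vector_derivative[OF N(1) that])
  have seg: "P y - P x = integral {x..y} N" if "0 \<le> x" "x \<le> y" "y \<le> T" for x y
    using Henstock_Kurzweil_Integration.integral_combine[OF that(1,2),of N]
      integrable_continuous_interval[OF continuous_on_subset[OF N(1), of "{0..y}"]] that by (auto simp: P_def)
  have "((\<lambda>t. N (t + \<delta>) - N t) has_integral (P (\<tau> + \<delta>) - P \<tau>) - (P (0 + \<delta>) - P 0)) {0..\<tau>}"
  proof (rule fundamental_theorem_of_calculus[OF \<tau>(1)])
    fix x assume x: "x \<in> {0..\<tau>}"
    have "((P \<circ> (\<lambda>t. t + \<delta>)) has_vector_derivative 1 *\<^sub>R N (x + \<delta>)) (at x within {0..\<tau>})"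
      by (rule vector_diff_chain_within)
        (use x \<tau> \<delta> in \<open>auto intro!: derivative_eq_intros has_vector_derivative_within_subset[OF P]\<close>)
    then show "((\<lambda>t. P (t + \<delta>) - P t) has_vector_derivative N (x + \<delta>) - N x) (at x within {0..\<tau>})"
      using has_vector_derivative_within_subset[OF P[of x], of "{0..\<tau>}"] x \<tau> \<delta>
      by (intro has_vector_derivative_diff) (auto simp: o_def)
  qed
  then have I: "integral {0..\<tau>} (\<lambda>t. N (t + \<delta>) - N t) = integral {\<tau>..\<tau> + \<delta>} N - integral {0..\<delta>} N"
    using seg[of \<tau> "\<tau> + \<delta>"] seg[of 0 \<delta>] \<tau> \<delta> by (simp add: integral_unique)
  have Ni: "N integrable_on {a..b}" if "0 \<le> a" "b \<le> T" for a b
    by (rule integrable_continuous_interval, rule continuous_on_subset[OF N(1)]) (use that in auto)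
  have "integral {\<tau>..\<tau> + \<delta>} N \<le> integral {\<tau>..\<tau> + \<delta>} (\<lambda>_. N T)"
    by (intro integral_le Ni) (use \<tau> \<delta> mono in auto)
  moreover have "integral {0..\<delta>} (\<lambda>_. N 0) \<le> integral {0..\<delta>} N"
    by (intro integral_le Ni) (use \<tau> \<delta> mono in auto)
  ultimately have "integral {0..\<tau>} (\<lambda>t. N (t + \<delta>) - N t) \<le> \<delta> * (N T - N 0)"
    using \<delta> by (simp add: I algebra_simps)
  also have "\<dots> \<le> \<delta> * E" using N(3) \<delta> by simp
  finally have main: "integral {0..\<tau>} (\<lambda>t. N (t + \<delta>) - N t) \<le> \<delta> * E" .
  have "integral {0..\<tau>} (\<lambda>t. (norm (F (t + \<delta>) - F t))\<^sup>2) \<le> integral {0..\<tau>} (\<lambda>t. \<delta> * (N (t + \<delta>) - N t))"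
    by (intro integral_le integrable_continuous_interval continuous_intros Nc Fc)
      (use N(4)[of t "t + \<delta>" for t] \<tau> \<delta> in \<open>auto simp: algebra_simps\<close>)
  also have "\<dots> \<le> \<delta> * (\<delta> * E)" using main \<delta> by simp
  finally show ?thesis by (simp add: power2_eq_square)
qed

section \<open>Representation of functionals and right inverse of the constraint\<close>

text \<open>The solution minimises \<open>a y y / 2 - \<phi> y\<close>: by the parallelogram law and coercivity, a minimising
  sequence is Cauchy.  The form \<open>a = (\<cdot>,\<cdot>)\<close> gives the Riesz representation, and
  \<open>a = B B\<^sup>*\<close> the right inverse of \<open>B\<close>.\<close>

lemma symmetric_coercive_form_represents:
  fixes a :: "'x::{real_inner,banach} \<Rightarrow>\<^sub>L ('x \<Rightarrow>\<^sub>L real)" and \<phi> :: "'x \<Rightarrow>\<^sub>L real"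
  assumes sym: "\<And>x y. a x y = a y x" and c: "0 < c" and coercive: "\<And>x. c * (norm x)\<^sup>2 \<le> a x x"
  shows "\<exists>x. a x = \<phi>"
proof -
  define J where "J y = a y y / 2 - \<phi> y" for y
  have lower: "- ((norm \<phi>)\<^sup>2 / (2 * c)) \<le> J y" for y
  proof -
    have "\<phi> y \<le> norm \<phi> * norm y" using norm_blinfun[of \<phi> y] by simp
    moreover have "norm \<phi> * norm y \<le> (norm \<phi>)\<^sup>2 / (2 * c) + c * (norm y)\<^sup>2 / 2"
      using zero_le_power2[of "norm \<phi> - c * norm y"] c by (simp add: field_simps power2_eq_square)
    ultimately show ?thesis using coercive[of y] by (simp add: J_def)
  qed
  define j where "j = (INF y. J y)"
  have bdd: "bdd_below (range J)" using lower by (intro bdd_belowI2[of _ "- ((norm \<phi>)\<^sup>2 / (2 * c))"])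
  have jle: "j \<le> J y" for y unfolding j_def by (rule cINF_lower[OF bdd]) simp
  have "\<exists>y. J y < j + inverse (Suc n)" for n
    using cINF_less_iff[OF _ bdd, of "j + inverse (Suc n)"] by (auto simp: j_def)
  then obtain y where y: "\<And>n. J (y n) < j + inverse (Suc n)" by metis
  have para: "c * (norm (u - v))\<^sup>2 / 4 \<le> J u + J v - 2 * J ((u + v) /\<^sub>R 2)" for u v
  proof -
    have "J u + J v - 2 * J ((u + v) /\<^sub>R 2) = a (u - v) (u - v) / 4"
      by (simp add: J_def blinfun.add_left blinfun.add_right blinfun.diff_left blinfun.diff_right
          blinfun.scaleR_left blinfun.scaleR_right sym[of v u] field_simps)
    then show ?thesis using coercive[of "u - v"] by simp
  qed
  have close: "(norm (y m - y n))\<^sup>2 \<le> 8 / c * inverse (Suc (min m n))" for m n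
  proof -
    have "inverse (Suc m) \<le> inverse (real (Suc (min m n)))" "inverse (Suc n) \<le> inverse (real (Suc (min m n)))"
      by (auto intro!: le_imp_inverse_le)
    then have "c * (norm (y m - y n))\<^sup>2 / 4 \<le> 2 * inverse (Suc (min m n))"
      using para[of "y m" "y n"] jle[of "(y m + y n) /\<^sub>R 2"] y[of m] y[of n] by linarith
    then have "4 / c * (c * (norm (y m - y n))\<^sup>2 / 4) \<le> 4 / c * (2 * inverse (Suc (min m n)))"
      using c by (intro mult_left_mono) auto
    then show ?thesis using c by simp
  qed
  have "Cauchy y"
  proof (rule metric_CauchyI)
    fix e :: real assume e: "0 < e"
    obtain M where M: "inverse (Suc M) < c * e\<^sup>2 / 8"
      using reals_Archimedean[of "c * e\<^sup>2 / 8"] c e by auto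
    have "dist (y m) (y n) < e" if "M \<le> m" "M \<le> n" for m n
    proof -
      have "inverse (real (Suc (min m n))) \<le> inverse (Suc M)" using that by (auto intro!: le_imp_inverse_le)
      with M have "inverse (real (Suc (min m n))) < c * e\<^sup>2 / 8" by linarith
      then have "8 / c * inverse (real (Suc (min m n))) < 8 / c * (c * e\<^sup>2 / 8)"
        using c by (intro mult_strict_left_mono divide_pos_pos) simp_all
      also have "\<dots> = e\<^sup>2" using c by simp
      finally have "8 / c * inverse (real (Suc (min m n))) < e\<^sup>2" .
      with close[of m n] have "(norm (y m - y n))\<^sup>2 < e\<^sup>2" by linarith
      then show ?thesis using e by (simp add: dist_norm power2_less_imp_less)
    qed
    then show "\<exists>M. \<forall>m\<ge>M. \<forall>n\<ge>M. dist (y m) (y n) < e" by blast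
  qed
  then obtain x where x: "y \<longlonglongrightarrow> x" using Cauchy_convergent convergent_def by blast
  have "(\<lambda>n. J (y n)) \<longlonglongrightarrow> J x" unfolding J_def by (intro tendsto_intros x) simp
  moreover have "(\<lambda>n. j + inverse (real (Suc n))) \<longlonglongrightarrow> j + 0"
    by (intro tendsto_intros LIMSEQ_inverse_real_of_nat)
  ultimately have "J x \<le> j + 0"
    by (rule LIMSEQ_le) (use y less_imp_le in blast)
  then have min: "J x \<le> J z" for z using jle[of z] by linarith
  have "a x z = \<phi> z" for z
  proof -
    define k where "k = a x z - \<phi> z"
    have quad: "0 \<le> t * k + t\<^sup>2 * (a z z / 2)" for t
    proof -
      have "J (x + t *\<^sub>R z) - J x = t * k + t\<^sup>2 * (a z z / 2)"
        by (simp add: J_def k_def blinfun.add_left blinfun.add_right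
          blinfun.scaleR_left blinfun.scaleR_right sym[of z x] field_simps power2_eq_square)
      then show ?thesis using min[of "x + t *\<^sub>R z"] by linarith
    qed
    \<comment> \<open>Evaluate at the vertex of a slightly wider parabola.\<close>
    define d where "d = a z z + 1"
    have d: "0 < d" using coercive[of z] c by (simp add: d_def add_nonneg_pos zero_le_mult_iff order_trans[rotated])
    have "0 \<le> (- k / d) * k + (- k / d)\<^sup>2 * ((d - 1) / 2)" using quad[of "- k / d"] by (simp add: d_def)
    also have "\<dots> = - (k\<^sup>2) * (d + 1) / (2 * d\<^sup>2)" using d by (simp add: field_simps power2_eq_square)
    finally have "k\<^sup>2 * (d + 1) \<le> 0" using d by (simp add: divide_le_0_iff)
    then have "k = 0" using d by (simp add: mult_le_0_iff)
    then show ?thesis by (simp add: k_def)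
  qed
  then show ?thesis by (intro exI blinfun_eqI)
qed

lemma riesz_representation:
  fixes \<phi> :: "'x::{real_inner,banach} \<Rightarrow>\<^sub>L real"
  obtains x where "\<And>y. \<phi> y = x \<bullet> y"
proof -
  have b: "blinfun_apply (Blinfun blinfun_inner_right) = (blinfun_inner_right :: 'x \<Rightarrow> _)"
    by (rule bounded_linear_Blinfun_apply[OF bounded_linear_blinfun_inner_right])
  have "\<exists>x. Blinfun blinfun_inner_right x = \<phi>"
    by (rule symmetric_coercive_form_represents[of _ 1])
      (simp_all add: b inner_commute power2_norm_eq_inner)
  then show ?thesis using that unfolding b by (metis blinfun_inner_right.rep_eq)
qed

text \<open>With the Riesz representative \<open>r \<mu>\<close> of \<open>B\<^sup>* \<mu>\<close>, the inf-sup condition reads \<open>\<beta> \<parallel>\<mu>\<parallel> \<le> \<parallel>r \<mu>\<parallel>\<close>.  Hence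
  the symmetric form \<open>B B\<^sup>*\<close> on \<open>Q\<close> is coercive, and \<open>B\<^sup>* (B B\<^sup>*)\<^sup>-\<^sup>1\<close> is a bounded right inverse.\<close>

lemma inf_sup_imp_right_inverse:
  fixes B :: "'p::{real_inner,banach} \<Rightarrow>\<^sub>L ('q::{real_inner,banach} \<Rightarrow>\<^sub>L real)"
  assumes "0 < inf_sup_const B"
  obtains R :: "('q \<Rightarrow>\<^sub>L real) \<Rightarrow>\<^sub>L 'p" where "\<And>\<phi>. B (R \<phi>) = \<phi>"
proof -
  obtain \<beta> where \<beta>: "0 < \<beta>" "ereal \<beta> < inf_sup_const B"
    using ereal_dense2[OF assms] by (auto simp: zero_ereal_def)
  have "\<exists>x. \<forall>q. B q \<mu> = x \<bullet> q" for \<mu>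
    using riesz_representation[of "dual_op B \<mu>"] by (metis dual_op_apply)
  then obtain r where r: "\<And>\<mu> q. B q \<mu> = r \<mu> \<bullet> q" by metis
  have r_linear: "r (\<mu> + \<nu>) = r \<mu> + r \<nu>" "r (s *\<^sub>R \<mu>) = s *\<^sub>R r \<mu>" for \<mu> \<nu> s
  proof -
    have "r (\<mu> + \<nu>) \<bullet> q = (r \<mu> + r \<nu>) \<bullet> q" "r (s *\<^sub>R \<mu>) \<bullet> q = (s *\<^sub>R r \<mu>) \<bullet> q" for q
      by (simp_all add: inner_add_left r[symmetric] blinfun.add_right blinfun.scaleR_right)
    then show "r (\<mu> + \<nu>) = r \<mu> + r \<nu>" "r (s *\<^sub>R \<mu>) = s *\<^sub>R r \<mu>"
      using vector_eq_rdot by blast+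
  qed
  have r_bound: "norm (r \<mu>) \<le> norm \<mu> * norm B" for \<mu>
  proof (cases "r \<mu> = 0")
    case False
    have "(norm (r \<mu>))\<^sup>2 = B (r \<mu>) \<mu>" by (simp add: r power2_norm_eq_inner)
    also have "\<dots> \<le> norm (B (r \<mu>)) * norm \<mu>" using norm_blinfun[of "B (r \<mu>)" \<mu>] by simp
    also have "\<dots> \<le> norm B * norm (r \<mu>) * norm \<mu>" by (intro mult_right_mono norm_blinfun) simp
    finally show ?thesis using False by (simp add: power2_eq_square mult_ac)
  qed simp
  have bl: "bounded_linear r"
    by (rule bounded_linear_intro[OF r_linear r_bound])
  have r_below: "\<beta> * norm \<mu> \<le> norm (r \<mu>)" for \<mu>
  proof (cases "\<mu> = 0")
    case False
    then have "inf_sup_const B \<le> (SUP q\<in>UNIV - {0}. ereal (B q \<mu> / (norm q * norm \<mu>)))"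
      unfolding inf_sup_const_def by (intro INF_lower) auto
    with \<beta>(2) have "ereal \<beta> < (SUP q\<in>UNIV - {0}. ereal (B q \<mu> / (norm q * norm \<mu>)))" by (rule less_le_trans)
    then obtain q where q: "q \<noteq> 0" "\<beta> < B q \<mu> / (norm q * norm \<mu>)"
      unfolding less_SUP_iff by auto
    then have "\<beta> * (norm q * norm \<mu>) < B q \<mu>" using False by (simp add: pos_less_divide_eq)
    also have "\<dots> \<le> norm (r \<mu>) * norm q" unfolding r by (rule norm_cauchy_schwarz)
    finally have "norm q * (\<beta> * norm \<mu>) \<le> norm q * norm (r \<mu>)" by (simp add: mult_ac)
    then show ?thesis by (rule mult_left_le_imp_le) (use q in auto)
  next
    case True
    then show ?thesis by simp
  qed
  define a where "a = B o\<^sub>L Blinfun r"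
  have a: "a \<mu> \<nu> = r \<nu> \<bullet> r \<mu>" for \<mu> \<nu>
    by (simp add: a_def bounded_linear_Blinfun_apply[OF bl] r)
  have coercive: "\<beta>\<^sup>2 * (norm \<mu>)\<^sup>2 \<le> a \<mu> \<mu>" for \<mu>
    using power_mono[OF r_below[of \<mu>], of 2] \<beta>(1) by (simp add: a power2_norm_eq_inner power_mult_distrib)
  have ex: "\<exists>\<mu>. a \<mu> = \<phi>" for \<phi>
    by (rule symmetric_coercive_form_represents[of a "\<beta>\<^sup>2"]) (use coercive \<beta>(1) in \<open>auto simp: a inner_commute\<close>)
  have inj: "\<mu> = \<nu>" if "a \<mu> = a \<nu>" for \<mu> \<nu>
  proof -
    have "a (\<mu> - \<nu>) (\<mu> - \<nu>) = 0" using that by (simp add: blinfun.diff_right)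
    then show ?thesis using coercive[of "\<mu> - \<nu>"] \<beta>(1) by (simp add: mult_le_0_iff)
  qed
  obtain m where m: "\<And>\<phi>. a (m \<phi>) = \<phi>" using ex by metis
  have m_linear: "m (\<phi> + \<psi>) = m \<phi> + m \<psi>" "m (s *\<^sub>R \<phi>) = s *\<^sub>R m \<phi>" for \<phi> \<psi> s
    by (rule inj, simp add: m blinfun.add_right blinfun.scaleR_right)+
  have m_bound: "norm (m \<phi>) \<le> norm \<phi> * inverse (\<beta>\<^sup>2)" for \<phi>
  proof (cases "m \<phi> = 0")
    case False
    have "\<beta>\<^sup>2 * (norm (m \<phi>))\<^sup>2 \<le> norm \<phi> * norm (m \<phi>)"
      using coercive[of "m \<phi>"] norm_blinfun[of \<phi> "m \<phi>"] by (simp add: m)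
    then show ?thesis using False \<beta>(1) by (simp add: power2_eq_square field_simps)
  qed simp
  have "bounded_linear m" by (rule bounded_linear_intro[OF m_linear m_bound])
  then have apply_m: "blinfun_apply (Blinfun m) = m" by (rule bounded_linear_Blinfun_apply)
  show ?thesis
  proof
    show "B ((Blinfun r o\<^sub>L Blinfun m) \<phi>) = \<phi>" for \<phi>
      using m[of \<phi>] by (simp add: a_def apply_m)
  qed
qed

section \<open>Sobolev functions on an interval\<close>

lemma sobolev_weak_deriv:
  assumes "u \<in> sobolev_bochner k T" "j \<le> k"
  shows "weak_deriv T j u \<in> bochner_L2 T" "has_weak_deriv T j u (weak_deriv T j u)"
proof -
  have "\<exists>v. v \<in> bochner_L2 T \<and> has_weak_deriv T j u v"
    using assms unfolding sobolev_bochner_def by blast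
  from someI_ex[OF this] show "weak_deriv T j u \<in> bochner_L2 T" "has_weak_deriv T j u (weak_deriv T j u)"
    unfolding weak_deriv_def by blast+
qed

lemma sobolev_norm_nonneg: "0 \<le> sobolev_norm k T u"
  by (simp add: sobolev_norm_def sum_nonneg)

lemma integral_weak_deriv_le:
  assumes "u \<in> sobolev_bochner k T" "j \<le> k"
  shows "integral {0..T} (\<lambda>t. (norm (weak_deriv T j u t))\<^sup>2) \<le> (sobolev_norm k T u)\<^sup>2"
proof -
  have "integral {0..T} (\<lambda>t. (norm (weak_deriv T j u t))\<^sup>2) = (bochner_L2_norm T (weak_deriv T j u))\<^sup>2"
    by (simp add: bochner_L2_norm_def integral_nonneg bochner_L2_sq_integrable[OF sobolev_weak_deriv(1)[OF assms]])
  also have "\<dots> \<le> (\<Sum>j\<le>k. (bochner_L2_norm T (weak_deriv T j u))\<^sup>2)"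
    using assms(2) by (intro member_le_sum) auto
  finally show ?thesis by (simp add: sobolev_norm_def sum_nonneg)
qed

lemma integral_norm_weak_deriv_le:
  assumes "u \<in> sobolev_bochner k T" "j \<le> k" "0 < T"
  shows "integral {0..T} (\<lambda>t. norm (weak_deriv T j u t)) \<le> sqrt T * sobolev_norm k T u"
proof (rule power2_le_imp_le)
  note L2 = sobolev_weak_deriv(1)[OF assms(1,2)]
  have "(integral {0..T} (\<lambda>t. norm (weak_deriv T j u t)))\<^sup>2 \<le> T * integral {0..T} (\<lambda>t. (norm (weak_deriv T j u t))\<^sup>2)"
    using bochner_L2_increment[OF L2, of 0 T] assms(3) by simp
  also have "\<dots> \<le> T * (sobolev_norm k T u)\<^sup>2"
    using integral_weak_deriv_le[OF assms(1,2)] assms(3) by simp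
  finally show "(integral {0..T} (\<lambda>t. norm (weak_deriv T j u t)))\<^sup>2 \<le> (sqrt T * sobolev_norm k T u)\<^sup>2"
    using assms(3) by (simp add: power_mult_distrib)
qed (use assms(3) sobolev_norm_nonneg[of k T u] in simp)

lemma sobolev_continuous: "u \<in> sobolev_bochner k T \<Longrightarrow> 0 < k \<Longrightarrow> continuous_on {0..T} u"
  by (simp add: sobolev_bochner_def)

lemma sobolev_increment_bound:
  fixes u :: "real \<Rightarrow> 'x::banach"
  assumes T: "0 < T" and u: "u \<in> sobolev_bochner k T" "0 < k" and st: "0 \<le> s" "s \<le> t" "t \<le> T"
  shows "norm (u t - u s) \<le> integral {s..t} (\<lambda>r. norm (weak_deriv T 1 u r))"
proof -
  have k: "1 \<le> k" using u(2) by simp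
  note n = bochner_L2_norm_integrable[OF sobolev_weak_deriv(1)[OF u(1) k]]
  show ?thesis
    using weak_deriv1_increment_bound[OF T n sobolev_continuous[OF u] sobolev_weak_deriv(2)[OF u(1) k] st]
      norm_primitive_diff[OF T n st] by simp
qed

lemma sobolev_h1_energy_le:
  fixes u :: "real \<Rightarrow> 'x::banach"
  assumes T: "0 < T" and u: "u \<in> sobolev_bochner k T" "0 < k"
  shows "h1_energy_le T u ((sobolev_norm k T u)\<^sup>2)"
proof -
  have k: "1 \<le> k" using u(2) by simp
  show ?thesis
    by (rule h1_energy_le_trans[OF h1_energy_le_of_L2 integral_weak_deriv_le[OF u(1) k]])
      (use sobolev_increment_bound[OF T u] sobolev_weak_deriv[OF u(1) k] in auto)
qed

text \<open>Large enough for both the point values of an \<open>H\<^sup>1\<close> function and the derivative of an \<open>H\<^sup>2\<close>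
  function; the quotient \<open>4 / (bump_mass * T)\<close> bounds the height of a bump of mass one on \<open>[T/4, 3T/4]\<close>.\<close>

definition sobolev_const :: "real \<Rightarrow> real" where
  "sobolev_const T = (4 / (bump_mass * T) + 1) * sqrt T * (1 + 2 / T) + sqrt T"

lemma sobolev_const_pos: "0 < T \<Longrightarrow> 0 < sobolev_const T"
  unfolding sobolev_const_def using bump_mass_pos by (intro add_nonneg_pos) auto

text \<open>A point value differs from a fixed weighted average by at most the integral of \<open>\<parallel>u'\<parallel>\<close>.  The
  average is evaluated through the weak derivative of order \<open>0\<close>, since the Sobolev norm contains that
  representative instead of \<open>u\<close>.\<close>

lemma sobolev_point_bound:
  fixes u :: "real \<Rightarrow> 'x::banach"
  assumes T: "0 < T" and u: "u \<in> sobolev_bochner k T" "0 < k" and t: "t \<in> {0..T}"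
  shows "norm (u t) \<le> (4 / (bump_mass * T) + 1) * sqrt T * sobolev_norm k T u"
proof -
  have \<eta>: "0 < T / 4" using T by simp
  define M where "M = 4 / (bump_mass * T)"
  have M: "0 < M" using T bump_mass_pos by (simp add: M_def)
  let ?\<phi> = "\<lambda>x. inverse M * bump_at (T/4) (T/2) x"
  have z: "bump_at (T/4) (T/2) x = 0" if "x \<notin> {T/4..3*T/4}" for x
  proof -
    have "T / 4 \<le> \<bar>x - T / 2\<bar>" using that by (auto simp: abs_if field_simps)
    then show ?thesis by (rule bump_at_outside[OF \<eta>])
  qed
  have test: "?\<phi> \<in> test_functions T"
    by (rule test_functionsI[OF diff_upto_cmult[OF diff_upto_bump_at], of "T/4" "3*T/4"]) (use T z in auto)
  have bd: "\<bar>?\<phi> x\<bar> \<le> 1" for x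
  proof -
    have "bump_at (T/4) (T/2) x \<le> (1 / bump_mass) / (T/4)"
      unfolding bump_at_def using bump_le T by (intro divide_right_mono) auto
    also have "\<dots> = M" by (simp add: M_def)
    finally show ?thesis using bump_at_nonneg[OF \<eta>, of "T/2" x] M by (simp add: field_simps)
  qed
  let ?I = "integral {0..T} (\<lambda>x. bump_at (T/4) (T/2) x *\<^sub>R u x)"
  note c = sobolev_continuous[OF u]
  have "norm (inverse M *\<^sub>R ?I) \<le> integral {0..T} (\<lambda>t. norm (weak_deriv T 0 u t))"
  proof (rule weak_deriv_test_bound[OF _ test])
    show "((\<lambda>t. (deriv ^^ 0) ?\<phi> t *\<^sub>R u t) has_integral inverse M *\<^sub>R ?I) {0..T}"
      using has_integral_cmul[OF integrable_integral[OF bump_average_integrable[OF c, of "T/4" "T/2"]], of "inverse M"]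
      by simp
    show "?\<phi> x = 0" if "x \<notin> {0..T}" for x using z[of x] that T by auto
  qed (use sobolev_weak_deriv[OF u(1), of 0] bochner_L2_norm_integrable bd in auto)
  also have "\<dots> \<le> sqrt T * sobolev_norm k T u" by (rule integral_norm_weak_deriv_le[OF u(1) _ T]) simp
  finally have 1: "norm ?I \<le> M * sqrt T * sobolev_norm k T u" using M by (simp add: field_simps)
  have k: "1 \<le> k" using u(2) by simp
  note n = bochner_L2_norm_integrable[OF sobolev_weak_deriv(1)[OF u(1) k]]
  have "norm (?I - u t) \<le> integral {0..T} (\<lambda>r. norm (weak_deriv T 1 u r))"
  proof (rule bump_average_near[OF c])
    fix x assume x: "x \<in> {0..T}"
    have *: "norm (u b - u a) \<le> integral {0..T} (\<lambda>r. norm (weak_deriv T 1 u r))" if "0 \<le> a" "a \<le> b" "b \<le> T" for a b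
    proof -
      have "integral {a..b} (\<lambda>r. norm (weak_deriv T 1 u r)) \<le> integral {0..T} (\<lambda>r. norm (weak_deriv T 1 u r))"
        by (rule integral_subset_le) (use that n integrable_subinterval_real[OF n] in auto)
      with sobolev_increment_bound[OF T u that] show ?thesis by linarith
    qed
    show "norm (u x - u t) \<le> integral {0..T} (\<lambda>r. norm (weak_deriv T 1 u r))"
      using *[of x t] *[of t x] x t by (cases "x \<le> t") (auto simp: norm_minus_commute)
  qed (use T in auto)
  also have "\<dots> \<le> sqrt T * sobolev_norm k T u" by (rule integral_norm_weak_deriv_le[OF u(1) k T])
  finally show ?thesis
    unfolding M_def[symmetric] using 1 norm_triangle_ineq3[of ?I "u t"] by (simp add: algebra_simps)
qed

lemma sobolev_embedding:
  fixes u :: "real \<Rightarrow> 'x::banach"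
  assumes T: "0 < T" and u: "u \<in> sobolev_bochner k T" "0 < k" and t: "t \<in> {0..T}"
  shows "norm (u t) \<le> sobolev_const T * sobolev_norm k T u"
proof (rule order_trans[OF sobolev_point_bound[OF assms] mult_right_mono])
  define a where "a = (4 / (bump_mass * T) + 1) * sqrt T"
  have "0 \<le> a" using T bump_mass_pos by (simp add: a_def)
  then have "0 \<le> a * (2 / T)" "0 \<le> sqrt T" using T by auto
  then have "a \<le> a * (1 + 2 / T) + sqrt T" unfolding distrib_left by linarith
  then show "(4 / (bump_mass * T) + 1) * sqrt T \<le> sobolev_const T" unfolding sobolev_const_def a_def .
qed (rule sobolev_norm_nonneg)

text \<open>The derivative differs from the mean slope over \<open>[0, T]\<close> by at most the integral of the norm of
  the second derivative.\<close>

lemma sobolev2_C1: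
  fixes u :: "real \<Rightarrow> 'x::banach"
  assumes T: "0 < T" and u: "u \<in> sobolev_bochner 2 T"
  obtains G where "\<And>t. t \<in> {0..T} \<Longrightarrow> (u has_vector_derivative G t) (at t within {0..T})"
    and "h1_energy_le T G ((sobolev_norm 2 T u)\<^sup>2)"
    and "\<And>t. t \<in> {0..T} \<Longrightarrow> norm (G t) \<le> sobolev_const T * sobolev_norm 2 T u"
proof -
  let ?v = "weak_deriv T 2 u" let ?N = "\<lambda>t. integral {0..t} (\<lambda>s. norm (?v s))"
  note L2 = sobolev_weak_deriv(1)[OF u order_refl]
  note n = bochner_L2_norm_integrable[OF L2] and c = sobolev_continuous[OF u, simplified]
  obtain G where G: "\<And>t. t \<in> {0..T} \<Longrightarrow> (u has_vector_derivative G t) (at t within {0..T})"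
    "\<And>s t. \<lbrakk>0 \<le> s; s \<le> t; t \<le> T\<rbrakk> \<Longrightarrow> norm (G t - G s) \<le> ?N t - ?N s"
    "\<And>t. t \<in> {0..T} \<Longrightarrow> norm (G t - (u T - u 0) /\<^sub>R T) \<le> ?N T - ?N 0"
  proof (rule slope_bound_imp_C1[OF T norm_primitive_continuous[OF T n], of u])
    show "norm ((u b - u a) /\<^sub>R (b - a) - (u d - u c) /\<^sub>R (d - c)) \<le> ?N r - ?N l"
      if "0 \<le> l" "l \<le> a" "a < b" "b \<le> r" "l \<le> c" "c < d" "d \<le> r" "r \<le> T" for l r a b c d
      by (rule weak_deriv2_slope_bound[OF T n c sobolev_weak_deriv(2)[OF u order_refl] that])
  qed (rule that)
  show ?thesis
  proof (rule that[OF G(1)])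
    show "h1_energy_le T G ((sobolev_norm 2 T u)\<^sup>2)"
      by (rule h1_energy_le_trans[OF h1_energy_le_of_L2[OF L2] integral_weak_deriv_le[OF u order_refl]])
        (metis norm_primitive_diff[OF T n] G(2))
    fix t assume t: "t \<in> {0..T}"
    define a where "a = (4 / (bump_mass * T) + 1) * sqrt T"
    have a: "norm (u x) \<le> a * sobolev_norm 2 T u" if "x \<in> {0..T}" for x
      unfolding a_def by (rule sobolev_point_bound[OF T u _ that]) simp
    have a0: "0 \<le> a" using T bump_mass_pos by (simp add: a_def)
    have "norm (u T - u 0) \<le> 2 * a * sobolev_norm 2 T u"
      using a[of T] a[of 0] T norm_triangle_ineq4[of "u T" "u 0"] by simp
    then have "inverse T * norm (u T - u 0) \<le> inverse T * (2 * a * sobolev_norm 2 T u)"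
      using T by (intro mult_left_mono) auto
    then have "norm ((u T - u 0) /\<^sub>R T) \<le> a * (2 / T) * sobolev_norm 2 T u"
      unfolding norm_scaleR using T by (simp add: divide_inverse mult_ac)
    moreover have "norm (G t - (u T - u 0) /\<^sub>R T) \<le> sqrt T * sobolev_norm 2 T u"
      using G(3)[OF t] integral_norm_weak_deriv_le[OF u order_refl T] by simp
    moreover have "0 \<le> a * sobolev_norm 2 T u" using a0 sobolev_norm_nonneg[of 2 T u] by simp
    ultimately have "norm (G t) \<le> (a * (1 + 2 / T) + sqrt T) * sobolev_norm 2 T u"
      using norm_triangle_sub[of "G t" "(u T - u 0) /\<^sub>R T"] by (simp add: algebra_simps)
    then show "norm (G t) \<le> sobolev_const T * sobolev_norm 2 T u" unfolding sobolev_const_def a_def .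
  qed
qed

lemma C1_has_weak_deriv:
  fixes W :: "real \<Rightarrow> 'x::banach"
  assumes T: "0 < T" and W: "\<And>t. t \<in> {0..T} \<Longrightarrow> (W has_vector_derivative w t) (at t within {0..T})"
  shows "has_weak_deriv T 1 W w"
  unfolding has_weak_deriv_def
proof
  fix \<phi> assume \<phi>: "\<phi> \<in> test_functions T"
  then have "(deriv ^^ 0) \<phi> differentiable_on UNIV" and ends: "\<phi> 0 = 0" "\<phi> T = 0"
    unfolding test_functions_def by (blast, auto)
  then have "diff_upto 0 \<phi>" by (simp add: diff_upto_0)
  then have d: "(\<phi> has_real_derivative deriv \<phi> t) (at t within {0..T})" for t
    by (intro DERIV_subset[OF diff_upto_DERIV]) auto
  have "((\<lambda>t. \<phi> t *\<^sub>R w t + deriv \<phi> t *\<^sub>R W t) has_integral \<phi> T *\<^sub>R W T - \<phi> 0 *\<^sub>R W 0) {0..T}"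
    using T by (intro fundamental_theorem_of_calculus has_vector_derivative_scaleR d W) auto
  then show "((\<lambda>t. (deriv ^^ 1) \<phi> t *\<^sub>R W t - ((- 1) ^ 1 * \<phi> t) *\<^sub>R w t) has_integral 0) {0..T}"
    by (simp add: ends add.commute)
qed

text \<open>Subtracting the primitive of a continuous function \<open>w\<close> near \<open>v\<close> leaves a function whose weak
  derivative is small in mean square, hence whose increments are small.\<close>

lemma weak_deriv1_imp_integral:
  fixes u v :: "real \<Rightarrow> real"
  assumes T: "0 < T" and u: "continuous_on {0..T} u" and wd: "has_weak_deriv T 1 u v"
    and v: "v \<in> bochner_L2 T" and t: "0 \<le> t" "t \<le> T"
  shows "u t - u 0 = integral {0..t} v"
proof -
  have vi: "v integrable_on {0..T}" using bochner_L2_blinfun_integrable[OF v, of id_blinfun] by simp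
  have "\<bar>u t - u 0 - integral {0..t} v\<bar> \<le> 0 + e" if e: "0 < e" for e
  proof -
    obtain w where w: "continuous_on UNIV w" "integral {0..T} (\<lambda>t. (norm (v t - w t))\<^sup>2) \<le> (e / 2)\<^sup>2 / T"
      using continuous_dense_in_bochner_L2[OF v, of "(e / 2)\<^sup>2 / T"] e T by auto
    have wc: "continuous_on {a..b} w" for a b using w(1) continuous_on_subset by blast
    define W where "W t = integral {0..t} w" for t
    have W: "(W has_vector_derivative w t) (at t within {0..T})" if "t \<in> {0..T}" for t
      unfolding W_def[abs_def] by (rule integral_has_vector_derivative[OF wc that])
    have L2: "(\<lambda>t. v t - w t) \<in> bochner_L2 T" by (intro bochner_L2_diff v continuous_in_bochner_L2 wc)
    note n = bochner_L2_norm_integrable[OF L2]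
    let ?I = "integral {0..t} (\<lambda>t. norm (v t - w t))"
    have "?I\<^sup>2 \<le> t * integral {0..t} (\<lambda>t. (norm (v t - w t))\<^sup>2)"
      using bochner_L2_increment[OF L2, of 0 t] t by simp
    also have "\<dots> \<le> T * ((e / 2)\<^sup>2 / T)"
    proof (rule mult_mono[OF t(2) order_trans[OF integral_subset_le w(2)]])
      show "0 \<le> integral {0..t} (\<lambda>t. (norm (v t - w t))\<^sup>2)"
        by (rule integral_nonneg) (use integrable_subinterval_real[OF bochner_L2_sq_integrable[OF L2], of 0 t] t in auto)
    qed (use T t bochner_L2_sq_integrable[OF L2] integrable_subinterval_real[OF bochner_L2_sq_integrable[OF L2], of 0 t] in auto)
    finally have I: "?I \<le> e / 2" using T e by (intro power2_le_imp_le[of ?I]) auto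
    have "has_weak_deriv T 1 (\<lambda>t. u t - W t) (\<lambda>t. v t - w t)"
      unfolding has_weak_deriv_def
    proof
      fix \<phi> assume "\<phi> \<in> test_functions T"
      with has_integral_diff[OF wd[unfolded has_weak_deriv_def, rule_format]
          C1_has_weak_deriv[OF T W, unfolded has_weak_deriv_def, rule_format]]
      show "((\<lambda>t. (deriv ^^ 1) \<phi> t *\<^sub>R (u t - W t) - ((- 1) ^ 1 * \<phi> t) *\<^sub>R (v t - w t)) has_integral 0) {0..T}"
        by (simp add: algebra_simps)
    qed
    from weak_deriv1_increment_bound[OF T n _ this, of 0 t]
    have 1: "norm ((u t - W t) - (u 0 - W 0)) \<le> ?I"
      using t continuous_on_diff[OF u continuous_on_vector_derivative[OF W]] by auto
    have sub: "v integrable_on {0..t}" "w integrable_on {0..t}"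
      using integrable_subinterval_real[OF vi, of 0 t] integrable_continuous_interval[OF wc] t by auto
    have "norm (integral {0..t} (\<lambda>t. v t - w t)) \<le> ?I"
      by (rule Henstock_Kurzweil_Integration.integral_norm_bound_integral)
        (use sub integrable_subinterval_real[OF n, of 0 t] t in \<open>auto intro: integrable_diff\<close>)
    then have "\<bar>integral {0..t} v - W t\<bar> \<le> ?I"
      using Henstock_Kurzweil_Integration.integral_diff[OF sub] by (simp add: W_def)
    moreover have "\<bar>u t - W t - u 0\<bar> \<le> ?I" using 1 by (simp add: W_def)
    ultimately show ?thesis using I by linarith
  qed
  then have "\<bar>u t - u 0 - integral {0..t} v\<bar> \<le> 0" by (rule field_le_epsilon)
  then show ?thesis by simp
qed

section \<open>Weak primitives\<close>

text \<open>The primitive in the sense of Pettis.  For square-integrable functions with values in a Hilbert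
  space it exists by Riesz, also without separability.\<close>

definition weak_primitive :: "real \<Rightarrow> (real \<Rightarrow> 'x::real_normed_vector) \<Rightarrow> (real \<Rightarrow> 'x) \<Rightarrow> bool" where
  "weak_primitive T u U \<longleftrightarrow> (\<forall>t\<in>{0..T}. \<forall>\<phi> :: 'x \<Rightarrow>\<^sub>L real. ((\<lambda>s. \<phi> (u s)) has_integral \<phi> (U t)) {0..t})"

lemma weak_primitiveD:
  fixes \<phi> :: "'x::real_normed_vector \<Rightarrow>\<^sub>L real" shows
  "weak_primitive T u U \<Longrightarrow> 0 \<le> t \<Longrightarrow> t \<le> T \<Longrightarrow> ((\<lambda>s. blinfun_apply \<phi> (u s)) has_integral \<phi> (U t)) {0..t}"
  by (simp add: weak_primitive_def)

text \<open>The integral of the inner product with \<open>x\<close> is a bounded functional of \<open>x\<close>; the primitive is its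
  Riesz representative.\<close>

lemma weak_primitive_exists:
  fixes u :: "real \<Rightarrow> 'x::{real_inner,banach}"
  assumes u: "u \<in> bochner_L2 T" obtains U where "weak_primitive T u U"
proof -
  have "\<exists>y. \<forall>\<phi> :: 'x \<Rightarrow>\<^sub>L real. ((\<lambda>s. \<phi> (u s)) has_integral \<phi> y) {0..t}" if "t \<in> {0..T}" for t
  proof -
    have int: "(\<lambda>s. \<phi> (u s)) integrable_on {0..t}" for \<phi> :: "'x \<Rightarrow>\<^sub>L real"
      by (rule integrable_subinterval_real[OF bochner_L2_blinfun_integrable[OF u]]) (use that in auto)
    have int': "(\<lambda>s. x \<bullet> u s) integrable_on {0..t}" for x
      using int[of "blinfun_inner_right x"] by simp
    have nint: "(\<lambda>s. norm (u s)) integrable_on {0..t}"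
      by (rule integrable_subinterval_real[OF bochner_L2_norm_integrable[OF u]]) (use that in auto)
    have "bounded_linear (\<lambda>x. integral {0..t} (\<lambda>s. x \<bullet> u s))"
    proof (rule bounded_linear_intro)
      show "norm (integral {0..t} (\<lambda>s. x \<bullet> u s)) \<le> norm x * integral {0..t} (\<lambda>s. norm (u s))" for x
        using Henstock_Kurzweil_Integration.integral_norm_bound_integral[OF int'[of x] integrable_on_mult_right[OF nint, of "norm x"]]
          Cauchy_Schwarz_ineq2 by auto
    qed (simp_all add: inner_add_left Henstock_Kurzweil_Integration.integral_add int')
    then obtain y where y: "\<And>x. integral {0..t} (\<lambda>s. x \<bullet> u s) = y \<bullet> x"
      using riesz_representation[of "Blinfun (\<lambda>x. integral {0..t} (\<lambda>s. x \<bullet> u s))"] bounded_linear_Blinfun_apply by metis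
    have "((\<lambda>s. \<phi> (u s)) has_integral \<phi> y) {0..t}" for \<phi> :: "'x \<Rightarrow>\<^sub>L real"
    proof -
      obtain x where x: "\<And>z. \<phi> z = x \<bullet> z" using riesz_representation[of \<phi>] by blast
      then show ?thesis using integrable_integral[OF int', of x] y[of x] by (simp add: inner_commute)
    qed
    then show ?thesis by blast
  qed
  then show ?thesis using that unfolding weak_primitive_def by metis
qed

lemma weak_primitive_diff:
  "weak_primitive T u U \<Longrightarrow> weak_primitive T w W \<Longrightarrow> weak_primitive T (\<lambda>t. u t - w t) (\<lambda>t. U t - W t)"
  unfolding weak_primitive_def by (auto simp: blinfun.diff_right intro!: has_integral_diff)

lemma weak_primitive_segment:
  fixes \<phi> :: "'x::real_normed_vector \<Rightarrow>\<^sub>L real"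
  assumes U: "weak_primitive T u U" and st: "0 \<le> s" "s \<le> t" "t \<le> T"
  shows "((\<lambda>r. blinfun_apply \<phi> (u r)) has_integral \<phi> (U t - U s)) {s..t}"
proof -
  note h = weak_primitiveD[OF U, of _ \<phi>]
  have "(\<lambda>r. \<phi> (u r)) integrable_on {0..t}" using h[of t] st by (auto simp: integrable_on_def)
  then have "integral {0..s} (\<lambda>r. \<phi> (u r)) + integral {s..t} (\<lambda>r. \<phi> (u r)) = integral {0..t} (\<lambda>r. \<phi> (u r))"
    and "(\<lambda>r. \<phi> (u r)) integrable_on {s..t}"
    using Henstock_Kurzweil_Integration.integral_combine[OF st(1,2)] st
      integrable_subinterval_real[of "\<lambda>r. \<phi> (u r)" 0 t s t] by simp_all
  then show ?thesis using h[of s] h[of t] st by (simp add: has_integral_iff blinfun.diff_right)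
qed

lemma weak_primitive_increment_bound:
  fixes u :: "real \<Rightarrow> 'x::real_inner"
  assumes U: "weak_primitive T u U" and u: "u \<in> bochner_L2 T" and st: "0 \<le> s" "s \<le> t" "t \<le> T"
  shows "norm (U t - U s) \<le> integral {s..t} (\<lambda>r. norm (u r))"
proof (cases "U t = U s")
  case True
  have "0 \<le> integral {s..t} (\<lambda>r. norm (u r))"
    by (rule integral_nonneg) (use integrable_subinterval_real[OF bochner_L2_norm_integrable[OF u]] st in auto)
  then show ?thesis using True by simp
next
  case False
  let ?d = "U t - U s"
  have nint: "(\<lambda>r. norm (u r)) integrable_on {s..t}"
    using integrable_subinterval_real[OF bochner_L2_norm_integrable[OF u]] st by auto
  have "((\<lambda>r. ?d \<bullet> u r) has_integral ?d \<bullet> ?d) {s..t}"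
    using weak_primitive_segment[OF U st, of "blinfun_inner_right ?d"] by simp
  then have "?d \<bullet> ?d \<le> integral {s..t} (\<lambda>r. norm ?d * norm (u r))"
    using integrable_on_mult_right[OF nint, of "norm ?d"] norm_cauchy_schwarz
    by (metis (no_types, lifting) has_integral_iff integral_le)
  then have "norm ?d * norm ?d \<le> norm ?d * integral {s..t} (\<lambda>r. norm (u r))"
    by (simp add: power2_norm_eq_inner[symmetric] power2_eq_square)
  then show ?thesis using False by simp
qed

lemma weak_primitive_h1_energy_le:
  fixes u :: "real \<Rightarrow> 'x::real_inner"
  assumes "weak_primitive T u U" "u \<in> bochner_L2 T"
  shows "h1_energy_le T U (int_sq {0..T} u)"
  by (rule h1_energy_le_of_L2[OF assms(2) weak_primitive_increment_bound[OF assms]])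

lemma weak_primitive_continuous_integral:
  fixes w :: "real \<Rightarrow> 'x::banach"
  assumes "continuous_on {0..T} w"
  shows "weak_primitive T w (\<lambda>t. integral {0..t} w)"
  unfolding weak_primitive_def
proof (intro ballI allI)
  fix t and \<phi> :: "'x \<Rightarrow>\<^sub>L real" assume "t \<in> {0..T}"
  then have "w integrable_on {0..t}"
    by (intro integrable_continuous_interval continuous_on_subset[OF assms]) auto
  from has_integral_linear[OF integrable_integral[OF this] blinfun.bounded_linear_right[of \<phi>]]
  show "((\<lambda>s. \<phi> (w s)) has_integral \<phi> (integral {0..t} w)) {0..t}" by (simp add: o_def)
qed

lemma power2_sum_weighted_le:
  fixes x s \<kappa> :: real assumes "0 < \<kappa>"
  shows "(x + s)\<^sup>2 \<le> (1 + \<kappa>) * x\<^sup>2 + (1 + 1 / \<kappa>) * s\<^sup>2"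
proof -
  have "0 \<le> (\<kappa> * x - s)\<^sup>2 / \<kappa>" using assms by simp
  also have "\<dots> = \<kappa> * x\<^sup>2 - 2 * x * s + s\<^sup>2 / \<kappa>"
    using assms by (simp add: power2_eq_square field_simps)
  finally show ?thesis by (simp add: power2_eq_square algebra_simps)
qed

lemma power2_norm_sum_le:
  fixes a b c d :: "'x::real_normed_vector" and \<kappa> :: real
  assumes "0 < \<kappa>"
  shows "(norm (a + b + c + d))\<^sup>2 \<le> (1 + \<kappa>) * (norm a)\<^sup>2 + 3 * (1 + 1 / \<kappa>) * ((norm b)\<^sup>2 + (norm c)\<^sup>2 + (norm d)\<^sup>2)"
proof -
  define s where "s = norm b + norm c + norm d"
  have "norm (a + b + c + d) \<le> norm a + s"
    using norm_triangle_ineq[of "a + b + c" d] norm_triangle_ineq[of "a + b" c] norm_triangle_ineq[of a b]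
    unfolding s_def by linarith
  then have "(norm (a + b + c + d))\<^sup>2 \<le> (norm a + s)\<^sup>2" by (intro power_mono) auto
  also have "\<dots> \<le> (1 + \<kappa>) * (norm a)\<^sup>2 + (1 + 1 / \<kappa>) * s\<^sup>2" by (rule power2_sum_weighted_le[OF assms])
  also have "\<dots> \<le> (1 + \<kappa>) * (norm a)\<^sup>2 + (1 + 1 / \<kappa>) * (3 * ((norm b)\<^sup>2 + (norm c)\<^sup>2 + (norm d)\<^sup>2))"
  proof (intro add_left_mono mult_left_mono)
    show "s\<^sup>2 \<le> 3 * ((norm b)\<^sup>2 + (norm c)\<^sup>2 + (norm d)\<^sup>2)"
      using zero_le_power2[of "norm b - norm c"] zero_le_power2[of "norm b - norm d"] zero_le_power2[of "norm c - norm d"]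
      by (simp add: s_def power2_eq_square algebra_simps)
  qed (use assms in simp)
  finally show ?thesis by (simp only: mult_ac)
qed

text \<open>A replacement for the almost everywhere convergence of the difference quotients of a primitive.
  For a continuous function \<open>w\<close> near \<open>u\<close> in mean square, the quotients of the primitive of \<open>w\<close>
  converge uniformly to \<open>w\<close>, while those of the primitive of \<open>u - w\<close> are small in mean square for
  every step.  The error terms are weighted with \<open>1 + 1/\<kappa>\<close> in order to keep the constant one in front
  of \<open>L\<close>.\<close>

lemma difference_quotients_bound_L2:
  fixes u :: "real \<Rightarrow> 'x::{real_inner,banach}"
  assumes u: "u \<in> bochner_L2 T" and U: "weak_primitive T u U" and \<tau>: "0 \<le> \<tau>" "\<tau> < T"
    and L: "\<forall>\<^sub>F \<delta> in at_right 0. integral {0..\<tau>} (\<lambda>t. (norm ((U (t + \<delta>) - U t) /\<^sub>R \<delta>))\<^sup>2) \<le> L"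
  shows "int_sq {0..\<tau>} u \<le> L"
proof -
  have bound: "int_sq {0..\<tau>} u \<le> (1 + \<kappa>) * L + 3 * (\<kappa>\<^sup>2 + \<kappa>) * (2 + T)" if \<kappa>: "0 < \<kappa>" for \<kappa>
  proof -
    obtain w where w: "continuous_on UNIV w" "integral {0..T} (\<lambda>t. (norm (u t - w t))\<^sup>2) \<le> \<kappa>\<^sup>2"
      using continuous_dense_in_bochner_L2[OF u, of "\<kappa>\<^sup>2"] \<kappa> by auto
    have wc: "continuous_on {a..b} w" for a b using w(1) continuous_on_subset by blast
    define W where "W t = integral {0..t} w" for t
    have W: "weak_primitive T w W"
      unfolding W_def[abs_def] by (rule weak_primitive_continuous_integral[OF wc])
    have L2: "(\<lambda>t. u t - w t) \<in> bochner_L2 T" by (intro bochner_L2_diff u continuous_in_bochner_L2 wc)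
    obtain \<rho> where \<rho>: "0 < \<rho>" "\<And>x y. x \<in> {0..T} \<Longrightarrow> y \<in> {0..T} \<Longrightarrow> dist y x < \<rho> \<Longrightarrow> dist (w y) (w x) < \<kappa>"
      using compact_uniformly_continuous[OF wc[of 0 T]] \<kappa> unfolding uniformly_continuous_on_def by (metis compact_Icc)
    have "\<forall>\<^sub>F \<delta> in at_right 0. 0 < \<delta> \<and> \<delta> < \<rho> \<and> \<tau> + \<delta> \<le> T"
      by (rule eventually_at_rightI[of 0 "min \<rho> (T - \<tau>)"]) (use \<rho>(1) \<tau> in auto)
    from eventually_happens'[OF trivial_limit_at_right_real eventually_conj[OF this L]]
    obtain \<delta> where \<delta>: "0 < \<delta>" "\<delta> < \<rho>" "\<tau> + \<delta> \<le> T"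
      and L\<delta>: "integral {0..\<tau>} (\<lambda>t. (norm ((U (t + \<delta>) - U t) /\<^sub>R \<delta>))\<^sup>2) \<le> L" by blast
    let ?q = "\<lambda>V t. (V (t + \<delta>) - V t) /\<^sub>R \<delta>"
    have Uc: "continuous_on {0..T} U" "continuous_on {0..T} W"
      using h1_energy_le_continuous weak_primitive_h1_energy_le[OF U u]
        weak_primitive_h1_energy_le[OF W continuous_in_bochner_L2[OF wc]] by blast+
    note sh = continuous_on_shift[OF Uc(1) less_imp_le[OF \<delta>(1)] \<delta>(3)] continuous_on_shift[OF Uc(2) less_imp_le[OF \<delta>(1)] \<delta>(3)]
    have e1: "integral {0..\<tau>} (\<lambda>t. (norm (?q W t - ?q U t))\<^sup>2) \<le> \<kappa>\<^sup>2"
    proof -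
      let ?V = "\<lambda>t. U t - W t"
      have "integral {0..\<tau>} (\<lambda>t. (norm (?V (t + \<delta>) - ?V t))\<^sup>2) \<le> \<delta>\<^sup>2 * \<kappa>\<^sup>2"
        using h1_energy_difference_integral[OF h1_energy_le_trans[OF
            weak_primitive_h1_energy_le[OF weak_primitive_diff[OF U W] L2] w(2)] \<delta>(1) \<tau>(1) \<delta>(3)] .
      moreover have "(norm (?q W t - ?q U t))\<^sup>2 = inverse (\<delta>\<^sup>2) * (norm (?V (t + \<delta>) - ?V t))\<^sup>2" for t
      proof -
        have "?q W t - ?q U t = - (?V (t + \<delta>) - ?V t) /\<^sub>R \<delta>" by (simp add: algebra_simps)
        then show ?thesis using \<delta>(1) by (simp add: power_mult_distrib norm_minus_commute power_inverse del: scaleR_minus_right minus_diff_eq)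
      qed
      ultimately have "integral {0..\<tau>} (\<lambda>t. (norm (?q W t - ?q U t))\<^sup>2) \<le> inverse (\<delta>\<^sup>2) * (\<delta>\<^sup>2 * \<kappa>\<^sup>2)"
        using \<delta>(1) by (simp only: integral_mult_right) (intro mult_left_mono, auto)
      moreover have "inverse (\<delta>\<^sup>2) * (\<delta>\<^sup>2 * \<kappa>\<^sup>2) = \<kappa>\<^sup>2" using \<delta>(1) by simp
      ultimately show ?thesis by linarith
    qed
    have e2: "(norm (w t - ?q W t))\<^sup>2 \<le> \<kappa>\<^sup>2" if t: "t \<in> {0..\<tau>}" for t
    proof -
      have "W (t + \<delta>) - W t = integral {t..t + \<delta>} w"
        using Henstock_Kurzweil_Integration.integral_combine[of 0 t "t + \<delta>" w] integrable_continuous_interval[OF wc] t \<delta>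
        by (simp add: W_def algebra_simps)
      also have "\<dots> - \<delta> *\<^sub>R w t = integral {t..t + \<delta>} (\<lambda>s. w s - w t)"
        using \<delta>(1) Henstock_Kurzweil_Integration.integral_diff[OF integrable_continuous_interval[OF wc] integrable_const_ivl, of t "t + \<delta>" "w t"]
        by simp
      finally have eq: "W (t + \<delta>) - W t - \<delta> *\<^sub>R w t = integral {t..t + \<delta>} (\<lambda>s. w s - w t)" .
      have "norm (integral {t..t + \<delta>} (\<lambda>s. w s - w t)) \<le> \<kappa> * (t + \<delta> - t)"
      proof (rule integral_bound)
        show "norm (w s - w t) \<le> \<kappa>" if "s \<in> {t..t + \<delta>}" for s
          using \<rho>(2)[of t s] that t \<delta> by (auto simp: dist_norm dist_real_def)
      qed (use \<delta> in \<open>auto intro!: continuous_intros wc\<close>)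
      then have "norm (W (t + \<delta>) - W t - \<delta> *\<^sub>R w t) \<le> \<kappa> * \<delta>" by (simp add: eq)
      moreover have "w t - ?q W t = - (W (t + \<delta>) - W t - \<delta> *\<^sub>R w t) /\<^sub>R \<delta>"
        using \<delta>(1) by (simp add: algebra_simps)
      ultimately have "norm (w t - ?q W t) \<le> \<kappa>"
        using \<delta>(1) by (simp add: field_simps del: scaleR_minus_right minus_diff_eq)
      then show ?thesis by (intro power_mono) auto
    qed
    have e3: "integral {0..\<tau>} (\<lambda>t. (norm (u t - w t))\<^sup>2) \<le> \<kappa>\<^sup>2"
      using integral_subset_le[of "{0..\<tau>}" "{0..T}" "\<lambda>t. (norm (u t - w t))\<^sup>2"] w(2) \<tau>
        integrable_subinterval_real[OF bochner_L2_sq_integrable[OF L2], of 0 \<tau>] bochner_L2_sq_integrable[OF L2] by force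
    have i: "(\<lambda>t. (norm (u t - w t))\<^sup>2) integrable_on {0..\<tau>}" "(\<lambda>t. (norm (u t))\<^sup>2) integrable_on {0..\<tau>}"
      using \<tau> by (auto intro!: integrable_subinterval_real[OF bochner_L2_sq_integrable[OF L2]]
          integrable_subinterval_real[OF bochner_L2_sq_integrable[OF u]])
    have ci: "(\<lambda>t. (norm (?q U t))\<^sup>2) integrable_on {0..\<tau>}" "(\<lambda>t. (norm (?q W t - ?q U t))\<^sup>2) integrable_on {0..\<tau>}"
      by (intro integrable_continuous_interval continuous_intros sh)+
    let ?K = "3 * (1 + 1 / \<kappa>)"
    have "int_sq {0..\<tau>} u \<le> integral {0..\<tau>} (\<lambda>t. (1 + \<kappa>) * (norm (?q U t))\<^sup>2 +
        ?K * ((norm (?q W t - ?q U t))\<^sup>2 + \<kappa>\<^sup>2 + (norm (u t - w t))\<^sup>2))"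
    proof (rule integral_le[OF i(2)])
      show "(\<lambda>t. (1 + \<kappa>) * (norm (?q U t))\<^sup>2 + ?K * ((norm (?q W t - ?q U t))\<^sup>2 + \<kappa>\<^sup>2 + (norm (u t - w t))\<^sup>2))
        integrable_on {0..\<tau>}"
        by (intro integrable_add integrable_on_mult_right integrable_const_ivl i ci)
      fix t assume t: "t \<in> {0..\<tau>}"
      have "u t = ?q U t + (?q W t - ?q U t) + (w t - ?q W t) + (u t - w t)" by simp
      then have "(norm (u t))\<^sup>2 \<le> (1 + \<kappa>) * (norm (?q U t))\<^sup>2 +
        ?K * ((norm (?q W t - ?q U t))\<^sup>2 + (norm (w t - ?q W t))\<^sup>2 + (norm (u t - w t))\<^sup>2)"
        using power2_norm_sum_le[OF \<kappa>] by metis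
      also have "\<dots> \<le> (1 + \<kappa>) * (norm (?q U t))\<^sup>2 + ?K * ((norm (?q W t - ?q U t))\<^sup>2 + \<kappa>\<^sup>2 + (norm (u t - w t))\<^sup>2)"
        using e2[OF t] \<kappa> by (intro add_left_mono mult_left_mono) auto
      finally show "(norm (u t))\<^sup>2 \<le> \<dots>" .
    qed
    also have "\<dots> = (1 + \<kappa>) * integral {0..\<tau>} (\<lambda>t. (norm (?q U t))\<^sup>2) +
        ?K * (integral {0..\<tau>} (\<lambda>t. (norm (?q W t - ?q U t))\<^sup>2) + \<tau> * \<kappa>\<^sup>2 + integral {0..\<tau>} (\<lambda>t. (norm (u t - w t))\<^sup>2))"
      using \<tau>(1) has_integral_const_real[of "\<kappa>\<^sup>2" 0 \<tau>]
      by (intro integral_unique has_integral_add has_integral_mult_right integrable_integral i ci) auto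
    also have "\<dots> \<le> (1 + \<kappa>) * L + ?K * (\<kappa>\<^sup>2 + T * \<kappa>\<^sup>2 + \<kappa>\<^sup>2)"
      by (intro add_mono mult_left_mono e1 e3 L\<delta> mult_right_mono) (use \<kappa> \<tau> in auto)
    also have "?K * (\<kappa>\<^sup>2 + T * \<kappa>\<^sup>2 + \<kappa>\<^sup>2) = 3 * (\<kappa>\<^sup>2 + \<kappa>) * (2 + T)"
      using \<kappa> by (simp add: field_simps power2_eq_square)
    finally show ?thesis .
  qed
  have "((\<lambda>\<kappa>. (1 + \<kappa>) * L + 3 * (\<kappa>\<^sup>2 + \<kappa>) * (2 + T)) \<longlongrightarrow> (1 + 0) * L + 3 * (0\<^sup>2 + 0) * (2 + T)) (at_right 0)"
    by (intro tendsto_intros)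
  then have "int_sq {0..\<tau>} u \<le> (1 + 0) * L + 3 * (0\<^sup>2 + 0) * (2 + T)"
    by (rule tendsto_lowerbound) (use bound in \<open>auto simp: eventually_at_right_less intro: eventually_mono[OF eventually_at_right_less]\<close>)
  then show ?thesis by simp
qed

section \<open>Energy estimates for differences in time\<close>

lemma bound_at_right_end:
  fixes f :: "real \<Rightarrow> real"
  assumes "0 < T" "continuous_on {0..T} f" "\<And>t. 0 \<le> t \<Longrightarrow> t < T \<Longrightarrow> f t \<le> X" "t \<in> {0..T}"
  shows "f t \<le> X"
  by (rule continuous_le_on_closure[where S = "{0..<T}" and f = f])
    (use assms in \<open>auto simp: closure_atLeastLessThan\<close>)

lemma gronwall_integral:
  fixes a :: "real \<Rightarrow> real"
  assumes a: "continuous_on {0..\<tau>} a" and c: "0 \<le> c" "0 \<le> \<tau>"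
    and le: "\<And>s. s \<in> {0..\<tau>} \<Longrightarrow> a s \<le> X + c * integral {0..s} a"
  shows "X + c * integral {0..\<tau>} a \<le> exp (c * \<tau>) * X"
proof (cases "\<tau> = 0")
  case False
  define Y where "Y s = X + c * integral {0..s} a" for s
  have "exp (- c * \<tau>) * Y \<tau> \<le> exp (- c * 0) * Y 0"
  proof (rule DERIV_nonpos_imp_decreasing_open[where f = "\<lambda>s. exp (- c * s) * Y s"])
    show "0 \<le> \<tau>" by (rule c)
    show "continuous_on {0..\<tau>} (\<lambda>s. exp (- c * s) * Y s)" unfolding Y_def
      by (intro continuous_intros indefinite_integral_continuous_1 integrable_continuous_interval a)
    fix x assume x: "0 < x" "x < \<tau>"
    have "((\<lambda>s. integral {0..s} a) has_real_derivative a x) (at x within {0..\<tau>})"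
      using integral_has_real_derivative[OF a, of x] x by simp
    moreover have "at x within {0..\<tau>} = at x" using x by (intro at_within_interior) simp
    ultimately have "((\<lambda>s. integral {0..s} a) has_real_derivative a x) (at x)" by simp
    then have "((\<lambda>s. exp (- c * s) * Y s) has_real_derivative exp (- c * x) * (c * (a x - Y x))) (at x)"
      unfolding Y_def by (auto intro!: derivative_eq_intros simp: algebra_simps)
    moreover have "exp (- c * x) * (c * (a x - Y x)) \<le> 0"
      using le[of x] x c(1) by (intro mult_nonneg_nonpos) (auto simp: Y_def)
    ultimately show "\<exists>d. ((\<lambda>s. exp (- c * s) * Y s) has_real_derivative d) (at x) \<and> d \<le> 0" by blast
  qed
  then have "exp (c * \<tau>) * (exp (- c * \<tau>) * Y \<tau>) \<le> exp (c * \<tau>) * X" by (intro mult_left_mono) (auto simp: Y_def)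
  then show ?thesis by (simp add: Y_def mult.assoc[symmetric] exp_add[symmetric])
qed simp

lemma right_quotient_tendsto:
  fixes f :: "real \<Rightarrow> 'x::real_normed_vector"
  assumes "(f has_vector_derivative D) (at t within {0..T})" "0 \<le> t" "t < T"
  shows "((\<lambda>\<delta>. (f (t + \<delta>) - f t) /\<^sub>R \<delta>) \<longlongrightarrow> D) (at_right 0)"
proof -
  have "filterlim (\<lambda>\<delta>. t + \<delta>) (at t within {0..T}) (at_right 0)"
    unfolding filterlim_at
  proof
    show "\<forall>\<^sub>F \<delta> in at_right 0. t + \<delta> \<in> {0..T} \<and> t + \<delta> \<noteq> t"
      by (rule eventually_at_rightI[of 0 "T - t"]) (use assms in auto)
    show "((\<lambda>\<delta>. t + \<delta>) \<longlongrightarrow> t) (at_right 0)"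
      using tendsto_add[OF tendsto_const[of t] tendsto_ident_at[of 0 "{0<..}"]] by simp
  qed
  from filterlim_compose[OF assms(1)[unfolded has_vector_derivative_iff_slope] this]
  show ?thesis by simp
qed

lemma difference_quotients_limit_bound_L2:
  fixes u :: "real \<Rightarrow> 'x::{real_inner,banach}"
  assumes u: "u \<in> bochner_L2 T" and U: "weak_primitive T u U" and \<tau>: "0 \<le> \<tau>" "\<tau> < T"
    and L: "\<forall>\<^sub>F \<delta> in at_right 0. integral {0..\<tau>} (\<lambda>t. (norm ((U (t + \<delta>) - U t) /\<^sub>R \<delta>))\<^sup>2) \<le> L \<delta>"
    and lim: "(L \<longlongrightarrow> L0) (at_right 0)"
  shows "int_sq {0..\<tau>} u \<le> L0"
proof (rule field_le_epsilon)
  fix e :: real assume "0 < e"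
  then have "\<forall>\<^sub>F \<delta> in at_right 0. L \<delta> < L0 + e" using lim by (intro order_tendstoD) auto
  with L have "\<forall>\<^sub>F \<delta> in at_right 0. integral {0..\<tau>} (\<lambda>t. (norm ((U (t + \<delta>) - U t) /\<^sub>R \<delta>))\<^sup>2) \<le> L0 + e"
    by eventually_elim linarith
  then show "int_sq {0..\<tau>} u \<le> L0 + e"
    by (rule difference_quotients_bound_L2[OF u U \<tau>])
qed

lemma h1_energy_le_nonneg: "h1_energy_le T F E \<Longrightarrow> 0 \<le> T \<Longrightarrow> 0 \<le> E"
  unfolding h1_energy_le_def by (smt (verit) atLeastAtMost_iff mono_onD)

lemma weak_primitive_of_derivative:
  fixes m :: "real \<Rightarrow> 'x::banach"
  assumes "\<And>t. t \<in> {0..T} \<Longrightarrow> (m has_vector_derivative md t) (at t within {0..T})"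
  shows "weak_primitive T md (\<lambda>t. m t - m 0)"
  unfolding weak_primitive_def
proof (intro ballI allI)
  fix t and \<phi> :: "'x \<Rightarrow>\<^sub>L real" assume t: "t \<in> {0..T}"
  have "(md has_integral m t - m 0) {0..t}"
    using t by (intro fundamental_theorem_of_calculus) (auto intro: has_vector_derivative_within_subset[OF assms])
  from has_integral_linear[OF this blinfun.bounded_linear_right[of \<phi>]]
  show "((\<lambda>s. \<phi> (md s)) has_integral \<phi> (m t - m 0)) {0..t}" by (simp add: o_def)
qed

lemma scaled_square: "0 < \<delta> \<Longrightarrow> (norm ((x :: 'x::real_normed_vector) /\<^sub>R \<delta>))\<^sup>2 = (norm x)\<^sup>2 / \<delta>\<^sup>2"
  by (simp add: power_mult_distrib divide_inverse power_inverse mult.commute)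

lemma shift_has_vector_derivative:
  fixes f :: "real \<Rightarrow> 'x::real_normed_vector"
  assumes "\<And>t. t \<in> {0..T} \<Longrightarrow> (f has_vector_derivative f' t) (at t within {0..T})"
    and "0 \<le> \<delta>" "t \<in> {0..\<sigma>}" "\<sigma> + \<delta> \<le> T"
  shows "((\<lambda>s. f (s + \<delta>) - f s) has_vector_derivative f' (t + \<delta>) - f' t) (at t within {0..\<sigma>})"
proof -
  have "((f \<circ> (\<lambda>t. t + \<delta>)) has_vector_derivative 1 *\<^sub>R f' (t + \<delta>)) (at t within {0..\<sigma>})"
    by (rule vector_diff_chain_within)
      (use assms(2-) in \<open>auto intro!: derivative_eq_intros has_vector_derivative_within_subset[OF assms(1)]\<close>)
  then show ?thesis
    using has_vector_derivative_within_subset[OF assms(1)[of t], of "{0..\<sigma>}"] assms(2-)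
    by (intro has_vector_derivative_diff) (auto simp: o_def)
qed

text \<open>The common form of the two systems to which the energy argument applies, after elimination of the
  constraint: \<open>V\<close> is the kernel of \<open>B\<close>, and \<open>y\<close> is the derivative of \<open>z\<close> in \<open>H\<close>.  For \<open>\<epsilon> = 0\<close> the second
  equation contains no derivative of \<open>m\<close>, hence the guard in the differentiability of \<open>m\<close>.  The functional
  acting on \<open>P\<close> is kept apart from the one acting on \<open>H\<close>, because differences of the latter can be
  absorbed by the energy whereas the former has to be integrated by parts.\<close>

locale damped_system =
  fixes \<iota> :: "'p::{real_inner,banach} \<Rightarrow>\<^sub>L 'h::{real_inner,banach}"
    and A :: "'h \<Rightarrow>\<^sub>L ('h \<Rightarrow>\<^sub>L real)"
    and K :: "'p \<Rightarrow>\<^sub>L ('m::{real_inner,banach} \<Rightarrow>\<^sub>L real)"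
    and D :: "'m \<Rightarrow>\<^sub>L ('m \<Rightarrow>\<^sub>L real)"
    and V :: "'p set" and T c\<^sub>D c\<^sub>K \<epsilon> :: real
    and z :: "real \<Rightarrow> 'p" and y :: "real \<Rightarrow> 'h" and m md :: "real \<Rightarrow> 'm"
    and G\<^sub>1 :: "real \<Rightarrow> 'p \<Rightarrow>\<^sub>L real" and G\<^sub>2 :: "real \<Rightarrow> 'h \<Rightarrow>\<^sub>L real" and F :: "real \<Rightarrow> 'm \<Rightarrow>\<^sub>L real"
    and E\<^sub>2 E\<^sub>F :: real
  assumes T: "0 < T" and c\<^sub>D: "0 < c\<^sub>D" and coercive: "\<And>x. c\<^sub>D * (norm x)\<^sup>2 \<le> D x x"
    and V_diff: "\<And>x x'. x \<in> V \<Longrightarrow> x' \<in> V \<Longrightarrow> x - x' \<in> V"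
    and c\<^sub>K: "0 < c\<^sub>K" "\<And>q. q \<in> V \<Longrightarrow> c\<^sub>K * norm q \<le> norm (K q)"
    and \<epsilon>: "0 \<le> \<epsilon>"
    and z_V: "\<And>t. t \<in> {0..T} \<Longrightarrow> z t \<in> V"
    and z_cont: "continuous_on {0..T} z" and m_cont: "continuous_on {0..T} m"
    and z_deriv: "\<And>t. t \<in> {0..T} \<Longrightarrow> ((\<lambda>s. \<iota> (z s)) has_vector_derivative y t) (at t within {0..T})"
    and m_deriv: "\<And>t. \<epsilon> \<noteq> 0 \<Longrightarrow> t \<in> {0..T} \<Longrightarrow> (m has_vector_derivative md t) (at t within {0..T})"
    and eq1: "\<And>t q. t \<in> {0..T} \<Longrightarrow> q \<in> V \<Longrightarrow>
      y t \<bullet> \<iota> q + A (\<iota> (z t)) (\<iota> q) - K q (m t) = G\<^sub>1 t q + G\<^sub>2 t (\<iota> q)"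
    and eq2: "\<And>t. t \<in> {0..T} \<Longrightarrow> \<epsilon> *\<^sub>R blinfun_inner_right (md t) + K (z t) + D (m t) = F t"
    and G\<^sub>1_cont: "continuous_on {0..T} G\<^sub>1"
    and G\<^sub>2: "h1_energy_le T G\<^sub>2 E\<^sub>2" and F: "h1_energy_le T F E\<^sub>F"
begin

text \<open>Both equations are linear, hence hold for differences.  Testing them with the differences of \<open>z\<close>
  and \<open>m\<close> cancels the terms with \<open>K\<close>; Young and Gronwall do the rest.\<close>

lemma difference_energy_estimate:
  assumes \<delta>: "0 < \<delta>" and \<tau>: "0 \<le> \<tau>" "\<tau> + \<delta> \<le> T"
    and \<Theta>: "\<And>\<sigma>. 0 \<le> \<sigma> \<Longrightarrow> \<sigma> + \<delta> \<le> T \<Longrightarrow>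
      integral {0..\<sigma>} (\<lambda>t. (G\<^sub>1 (t + \<delta>) - G\<^sub>1 t) (z (t + \<delta>) - z t)) \<le> \<delta>\<^sup>2 * \<Theta>"
  shows "(norm (\<iota> (z (\<tau> + \<delta>)) - \<iota> (z \<tau>)))\<^sup>2 + \<epsilon> * (norm (m (\<tau> + \<delta>) - m \<tau>))\<^sup>2
      + c\<^sub>D * integral {0..\<tau>} (\<lambda>t. (norm (m (t + \<delta>) - m t))\<^sup>2)
    \<le> exp ((2 * norm A + 1) * \<tau>) * ((norm (\<iota> (z \<delta>) - \<iota> (z 0)))\<^sup>2 + \<epsilon> * (norm (m \<delta> - m 0))\<^sup>2
      + \<delta>\<^sup>2 * (E\<^sub>2 + E\<^sub>F / c\<^sub>D + 2 * \<Theta>))"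
proof -
  define c where "c = 2 * norm A + 1"
  define dz where "dz t = z (t + \<delta>) - z t" for t
  define dm where "dm t = m (t + \<delta>) - m t" for t
  define dF where "dF t = F (t + \<delta>) - F t" for t
  define dG1 where "dG1 t = G\<^sub>1 (t + \<delta>) - G\<^sub>1 t" for t
  define dG2 where "dG2 t = G\<^sub>2 (t + \<delta>) - G\<^sub>2 t" for t
  define a where "a t = (norm (\<iota> (dz t)))\<^sup>2" for t
  define \<Phi> where "\<Phi> t = a t + \<epsilon> * (norm (dm t))\<^sup>2" for t
  define R where "R t = 2 * (- D (dm t) (dm t) - A (\<iota> (dz t)) (\<iota> (dz t)) + dF t (dm t)
      + dG1 t (dz t) + dG2 t (\<iota> (dz t)))" for t
  define X where "X = \<Phi> 0 + \<delta>\<^sup>2 * (E\<^sub>2 + E\<^sub>F / c\<^sub>D + 2 * \<Theta>)"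
  have cont: "continuous_on {0..\<sigma>} dz" "continuous_on {0..\<sigma>} dm" "continuous_on {0..\<sigma>} dF"
    "continuous_on {0..\<sigma>} dG1" "continuous_on {0..\<sigma>} dG2" if "\<sigma> + \<delta> \<le> T" for \<sigma>
    unfolding dz_def dm_def dF_def dG1_def dG2_def
    by (intro continuous_on_diff continuous_on_shift[OF _ less_imp_le[OF \<delta>] that] z_cont m_cont G\<^sub>1_cont
        h1_energy_le_continuous[OF G\<^sub>2] h1_energy_le_continuous[OF F])+
  have R: "(\<Phi> has_vector_derivative R t) (at t within {0..\<sigma>})" if t: "t \<in> {0..\<sigma>}" "\<sigma> + \<delta> \<le> T" for t \<sigma>
  proof -
    let ?dy = "y (t + \<delta>) - y t" and ?dmd = "md (t + \<delta>) - md t"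
    have tt: "t \<in> {0..T}" "t + \<delta> \<in> {0..T}" using t \<delta> by auto
    have dV: "dz t \<in> V" unfolding dz_def by (intro V_diff z_V tt)
    have "((\<lambda>s. \<iota> (dz s)) has_vector_derivative ?dy) (at t within {0..\<sigma>})"
      using shift_has_vector_derivative[OF z_deriv less_imp_le[OF \<delta>] t] by (simp add: dz_def blinfun.diff_right)
    from bounded_bilinear.has_vector_derivative[OF bounded_bilinear_inner this this]
    have 1: "(a has_vector_derivative 2 * (?dy \<bullet> \<iota> (dz t))) (at t within {0..\<sigma>})"
      by (simp add: a_def[abs_def] power2_norm_eq_inner inner_commute)
    have 2: "((\<lambda>s. \<epsilon> * (norm (dm s))\<^sup>2) has_vector_derivative 2 * (\<epsilon> * (?dmd \<bullet> dm t))) (at t within {0..\<sigma>})"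
    proof (cases "\<epsilon> = 0")
      case False
      have "(dm has_vector_derivative ?dmd) (at t within {0..\<sigma>})"
        using shift_has_vector_derivative[OF m_deriv[OF False] less_imp_le[OF \<delta>] t] by (simp add: dm_def[abs_def])
      from bounded_bilinear.has_vector_derivative[OF bounded_bilinear_inner this this]
      have "((\<lambda>s. (norm (dm s))\<^sup>2) has_vector_derivative 2 * (?dmd \<bullet> dm t)) (at t within {0..\<sigma>})"
        by (simp add: power2_norm_eq_inner inner_commute)
      from has_vector_derivative_scaleR[OF DERIV_const[of \<epsilon>] this] show ?thesis by (simp add: mult_ac)
    qed simp
    have e1: "?dy \<bullet> \<iota> (dz t) + A (\<iota> (dz t)) (\<iota> (dz t)) - K (dz t) (dm t) = dG1 t (dz t) + dG2 t (\<iota> (dz t))"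
      using eq1[OF tt(1) dV] eq1[OF tt(2) dV]
      by (simp add: dz_def[of t] dm_def dG1_def dG2_def inner_diff_left blinfun.diff_left blinfun.diff_right algebra_simps)
    have "(\<epsilon> *\<^sub>R blinfun_inner_right (md (t + \<delta>)) + K (z (t + \<delta>)) + D (m (t + \<delta>))) (dm t)
        - (\<epsilon> *\<^sub>R blinfun_inner_right (md t) + K (z t) + D (m t)) (dm t) = dF t (dm t)"
      using eq2[OF tt(1)] eq2[OF tt(2)] by (simp add: dF_def blinfun.diff_left)
    then have e2: "\<epsilon> * (?dmd \<bullet> dm t) + K (dz t) (dm t) + D (dm t) (dm t) = dF t (dm t)"
      by (simp add: dz_def dm_def[of t] blinfun.add_left blinfun.scaleR_left inner_diff_left
          blinfun.diff_left blinfun.diff_right algebra_simps)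
    have "2 * (?dy \<bullet> \<iota> (dz t)) + 2 * (\<epsilon> * (?dmd \<bullet> dm t)) = R t"
      using e1 e2 by (simp add: R_def)
    with has_vector_derivative_add[OF 1 2] show ?thesis by (simp add: \<Phi>_def[abs_def])
  qed
  have Rle: "R t \<le> - c\<^sub>D * (norm (dm t))\<^sup>2 + c * a t + (norm (dF t))\<^sup>2 / c\<^sub>D + (norm (dG2 t))\<^sup>2 + 2 * dG1 t (dz t)" for t
  proof -
    have "- A (\<iota> (dz t)) (\<iota> (dz t)) \<le> norm A * a t"
    proof -
      have "\<bar>A (\<iota> (dz t)) (\<iota> (dz t))\<bar> \<le> norm (A (\<iota> (dz t))) * norm (\<iota> (dz t))"
        using norm_blinfun[of "A (\<iota> (dz t))" "\<iota> (dz t)"] by simp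
      also have "\<dots> \<le> norm A * norm (\<iota> (dz t)) * norm (\<iota> (dz t))" by (intro mult_right_mono norm_blinfun) simp
      finally show ?thesis by (simp add: a_def power2_eq_square)
    qed
    moreover have "2 * dF t (dm t) \<le> c\<^sub>D * (norm (dm t))\<^sup>2 + (norm (dF t))\<^sup>2 / c\<^sub>D"
    proof -
      have "0 \<le> (c\<^sub>D * norm (dm t) - norm (dF t))\<^sup>2 / c\<^sub>D" using c\<^sub>D by simp
      also have "\<dots> = c\<^sub>D * (norm (dm t))\<^sup>2 - 2 * (norm (dF t) * norm (dm t)) + (norm (dF t))\<^sup>2 / c\<^sub>D"
        using c\<^sub>D by (simp add: field_simps power2_eq_square)
      finally show ?thesis using norm_blinfun[of "dF t" "dm t"] by simp
    qed
    moreover have "2 * dG2 t (\<iota> (dz t)) \<le> a t + (norm (dG2 t))\<^sup>2"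
      using norm_blinfun[of "dG2 t" "\<iota> (dz t)"] sum_squares_bound[of "norm (dG2 t)" "norm (\<iota> (dz t))"]
      by (simp add: a_def)
    ultimately show ?thesis using coercive[of "dm t"] by (simp add: R_def c_def algebra_simps)
  qed
  have int: "a integrable_on {0..\<sigma>}" "(\<lambda>t. (norm (dm t))\<^sup>2) integrable_on {0..\<sigma>}"
    "(\<lambda>t. (norm (dF t))\<^sup>2) integrable_on {0..\<sigma>}" "(\<lambda>t. (norm (dG2 t))\<^sup>2) integrable_on {0..\<sigma>}"
    "(\<lambda>t. dG1 t (dz t)) integrable_on {0..\<sigma>}" if "\<sigma> + \<delta> \<le> T" for \<sigma>
    unfolding a_def[abs_def]
    by (intro integrable_continuous_interval continuous_intros cont that blinfun.continuous_on)+
  have step: "\<Phi> \<sigma> + c\<^sub>D * int_sq {0..\<sigma>} dm \<le> X + c * integral {0..\<sigma>} a"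
    if \<sigma>: "0 \<le> \<sigma>" "\<sigma> + \<delta> \<le> T" for \<sigma>
  proof -
    have h: "(R has_integral \<Phi> \<sigma> - \<Phi> 0) {0..\<sigma>}"
      by (rule fundamental_theorem_of_calculus[OF \<sigma>(1) R[OF _ \<sigma>(2)]])
    have "((\<lambda>t. - c\<^sub>D * (norm (dm t))\<^sup>2 + c * a t + (norm (dF t))\<^sup>2 / c\<^sub>D + (norm (dG2 t))\<^sup>2 + 2 * dG1 t (dz t))
      has_integral - c\<^sub>D * int_sq {0..\<sigma>} dm + c * integral {0..\<sigma>} a
        + int_sq {0..\<sigma>} dF / c\<^sub>D + int_sq {0..\<sigma>} dG2
        + 2 * integral {0..\<sigma>} (\<lambda>t. dG1 t (dz t))) {0..\<sigma>}"
      by (intro has_integral_add has_integral_mult_right has_integral_divide integrable_integral int \<sigma>)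
    from has_integral_le[OF h this Rle]
    have "\<Phi> \<sigma> - \<Phi> 0 \<le> - c\<^sub>D * int_sq {0..\<sigma>} dm + c * integral {0..\<sigma>} a
        + int_sq {0..\<sigma>} dF / c\<^sub>D + int_sq {0..\<sigma>} dG2
        + 2 * integral {0..\<sigma>} (\<lambda>t. dG1 t (dz t))" .
    moreover have "int_sq {0..\<sigma>} dF / c\<^sub>D \<le> \<delta>\<^sup>2 * E\<^sub>F / c\<^sub>D"
      using h1_energy_difference_integral[OF F \<delta> \<sigma>] c\<^sub>D by (simp add: dF_def divide_right_mono)
    moreover have "int_sq {0..\<sigma>} dG2 \<le> \<delta>\<^sup>2 * E\<^sub>2"
      using h1_energy_difference_integral[OF G\<^sub>2 \<delta> \<sigma>] by (simp add: dG2_def)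
    moreover have "integral {0..\<sigma>} (\<lambda>t. dG1 t (dz t)) \<le> \<delta>\<^sup>2 * \<Theta>"
      using \<Theta>[OF \<sigma>] by (simp add: dG1_def dz_def)
    ultimately show ?thesis by (simp add: X_def algebra_simps)
  qed
  have "X + c * integral {0..\<tau>} a \<le> exp (c * \<tau>) * X"
  proof (rule gronwall_integral)
    show "continuous_on {0..\<tau>} a" unfolding a_def[abs_def] by (intro continuous_intros cont \<tau>)
    show "0 \<le> c" "0 \<le> \<tau>" using \<tau> by (auto simp: c_def)
    fix s assume s: "s \<in> {0..\<tau>}"
    then have "0 \<le> int_sq {0..s} dm" using \<tau> by (intro integral_nonneg int) auto
    then have "0 \<le> c\<^sub>D * int_sq {0..s} dm" using c\<^sub>D by simp
    moreover have "0 \<le> \<epsilon> * (norm (dm s))\<^sup>2" using \<epsilon> by simp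
    moreover have "\<Phi> s + c\<^sub>D * int_sq {0..s} dm \<le> X + c * integral {0..s} a"
      using step[of s] s \<tau> by auto
    ultimately show "a s \<le> X + c * integral {0..s} a" unfolding \<Phi>_def by linarith
  qed
  with step[OF \<tau>] have "\<Phi> \<tau> + c\<^sub>D * int_sq {0..\<tau>} dm \<le> exp (c * \<tau>) * X" by linarith
  then show ?thesis by (simp add: \<Phi>_def X_def a_def dz_def dm_def c_def blinfun.diff_right)
qed

lemma quotient_energy_estimate:
  assumes \<delta>: "0 < \<delta>" and \<tau>: "0 \<le> \<tau>" "\<tau> + \<delta> \<le> T"
    and \<Theta>: "\<And>\<sigma>. 0 \<le> \<sigma> \<Longrightarrow> \<sigma> + \<delta> \<le> T \<Longrightarrow>
      integral {0..\<sigma>} (\<lambda>t. (G\<^sub>1 (t + \<delta>) - G\<^sub>1 t) (z (t + \<delta>) - z t)) \<le> \<delta>\<^sup>2 * \<Theta>"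
  shows "(norm ((\<iota> (z (\<tau> + \<delta>)) - \<iota> (z \<tau>)) /\<^sub>R \<delta>))\<^sup>2 + \<epsilon> * (norm ((m (\<tau> + \<delta>) - m \<tau>) /\<^sub>R \<delta>))\<^sup>2
      + c\<^sub>D * integral {0..\<tau>} (\<lambda>t. (norm ((m (t + \<delta>) - m t) /\<^sub>R \<delta>))\<^sup>2)
    \<le> exp ((2 * norm A + 1) * \<tau>) * ((norm ((\<iota> (z (0 + \<delta>)) - \<iota> (z 0)) /\<^sub>R \<delta>))\<^sup>2
      + \<epsilon> * (norm ((m (0 + \<delta>) - m 0) /\<^sub>R \<delta>))\<^sup>2 + (E\<^sub>2 + E\<^sub>F / c\<^sub>D + 2 * \<Theta>))"
proof -
  have "\<delta>\<^sup>2 \<noteq> 0" "0 < \<delta>\<^sup>2" using \<delta> by auto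
  from divide_right_mono[OF difference_energy_estimate[OF \<delta> \<tau> \<Theta>], of "\<delta>\<^sup>2"]
  show ?thesis
    unfolding scaled_square[OF \<delta>] integral_divide
    using \<open>\<delta>\<^sup>2 \<noteq> 0\<close> by (simp add: add_divide_distrib distrib_left)
qed

text \<open>The difference of \<open>z\<close> is the derivative of the integral of \<open>z\<close> over \<open>[t, t + \<delta>]\<close>, which is at
  most \<open>\<delta> Z\<close>.  Integrating by parts moves the derivative to the difference of \<open>G\<^sub>1\<close>, where a
  further factor \<open>\<delta>\<close> comes from the bound of \<open>G'\<close> at the ends and from its energy in the integral.\<close>

lemma difference_product_estimate:
  assumes dG: "\<And>t. t \<in> {0..T} \<Longrightarrow> (G\<^sub>1 has_vector_derivative G' t) (at t within {0..T})"
    and \<Gamma>: "\<And>t. t \<in> {0..T} \<Longrightarrow> norm (G' t) \<le> \<Gamma>" and E: "h1_energy_le T G' E\<^sub>1"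
    and Z: "\<And>t. t \<in> {0..T} \<Longrightarrow> norm (z t) \<le> Z"
    and \<delta>: "0 < \<delta>" and \<sigma>: "0 \<le> \<sigma>" "\<sigma> + \<delta> \<le> T"
  shows "integral {0..\<sigma>} (\<lambda>t. (G\<^sub>1 (t + \<delta>) - G\<^sub>1 t) (z (t + \<delta>) - z t)) \<le> \<delta>\<^sup>2 * ((2 * \<Gamma> + sqrt (T * E\<^sub>1)) * Z)"
proof -
  define P where "P t = integral {0..t} z" for t
  define dP where "dP t = P (t + \<delta>) - P t" for t
  define dz where "dz t = z (t + \<delta>) - z t" for t
  define dG1 where "dG1 t = G\<^sub>1 (t + \<delta>) - G\<^sub>1 t" for t
  define dG' where "dG' t = G' (t + \<delta>) - G' t" for t
  note sh = continuous_on_shift[OF _ less_imp_le[OF \<delta>] \<sigma>(2)]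
  have Z0: "0 \<le> Z" using order_trans[OF norm_ge_zero Z[of 0]] T by simp
  have \<Gamma>0: "0 \<le> \<Gamma>" using order_trans[OF norm_ge_zero \<Gamma>[of 0]] T by simp
  have P: "(P has_vector_derivative z t) (at t within {0..T})" if "t \<in> {0..T}" for t
    unfolding P_def[abs_def] by (rule integral_has_vector_derivative[OF z_cont that])
  have cP: "continuous_on {0..T} P"
    using P by (rule continuous_on_vector_derivative)
  have cont: "continuous_on {0..\<sigma>} dP" "continuous_on {0..\<sigma>} dG'"
    unfolding dP_def dG'_def by (intro continuous_on_diff sh cP h1_energy_le_continuous[OF E])+
  have dP_le: "norm (dP t) \<le> \<delta> * Z" if t: "t \<in> {0..\<sigma>}" for t
  proof -
    have c: "continuous_on {a..b} z" if "0 \<le> a" "b \<le> T" for a b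
      by (rule continuous_on_subset[OF z_cont]) (use that in auto)
    have "dP t = integral {t..t + \<delta>} z"
      using Henstock_Kurzweil_Integration.integral_combine[of 0 t "t + \<delta>" z] t \<delta> \<sigma>
        integrable_continuous_interval[OF c[of 0 "t + \<delta>"]] by (simp add: dP_def P_def algebra_simps)
    moreover have "norm (integral {t..t + \<delta>} z) \<le> Z * (t + \<delta> - t)"
      by (rule integral_bound) (use t \<delta> \<sigma> Z c[of t "t + \<delta>"] in auto)
    ultimately show ?thesis by (simp add: mult.commute)
  qed
  have dG1_le: "norm (dG1 t) \<le> \<delta> * \<Gamma>" if t: "t \<in> {0..\<sigma>}" for t
  proof -
    have "norm (G\<^sub>1 (t + \<delta>) - G\<^sub>1 t) \<le> \<Gamma> * norm (t + \<delta> - t)"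
    proof (rule differentiable_bound[of "{0..T}"])
      show "(G\<^sub>1 has_derivative (\<lambda>h. h *\<^sub>R G' x)) (at x within {0..T})" if "x \<in> {0..T}" for x
        using dG[OF that] by (simp add: has_vector_derivative_def)
      show "onorm (\<lambda>h. h *\<^sub>R G' x) \<le> \<Gamma>" if "x \<in> {0..T}" for x
      proof (rule onorm_le)
        show "norm (h *\<^sub>R G' x) \<le> \<Gamma> * norm h" for h
          using mult_right_mono[OF \<Gamma>[OF that], of "\<bar>h\<bar>"] by (simp add: mult.commute)
      qed
    qed (use t \<delta> \<sigma> in auto)
    then show ?thesis using \<delta> by (simp add: dG1_def mult.commute)
  qed
  have "((\<lambda>t. dG1 t (dP t)) has_vector_derivative dG1 t (dz t) + dG' t (dP t)) (at t within {0..\<sigma>})"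
    if t: "t \<in> {0..\<sigma>}" for t
    using bounded_bilinear.has_vector_derivative[OF bounded_bilinear_blinfun_apply
        shift_has_vector_derivative[OF dG less_imp_le[OF \<delta>] t \<sigma>(2)]
        shift_has_vector_derivative[OF P less_imp_le[OF \<delta>] t \<sigma>(2)]]
    by (simp add: dG1_def dP_def dz_def dG'_def)
  then have h: "((\<lambda>t. dG1 t (dz t) + dG' t (dP t)) has_integral dG1 \<sigma> (dP \<sigma>) - dG1 0 (dP 0)) {0..\<sigma>}"
    by (intro fundamental_theorem_of_calculus \<sigma>)
  have i: "(\<lambda>t. dG' t (dP t)) integrable_on {0..\<sigma>}"
    by (intro integrable_continuous_interval continuous_intros cont)
  from has_integral_diff[OF h integrable_integral[OF this]]
  have "((\<lambda>t. dG1 t (dz t)) has_integral dG1 \<sigma> (dP \<sigma>) - dG1 0 (dP 0) - integral {0..\<sigma>} (\<lambda>t. dG' t (dP t))) {0..\<sigma>}"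
    by simp
  then have "integral {0..\<sigma>} (\<lambda>t. dG1 t (dz t)) = dG1 \<sigma> (dP \<sigma>) - dG1 0 (dP 0) - integral {0..\<sigma>} (\<lambda>t. dG' t (dP t))"
    by (rule integral_unique)
  moreover have boundary: "\<bar>dG1 t (dP t)\<bar> \<le> \<delta>\<^sup>2 * (\<Gamma> * Z)" if "t \<in> {0..\<sigma>}" for t
  proof -
    have "\<bar>dG1 t (dP t)\<bar> \<le> norm (dG1 t) * norm (dP t)" using norm_blinfun[of "dG1 t" "dP t"] by simp
    also have "\<dots> \<le> (\<delta> * \<Gamma>) * (\<delta> * Z)"
      by (intro mult_mono dG1_le dP_le that mult_nonneg_nonneg) (use \<delta> \<Gamma>0 in auto)
    finally show ?thesis by (simp add: power2_eq_square mult_ac)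
  qed
  moreover have "\<bar>integral {0..\<sigma>} (\<lambda>t. dG' t (dP t))\<bar> \<le> \<delta>\<^sup>2 * (sqrt (T * E\<^sub>1) * Z)"
  proof -
    have n: "(\<lambda>t. norm (dG' t)) integrable_on {0..\<sigma>}"
      by (intro integrable_continuous_interval continuous_intros cont)
    have "norm (integral {0..\<sigma>} (\<lambda>t. dG' t (dP t))) \<le> integral {0..\<sigma>} (\<lambda>t. norm (dG' t) * (\<delta> * Z))"
    proof (rule Henstock_Kurzweil_Integration.integral_norm_bound_integral[OF i integrable_on_mult_left[OF n]])
      show "norm (dG' t (dP t)) \<le> norm (dG' t) * (\<delta> * Z)" if "t \<in> {0..\<sigma>}" for t
        by (rule order_trans[OF norm_blinfun]) (intro mult_left_mono dP_le that norm_ge_zero)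
    qed
    also have "\<dots> = integral {0..\<sigma>} (\<lambda>t. norm (dG' t)) * (\<delta> * Z)" by simp
    also have "\<dots> \<le> (\<delta> * sqrt (T * E\<^sub>1)) * (\<delta> * Z)"
    proof (rule mult_right_mono)
      have s: "integral {0..\<sigma>} (\<lambda>t. (norm (dG' t))\<^sup>2) \<le> \<delta>\<^sup>2 * E\<^sub>1"
        unfolding dG'_def by (rule h1_energy_difference_integral[OF E \<delta> \<sigma>])
      have s0: "0 \<le> integral {0..\<sigma>} (\<lambda>t. (norm (dG' t))\<^sup>2)"
        by (intro integral_nonneg integrable_continuous_interval continuous_intros cont) auto
      have "(integral {0..\<sigma>} (\<lambda>t. norm (dG' t)))\<^sup>2 \<le> (\<sigma> - 0) * integral {0..\<sigma>} (\<lambda>t. (norm (dG' t))\<^sup>2)"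
        by (rule square_integral_le[OF \<sigma>(1) n]) (intro integrable_continuous_interval continuous_intros cont)
      also have "\<dots> \<le> T * (\<delta>\<^sup>2 * E\<^sub>1)" using s s0 \<sigma> \<delta> by (intro mult_mono) auto
      finally have "sqrt ((integral {0..\<sigma>} (\<lambda>t. norm (dG' t)))\<^sup>2) \<le> sqrt (\<delta>\<^sup>2 * (T * E\<^sub>1))"
        by (intro real_sqrt_le_mono) (simp add: mult_ac)
      then show "integral {0..\<sigma>} (\<lambda>t. norm (dG' t)) \<le> \<delta> * sqrt (T * E\<^sub>1)"
        using \<delta> by (simp add: real_sqrt_mult)
    qed (use \<delta> Z0 in simp)
    finally show ?thesis by (simp add: power2_eq_square mult_ac)
  qed
  ultimately have "integral {0..\<sigma>} (\<lambda>t. dG1 t (dz t)) \<le> \<delta>\<^sup>2 * (\<Gamma> * Z) + \<delta>\<^sup>2 * (\<Gamma> * Z) + \<delta>\<^sup>2 * (sqrt (T * E\<^sub>1) * Z)"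
    using boundary[of 0, simplified, OF \<sigma>(1)] boundary[of \<sigma>, simplified, OF \<sigma>(1)] by linarith
  then show ?thesis by (simp add: dG1_def dz_def algebra_simps)
qed

text \<open>The function \<open>n\<close> is the limit of the energy of the difference quotients of \<open>m\<close>,
  and \<open>em\<close> stands for its velocity, which may exist in the weak sense only.\<close>

lemma energy_limit:
  assumes \<Theta>: "\<And>\<delta> \<sigma>. 0 < \<delta> \<Longrightarrow> 0 \<le> \<sigma> \<Longrightarrow> \<sigma> + \<delta> \<le> T \<Longrightarrow>
      integral {0..\<sigma>} (\<lambda>t. (G\<^sub>1 (t + \<delta>) - G\<^sub>1 t) (z (t + \<delta>) - z t)) \<le> \<delta>\<^sup>2 * \<Theta>" "0 \<le> \<Theta>"
    and em: "em \<in> bochner_L2 T" "weak_primitive T em M" "\<And>s t. M t - M s = m t - m s"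
    and n: "\<And>\<tau>. 0 \<le> \<tau> \<Longrightarrow> \<tau> < T \<Longrightarrow>
      ((\<lambda>\<delta>. \<epsilon> * (norm ((m (\<tau> + \<delta>) - m \<tau>) /\<^sub>R \<delta>))\<^sup>2) \<longlongrightarrow> n \<tau>) (at_right 0)"
    and X: "X = exp ((2 * norm A + 1) * T) * ((norm (y 0))\<^sup>2 + n 0 + (E\<^sub>2 + E\<^sub>F / c\<^sub>D + 2 * \<Theta>))"
    and \<tau>: "0 \<le> \<tau>" "\<tau> < T"
  shows "(norm (y \<tau>))\<^sup>2 + n \<tau> \<le> X" "c\<^sub>D * int_sq {0..\<tau>} em \<le> X"
proof -
  define a where "a \<tau> \<delta> = (norm ((\<iota> (z (\<tau> + \<delta>)) - \<iota> (z \<tau>)) /\<^sub>R \<delta>))\<^sup>2 + \<epsilon> * (norm ((m (\<tau> + \<delta>) - m \<tau>) /\<^sub>R \<delta>))\<^sup>2" for \<tau> \<delta>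
  define i where "i \<delta> = integral {0..\<tau>} (\<lambda>t. (norm ((m (t + \<delta>) - m t) /\<^sub>R \<delta>))\<^sup>2)" for \<delta>
  define S where "S = E\<^sub>2 + E\<^sub>F / c\<^sub>D + 2 * \<Theta>"
  define r where "r \<delta> = exp ((2 * norm A + 1) * \<tau>) * (a 0 \<delta> + S)" for \<delta>
  define r0 where "r0 = exp ((2 * norm A + 1) * \<tau>) * ((norm (y 0))\<^sup>2 + n 0 + S)"
  have alim: "(a \<tau> \<longlongrightarrow> (norm (y \<tau>))\<^sup>2 + n \<tau>) (at_right 0)" if "0 \<le> \<tau>" "\<tau> < T" for \<tau>
    unfolding a_def[abs_def]
    by (intro tendsto_add n tendsto_power tendsto_norm right_quotient_tendsto[of _ _ _ T] z_deriv) (use that in auto)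
  have a0: "0 \<le> a \<tau> \<delta>" for \<tau> \<delta> using \<epsilon> by (simp add: a_def)
  have i0: "0 \<le> i \<delta>" for \<delta>
  proof (cases "(\<lambda>t. (norm ((m (t + \<delta>) - m t) /\<^sub>R \<delta>))\<^sup>2) integrable_on {0..\<tau>}")
    case False
    then show ?thesis unfolding i_def not_integrable_integral[OF False] by simp
  qed (auto simp: i_def intro: integral_nonneg)
  have rlim: "(r \<longlongrightarrow> r0) (at_right 0)"
    unfolding r_def[abs_def] r0_def by (intro tendsto_intros alim) (use T in auto)
  have "\<forall>\<^sub>F \<delta> in at_right 0. 0 < \<delta> \<and> \<tau> + \<delta> \<le> T"
    by (rule eventually_at_rightI[of 0 "T - \<tau>"]) (use \<tau> in auto)
  then have ev: "\<forall>\<^sub>F \<delta> in at_right 0. a \<tau> \<delta> + c\<^sub>D * i \<delta> \<le> r \<delta>"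
  proof eventually_elim
    case (elim \<delta>)
    then show ?case
      using quotient_energy_estimate[OF _ \<tau>(1), of \<delta> \<Theta>] \<Theta>(1) by (simp add: a_def i_def r_def S_def add.assoc)
  qed
  have "0 \<le> (norm (y 0))\<^sup>2 + n 0"
    by (rule tendsto_lowerbound[OF alim]) (use T a0 in auto)
  moreover have "0 \<le> S"
    using h1_energy_le_nonneg[OF G\<^sub>2] h1_energy_le_nonneg[OF F] T c\<^sub>D \<Theta>(2) by (simp add: S_def)
  ultimately have pos: "0 \<le> (norm (y 0))\<^sup>2 + n 0 + S" by linarith
  have "exp ((2 * norm A + 1) * \<tau>) \<le> exp ((2 * norm A + 1) * T)" using \<tau> by (simp add: mult_left_mono)
  then have r0X: "r0 \<le> X" unfolding r0_def X S_def[symmetric] using pos by (rule mult_right_mono)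
  have "(norm (y \<tau>))\<^sup>2 + n \<tau> \<le> r0"
  proof (rule tendsto_le[OF _ rlim alim[OF \<tau>]])
    show "\<forall>\<^sub>F \<delta> in at_right 0. a \<tau> \<delta> \<le> r \<delta>" using ev
    proof eventually_elim
      case (elim \<delta>)
      moreover have "0 \<le> c\<^sub>D * i \<delta>" using i0[of \<delta>] c\<^sub>D by simp
      ultimately show ?case by linarith
    qed
  qed simp
  then show "(norm (y \<tau>))\<^sup>2 + n \<tau> \<le> X" using r0X by linarith
  have "int_sq {0..\<tau>} em \<le> r0 / c\<^sub>D"
  proof (rule difference_quotients_limit_bound_L2[OF em(1,2) \<tau>])
    show "((\<lambda>\<delta>. r \<delta> / c\<^sub>D) \<longlongrightarrow> r0 / c\<^sub>D) (at_right 0)" using c\<^sub>D by (intro tendsto_intros rlim) auto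
    show "\<forall>\<^sub>F \<delta> in at_right 0. integral {0..\<tau>} (\<lambda>t. (norm ((M (t + \<delta>) - M t) /\<^sub>R \<delta>))\<^sup>2) \<le> r \<delta> / c\<^sub>D"
      using ev
    proof eventually_elim
      case (elim \<delta>)
      then have "i \<delta> \<le> r \<delta> / c\<^sub>D" using a0[of \<tau> \<delta>] c\<^sub>D by (simp add: pos_le_divide_eq mult.commute)
      then show ?case by (simp add: i_def em(3))
    qed
  qed
  then show "c\<^sub>D * int_sq {0..\<tau>} em \<le> X"
    using r0X c\<^sub>D by (simp add: pos_le_divide_eq mult.commute)
qed

text \<open>The bound is not closed yet: it still contains the supremum \<open>Z\<close> of \<open>z\<close> in \<open>P\<close>.\<close>

lemma velocity_estimate:
  assumes \<epsilon>0: "0 < \<epsilon>" and y: "continuous_on {0..T} y" and md: "continuous_on {0..T} md"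
    and dG: "\<And>t. t \<in> {0..T} \<Longrightarrow> (G\<^sub>1 has_vector_derivative G' t) (at t within {0..T})"
    and \<Gamma>: "\<And>t. t \<in> {0..T} \<Longrightarrow> norm (G' t) \<le> \<Gamma>" and E: "h1_energy_le T G' E\<^sub>1"
    and Z: "\<And>t. t \<in> {0..T} \<Longrightarrow> norm (z t) \<le> Z"
    and X: "X = exp ((2 * norm A + 1) * T) * ((norm (y 0))\<^sup>2 + \<epsilon> * (norm (md 0))\<^sup>2
      + (E\<^sub>2 + E\<^sub>F / c\<^sub>D + 2 * ((2 * \<Gamma> + sqrt (T * E\<^sub>1)) * Z)))"
    and \<tau>: "\<tau> \<in> {0..T}"
  shows "(norm (y \<tau>))\<^sup>2 + \<epsilon> * (norm (md \<tau>))\<^sup>2 \<le> X" "c\<^sub>D * int_sq {0..\<tau>} md \<le> X"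
proof -
  have m_deriv': "(m has_vector_derivative md t) (at t within {0..T})" if "t \<in> {0..T}" for t
    using m_deriv \<epsilon>0 that by simp
  have "0 \<le> Z" "0 \<le> \<Gamma>" "0 \<le> E\<^sub>1"
    using order_trans[OF norm_ge_zero Z[of 0]] order_trans[OF norm_ge_zero \<Gamma>[of 0]] h1_energy_le_nonneg[OF E] T by auto
  then have \<Theta>0: "0 \<le> (2 * \<Gamma> + sqrt (T * E\<^sub>1)) * Z" using T by simp
  have lim: "((\<lambda>\<delta>. \<epsilon> * (norm ((m (\<tau> + \<delta>) - m \<tau>) /\<^sub>R \<delta>))\<^sup>2) \<longlongrightarrow> \<epsilon> * (norm (md \<tau>))\<^sup>2) (at_right 0)"
    if "0 \<le> \<tau>" "\<tau> < T" for \<tau>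
    by (intro tendsto_intros right_quotient_tendsto[of _ _ _ T] m_deriv') (use that in auto)
  have wp: "weak_primitive T md (\<lambda>t. m t - m 0)" by (rule weak_primitive_of_derivative[OF m_deriv'])
  have main: "(norm (y \<tau>))\<^sup>2 + \<epsilon> * (norm (md \<tau>))\<^sup>2 \<le> X" "c\<^sub>D * int_sq {0..\<tau>} md \<le> X"
    if \<tau>: "0 \<le> \<tau>" "\<tau> < T" for \<tau>
    using energy_limit[where n = "\<lambda>\<tau>. \<epsilon> * (norm (md \<tau>))\<^sup>2", OF difference_product_estimate[OF dG \<Gamma> E Z] \<Theta>0
        continuous_in_bochner_L2[OF md] wp _ lim X \<tau>] by simp_all
  show "(norm (y \<tau>))\<^sup>2 + \<epsilon> * (norm (md \<tau>))\<^sup>2 \<le> X"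
    by (rule bound_at_right_end[OF T _ _ \<tau>]) (use main in \<open>auto intro!: continuous_intros y md\<close>)
  show "c\<^sub>D * int_sq {0..\<tau>} md \<le> X"
    by (rule bound_at_right_end[OF T _ _ \<tau>])
      (use main in \<open>auto intro!: continuous_intros indefinite_integral_continuous_1 integrable_continuous_interval md\<close>)
qed

text \<open>Applied to the primitives \<open>z\<close>, \<open>m\<close> of the error functions \<open>ez\<close>, \<open>em\<close>.  The initial energy vanishes
  with \<open>y(0)\<close>, so that the error is governed by the energy of \<open>F\<close> alone.\<close>

lemma stationary_flux_error_estimate:
  assumes \<epsilon>0: "\<epsilon> = 0" and G0: "\<And>t. G\<^sub>1 t = 0" "E\<^sub>2 = 0"
    and y: "continuous_on {0..T} y" "y 0 = 0"
    and ez: "ez \<in> bochner_L2 T" "weak_primitive T ez z" and em: "em \<in> bochner_L2 T" "weak_primitive T em m"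
    and X: "X = exp ((2 * norm A + 1) * T) * (E\<^sub>F / c\<^sub>D)"
    and \<tau>: "\<tau> \<in> {0..T}"
  shows "(norm (y \<tau>))\<^sup>2 \<le> X" "c\<^sub>D * int_sq {0..\<tau>} em \<le> X"
    "c\<^sub>K\<^sup>2 * int_sq {0..\<tau>} ez \<le> 2 * E\<^sub>F + 2 * (norm D)\<^sup>2 * X / c\<^sub>D"
proof -
  note c = continuous_intros indefinite_integral_continuous_1 bochner_L2_sq_integrable
  have main: "(norm (y \<tau>))\<^sup>2 + 0 \<le> X" "c\<^sub>D * int_sq {0..\<tau>} em \<le> X"
    if \<tau>: "0 \<le> \<tau>" "\<tau> < T" for \<tau>
    using energy_limit[where n = "\<lambda>_. 0" and \<Theta> = 0, OF _ order_refl em refl _ _ \<tau>] by (simp_all add: \<epsilon>0 G0 y X)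
  show "(norm (y \<tau>))\<^sup>2 \<le> X"
    by (rule bound_at_right_end[OF T _ _ \<tau>]) (use main in \<open>auto intro!: c y\<close>)
  have em_le: "c\<^sub>D * int_sq {0..\<tau>} em \<le> X" if "\<tau> \<in> {0..T}" for \<tau>
    by (rule bound_at_right_end[OF T _ _ that]) (use main in \<open>auto intro!: c em\<close>)
  show "c\<^sub>D * int_sq {0..\<tau>} em \<le> X" by (rule em_le[OF \<tau>])
  \<comment> \<open>The flux equation turns increments of F and m into increments of z.\<close>
  define e where "e = 2 * E\<^sub>F + 2 * (norm D)\<^sup>2 * (X / c\<^sub>D)"
  have mE: "h1_energy_le T m (X / c\<^sub>D)"
    using em_le[of T] T c\<^sub>D by (intro h1_energy_le_trans[OF weak_primitive_h1_energy_le[OF em(2,1)]])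
      (simp add: pos_le_divide_eq mult.commute)
  have quot: "integral {0..\<tau>} (\<lambda>t. (norm ((z (t + \<delta>) - z t) /\<^sub>R \<delta>))\<^sup>2) \<le> e / c\<^sub>K\<^sup>2"
    if \<delta>: "0 < \<delta>" and \<tau>: "0 \<le> \<tau>" "\<tau> + \<delta> \<le> T" for \<delta> \<tau>
  proof -
    note sh = continuous_on_shift[OF _ less_imp_le[OF \<delta>] \<tau>(2)]
    let ?F = "\<lambda>t. (norm (F (t + \<delta>) - F t))\<^sup>2" and ?m = "\<lambda>t. (norm (m (t + \<delta>) - m t))\<^sup>2"
      and ?z = "\<lambda>t. (norm (z (t + \<delta>) - z t))\<^sup>2"
    have ints: "?F integrable_on {0..\<tau>}" "?m integrable_on {0..\<tau>}" "?z integrable_on {0..\<tau>}"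
      by (intro integrable_continuous_interval continuous_intros sh m_cont z_cont h1_energy_le_continuous[OF F])+
    have point: "c\<^sub>K\<^sup>2 * ?z t \<le> 2 * ?F t + 2 * (norm D)\<^sup>2 * ?m t" if t: "t \<in> {0..\<tau>}" for t
    proof -
      let ?dz = "z (t + \<delta>) - z t" and ?dm = "m (t + \<delta>) - m t"
      have tt: "t \<in> {0..T}" "t + \<delta> \<in> {0..T}" using t \<delta> \<tau> by auto
      have "K ?dz = (F (t + \<delta>) - F t) - D ?dm"
        using eq2[OF tt(1)] eq2[OF tt(2)] \<epsilon>0 by (simp add: blinfun.diff_right algebra_simps)
      moreover have "(c\<^sub>K * norm ?dz)\<^sup>2 \<le> (norm (K ?dz))\<^sup>2"
        using c\<^sub>K(1) by (intro power_mono c\<^sub>K(2) V_diff z_V tt) auto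
      ultimately have "c\<^sub>K\<^sup>2 * ?z t \<le> 2 * ?F t + 2 * (norm (D ?dm))\<^sup>2"
        using power2_norm_diff_le[of "F (t + \<delta>) - F t" "D ?dm"] by (simp add: power_mult_distrib)
      also have "\<dots> \<le> 2 * ?F t + 2 * (norm D)\<^sup>2 * ?m t"
        using power_mono[OF norm_blinfun[of D ?dm] norm_ge_zero, of 2] by (simp add: power_mult_distrib)
      finally show ?thesis .
    qed
    have "c\<^sub>K\<^sup>2 * integral {0..\<tau>} ?z \<le> 2 * integral {0..\<tau>} ?F + 2 * (norm D)\<^sup>2 * integral {0..\<tau>} ?m"
      by (rule has_integral_le[OF has_integral_mult_right[OF integrable_integral[OF ints(3)]]
            has_integral_add[OF has_integral_mult_right[OF integrable_integral[OF ints(1)]]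
              has_integral_mult_right[OF integrable_integral[OF ints(2)]]] point])
    also have "\<dots> \<le> 2 * (\<delta>\<^sup>2 * E\<^sub>F) + 2 * (norm D)\<^sup>2 * (\<delta>\<^sup>2 * (X / c\<^sub>D))"
      by (intro add_mono mult_left_mono h1_energy_difference_integral[OF F \<delta> \<tau>] h1_energy_difference_integral[OF mE \<delta> \<tau>]) auto
    also have "\<dots> = \<delta>\<^sup>2 * e" by (simp add: e_def algebra_simps)
    finally have "integral {0..\<tau>} ?z / \<delta>\<^sup>2 \<le> e / c\<^sub>K\<^sup>2" using c\<^sub>K(1) \<delta> by (simp add: field_simps)
    then show ?thesis unfolding scaled_square[OF \<delta>] by simp
  qed
  have "int_sq {0..\<tau>} ez \<le> e / c\<^sub>K\<^sup>2" if "0 \<le> \<tau>" "\<tau> < T" for \<tau>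
    by (intro difference_quotients_bound_L2[OF ez that] eventually_at_rightI[of 0 "T - \<tau>"] quot) (use that in auto)
  then have ez_le: "c\<^sub>K\<^sup>2 * int_sq {0..\<tau>} ez \<le> e" if "0 \<le> \<tau>" "\<tau> < T" for \<tau>
    using that c\<^sub>K(1) by (simp add: pos_le_divide_eq mult.commute)
  have "c\<^sub>K\<^sup>2 * int_sq {0..\<tau>} ez \<le> e"
    by (rule bound_at_right_end[OF T _ ez_le \<tau>]) (auto intro!: c ez)
  then show "c\<^sub>K\<^sup>2 * int_sq {0..\<tau>} ez \<le> 2 * E\<^sub>F + 2 * (norm D)\<^sup>2 * X / c\<^sub>D"
    by (simp add: e_def)
qed

end

section \<open>Absorption and the bound of the flux velocity\<close>

text \<open>The critical product is \<open>s sqrt X (1 + sqrt \<epsilon>)\<close>, of which half of \<open>X\<close> is absorbed at the price of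
  \<open>(1 + \<epsilon>) s\<^sup>2\<close>.\<close>

lemma absorb_velocity_bound:
  fixes X Z s r \<epsilon> C\<^sub>1 C\<^sub>2 :: real
  assumes "X \<le> C\<^sub>1 * (s\<^sup>2 + r\<^sup>2 / \<epsilon> + s * Z)" "Z \<le> C\<^sub>2 * (s + r + sqrt X + sqrt \<epsilon> * sqrt X)"
    and "0 < \<epsilon>" "0 \<le> s" "0 \<le> C\<^sub>1" "0 \<le> C\<^sub>2" "0 \<le> X"
  shows "X \<le> 2 * (C\<^sub>1 + C\<^sub>1 * C\<^sub>2 + (C\<^sub>1 * C\<^sub>2)\<^sup>2) * ((1 + \<epsilon>) * s\<^sup>2 + r\<^sup>2 / \<epsilon>)"
proof -
  define k where "k = C\<^sub>1 * C\<^sub>2"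
  define x where "x = sqrt X"
  define e where "e = sqrt \<epsilon>"
  have k: "0 \<le> k" and xX: "X = x\<^sup>2" and ee: "\<epsilon> = e\<^sup>2" and e: "0 < e" and x: "0 \<le> x"
    using assms by (auto simp: k_def x_def e_def)
  have sr: "s * r \<le> \<epsilon> * s\<^sup>2 + r\<^sup>2 / \<epsilon>"
  proof -
    have "2 * (e * s) * (r / e) \<le> (e * s)\<^sup>2 + (r / e)\<^sup>2" by (rule sum_squares_bound)
    then have "2 * (s * r) \<le> \<epsilon> * s\<^sup>2 + r\<^sup>2 / \<epsilon>" using e by (simp add: ee power_mult_distrib power_divide)
    moreover have "0 \<le> \<epsilon> * s\<^sup>2" "0 \<le> r\<^sup>2 / \<epsilon>" using assms(3) by auto
    ultimately show ?thesis by linarith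
  qed
  have "C\<^sub>1 * (s * Z) \<le> C\<^sub>1 * (s * (C\<^sub>2 * (s + r + x + e * x)))"
    using assms by (intro mult_left_mono) (auto simp: x_def e_def)
  then have "X \<le> C\<^sub>1 * s\<^sup>2 + C\<^sub>1 * (r\<^sup>2 / \<epsilon>) + k * (s\<^sup>2 + s * r + s * x * (1 + e))"
    using assms(1) by (simp add: k_def power2_eq_square algebra_simps)
  also have "\<dots> = C\<^sub>1 * s\<^sup>2 + C\<^sub>1 * (r\<^sup>2 / \<epsilon>) + k * s\<^sup>2 + k * (s * r) + k * (s * x * (1 + e))"
    by (simp add: algebra_simps)
  also have "k * (s * x * (1 + e)) \<le> X / 2 + k\<^sup>2 * ((1 + \<epsilon>) * s\<^sup>2)"
  proof -
    have "2 * x * (k * s * (1 + e)) \<le> x\<^sup>2 + (k * s * (1 + e))\<^sup>2" by (rule sum_squares_bound)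
    moreover have "(k * s * (1 + e))\<^sup>2 \<le> k\<^sup>2 * s\<^sup>2 * (2 * (1 + \<epsilon>))"
    proof -
      have "(1 + e)\<^sup>2 \<le> 2 * (1 + \<epsilon>)" using sum_squares_bound[of 1 e] by (simp add: ee power2_eq_square algebra_simps)
      then show ?thesis by (simp add: power_mult_distrib mult_left_mono)
    qed
    ultimately show ?thesis by (simp add: xX algebra_simps)
  qed
  also have "k * (s * r) \<le> k * (\<epsilon> * s\<^sup>2 + r\<^sup>2 / \<epsilon>)" using sr k by (rule mult_left_mono)
  finally have "X / 2 \<le> C\<^sub>1 * s\<^sup>2 + C\<^sub>1 * (r\<^sup>2 / \<epsilon>) + k * s\<^sup>2 + k * (\<epsilon> * s\<^sup>2 + r\<^sup>2 / \<epsilon>) + k\<^sup>2 * ((1 + \<epsilon>) * s\<^sup>2)"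
    by linarith
  also have "\<dots> \<le> (C\<^sub>1 + k + k\<^sup>2) * ((1 + \<epsilon>) * s\<^sup>2 + r\<^sup>2 / \<epsilon>)"
  proof -
    have "0 \<le> C\<^sub>1 * (\<epsilon> * s\<^sup>2)" "0 \<le> k\<^sup>2 * (r\<^sup>2 / \<epsilon>)" using assms by auto
    then show ?thesis by (simp add: algebra_simps add_divide_distrib)
  qed
  finally have "X \<le> 2 * ((C\<^sub>1 + k + k\<^sup>2) * ((1 + \<epsilon>) * s\<^sup>2 + r\<^sup>2 / \<epsilon>))" by linarith
  then show ?thesis by (simp only: k_def mult.assoc)
qed

lemma norm_blinfun_inner_right: "norm (blinfun_inner_right x) = norm x"
proof (rule antisym)
  show "norm (blinfun_inner_right x) \<le> norm x"
    by (rule norm_blinfun_bound) (use Cauchy_Schwarz_ineq2 in auto)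
  show "norm x \<le> norm (blinfun_inner_right x)"
  proof (cases "x = 0")
    case False
    have "norm x * norm x \<le> norm (blinfun_inner_right x) * norm x"
      using norm_blinfun[of "blinfun_inner_right x" x] by (simp add: power2_norm_eq_inner[symmetric] power2_eq_square)
    then show ?thesis using False by simp
  qed simp
qed

context damped_system
begin

text \<open>The velocity is a limit of elements of \<open>\<iota> V\<close>, so it can be tested with its own approximations.\<close>

lemma initial_velocity_bound:
  assumes "\<And>q. q \<in> V \<Longrightarrow> y 0 \<bullet> \<iota> q \<le> \<beta> * norm (\<iota> q)" and \<beta>: "0 \<le> \<beta>"
  shows "norm (y 0) \<le> \<beta>"
proof -
  let ?q = "\<lambda>\<delta>. (\<iota> (z (0 + \<delta>)) - \<iota> (z 0)) /\<^sub>R \<delta>"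
  have lim: "(?q \<longlongrightarrow> y 0) (at_right 0)" by (rule right_quotient_tendsto[OF z_deriv]) (use T in auto)
  have "y 0 \<bullet> y 0 \<le> \<beta> * norm (y 0)"
  proof (rule tendsto_le[of "at_right 0"])
    show "((\<lambda>\<delta>. \<beta> * norm (?q \<delta>)) \<longlongrightarrow> \<beta> * norm (y 0)) (at_right 0)"
      and "((\<lambda>\<delta>. y 0 \<bullet> ?q \<delta>) \<longlongrightarrow> y 0 \<bullet> y 0) (at_right 0)"
      by (intro tendsto_intros lim)+
    show "\<forall>\<^sub>F \<delta> in at_right 0. y 0 \<bullet> ?q \<delta> \<le> \<beta> * norm (?q \<delta>)"
    proof (rule eventually_at_rightI[of 0 T])
      fix \<delta> assume \<delta>: "\<delta> \<in> {0<..<T}"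
      have "y 0 \<bullet> \<iota> (z \<delta> - z 0) \<le> \<beta> * norm (\<iota> (z \<delta> - z 0))"
        by (rule assms(1)) (use \<delta> in \<open>auto intro!: V_diff z_V\<close>)
      then have "inverse \<delta> * (y 0 \<bullet> \<iota> (z \<delta> - z 0)) \<le> inverse \<delta> * (\<beta> * norm (\<iota> (z \<delta> - z 0)))"
        using \<delta> by (intro mult_left_mono) auto
      then show "y 0 \<bullet> ?q \<delta> \<le> \<beta> * norm (?q \<delta>)"
        unfolding inner_scaleR_right norm_scaleR using \<delta> by (simp add: blinfun.diff_right mult.left_commute)
    qed (rule T)
  qed simp
  then have "norm (y 0) * norm (y 0) \<le> \<beta> * norm (y 0)" by (simp add: power2_norm_eq_inner[symmetric] power2_eq_square)
  then show ?thesis using \<beta> by (cases "norm (y 0) = 0") auto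
qed

text \<open>Here \<open>s\<close> measures the data, \<open>r\<close> the initial residual, and \<open>k\<close> collects the constants of the
  operators.  The second equation at the time where \<open>\<parallel>z\<parallel>\<close> is largest bounds \<open>Z\<close> by the energy, which
  closes the estimate.\<close>

lemma velocity_bound:
  assumes \<epsilon>0: "0 < \<epsilon>" and y: "continuous_on {0..T} y" and md: "continuous_on {0..T} md"
    and dG: "\<And>t. t \<in> {0..T} \<Longrightarrow> (G\<^sub>1 has_vector_derivative G' t) (at t within {0..T})"
    and ks: "0 \<le> k" "0 \<le> s" and G': "\<And>t. t \<in> {0..T} \<Longrightarrow> norm (G' t) \<le> k * s" and E: "h1_energy_le T G' (k * s\<^sup>2)"
    and energies: "E\<^sub>2 \<le> k * s\<^sup>2" "E\<^sub>F \<le> k * s\<^sup>2"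
    and F_le: "\<And>t. t \<in> {0..T} \<Longrightarrow> norm (F t) \<le> k * s"
    and r: "r = \<epsilon> * norm (md 0)" and y0: "norm (y 0) \<le> k * s" and m0: "norm (m 0) \<le> k * (s + r)"
    and C\<^sub>1: "C\<^sub>1 = exp ((2 * norm A + 1) * T) * (k\<^sup>2 + 1 + k + k / c\<^sub>D + 2 * (2 * k + sqrt (T * k)))"
    and C\<^sub>2: "C\<^sub>2 = (k + norm D * k + norm D * sqrt (T / c\<^sub>D) + 1) / c\<^sub>K"
  shows "int_sq {0..T} md
    \<le> (1 / c\<^sub>D + T) * (2 * (C\<^sub>1 + C\<^sub>1 * C\<^sub>2 + (C\<^sub>1 * C\<^sub>2)\<^sup>2)) * (s\<^sup>2 + r\<^sup>2 / \<epsilon>)"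
proof -
  have r0: "0 \<le> r" using r \<epsilon>0 by simp
  have C0: "0 \<le> C\<^sub>1" "0 \<le> C\<^sub>2" unfolding C\<^sub>1 C\<^sub>2 using ks c\<^sub>D c\<^sub>K(1) T by auto
  have "\<exists>t\<in>{0..T}. \<forall>t'\<in>{0..T}. norm (z t') \<le> norm (z t)"
    by (rule continuous_attains_sup) (use T in \<open>auto intro!: continuous_intros z_cont\<close>)
  then obtain t where t: "t \<in> {0..T}" and max: "\<And>t'. t' \<in> {0..T} \<Longrightarrow> norm (z t') \<le> norm (z t)" by blast
  define Z where "Z = norm (z t)"
  define X where "X = exp ((2 * norm A + 1) * T) * ((norm (y 0))\<^sup>2 + \<epsilon> * (norm (md 0))\<^sup>2
      + (E\<^sub>2 + E\<^sub>F / c\<^sub>D + 2 * ((2 * (k * s) + sqrt (T * (k * s\<^sup>2))) * Z)))"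
  have est: "(norm (y \<tau>))\<^sup>2 + \<epsilon> * (norm (md \<tau>))\<^sup>2 \<le> X" "c\<^sub>D * int_sq {0..\<tau>} md \<le> X"
    if "\<tau> \<in> {0..T}" for \<tau>
    using velocity_estimate[OF \<epsilon>0 y md dG G' E max[folded Z_def] X_def that] by auto
  define Q where "Q = int_sq {0..T} md"
  have md2: "(\<lambda>t. (norm (md t))\<^sup>2) integrable_on {0..T}"
    by (intro integrable_continuous_interval continuous_intros md)
  have Q0: "0 \<le> Q" unfolding Q_def by (rule integral_nonneg[OF md2]) simp
  have QX: "c\<^sub>D * Q \<le> X" unfolding Q_def by (rule est(2)) (use T in auto)
  have X0: "0 \<le> X" using QX Q0 c\<^sub>D by (meson mult_nonneg_nonneg less_imp_le order_trans)
  have pointwise: "\<epsilon> * (norm (md t))\<^sup>2 \<le> X" if "t \<in> {0..T}" for t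
    using est(1)[OF that] zero_le_power2[of "norm (y t)"] by linarith
  have X_le: "X \<le> C\<^sub>1 * (s\<^sup>2 + r\<^sup>2 / \<epsilon> + s * Z)"
  proof -
    have "\<epsilon> * (norm (md 0))\<^sup>2 = r\<^sup>2 / \<epsilon>" using \<epsilon>0 by (simp add: r power_mult_distrib power2_eq_square)
    moreover have "(norm (y 0))\<^sup>2 \<le> k\<^sup>2 * s\<^sup>2"
      using power_mono[OF y0 norm_ge_zero, of 2] by (simp add: power_mult_distrib)
    moreover have "E\<^sub>F / c\<^sub>D \<le> k / c\<^sub>D * s\<^sup>2" using energies(2) c\<^sub>D by (simp add: divide_right_mono)
    moreover have "sqrt (T * (k * s\<^sup>2)) = sqrt (T * k) * s" using ks by (simp add: real_sqrt_mult)
    ultimately have "(norm (y 0))\<^sup>2 + \<epsilon> * (norm (md 0))\<^sup>2 + (E\<^sub>2 + E\<^sub>F / c\<^sub>D + 2 * ((2 * (k * s) + sqrt (T * (k * s\<^sup>2))) * Z))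
      \<le> (k\<^sup>2 + k + k / c\<^sub>D) * s\<^sup>2 + r\<^sup>2 / \<epsilon> + 2 * (2 * k + sqrt (T * k)) * (s * Z)"
      using energies(1) by (simp add: algebra_simps)
    also have "\<dots> \<le> (k\<^sup>2 + 1 + k + k / c\<^sub>D + 2 * (2 * k + sqrt (T * k))) * (s\<^sup>2 + r\<^sup>2 / \<epsilon> + s * Z)"
    proof -
      define a where "a = k\<^sup>2 + k + k / c\<^sub>D"
      define b where "b = 2 * (2 * k + sqrt (T * k))"
      have ab: "0 \<le> a" "0 \<le> b" using ks c\<^sub>D T by (auto simp: a_def b_def)
      have pos: "0 \<le> s\<^sup>2" "0 \<le> r\<^sup>2 / \<epsilon>" "0 \<le> s * Z" using ks \<epsilon>0 by (auto simp: Z_def)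
      have "a * s\<^sup>2 + r\<^sup>2 / \<epsilon> + b * (s * Z) \<le> (a + 1 + b) * s\<^sup>2 + (a + 1 + b) * (r\<^sup>2 / \<epsilon>) + (a + 1 + b) * (s * Z)"
        using mult_right_mono[OF _ pos(1), of a "a + 1 + b"] mult_right_mono[OF _ pos(2), of 1 "a + 1 + b"]
          mult_right_mono[OF _ pos(3), of b "a + 1 + b"] ab by linarith
      also have "\<dots> = (a + 1 + b) * (s\<^sup>2 + r\<^sup>2 / \<epsilon> + s * Z)" by (simp only: distrib_left)
      also have "a + 1 + b = k\<^sup>2 + 1 + k + k / c\<^sub>D + 2 * (2 * k + sqrt (T * k))" by (simp add: a_def b_def)
      finally show ?thesis unfolding a_def b_def .
    qed
    finally show ?thesis unfolding X_def C\<^sub>1 by (simp only: mult.assoc) (rule mult_left_mono, simp_all)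
  qed
  have Z_le: "Z \<le> C\<^sub>2 * (s + r + sqrt X + sqrt \<epsilon> * sqrt X)"
  proof -
    have "norm (m t - m 0) \<le> sqrt (T / c\<^sub>D) * sqrt X"
    proof -
      have L2: "md \<in> bochner_L2 T" by (rule continuous_in_bochner_L2[OF md])
      have wp: "weak_primitive T md (\<lambda>t. m t - m 0)"
        by (rule weak_primitive_of_derivative) (use m_deriv \<epsilon>0 in auto)
      have "norm ((m t - m 0) - (m 0 - m 0)) \<le> integral {0..t} (\<lambda>r. norm (md r))"
        by (rule weak_primitive_increment_bound[OF wp L2]) (use t in auto)
      then have "(norm (m t - m 0))\<^sup>2 \<le> (integral {0..t} (\<lambda>r. norm (md r)))\<^sup>2" by (intro power_mono) auto
      also have "\<dots> \<le> t * int_sq {0..t} md"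
        using bochner_L2_increment[OF L2, of 0 t] t by simp
      also have "\<dots> \<le> T * (X / c\<^sub>D)"
      proof (rule mult_mono)
        show "int_sq {0..t} md \<le> X / c\<^sub>D"
          using est(2)[OF t] c\<^sub>D by (simp add: pos_le_divide_eq mult.commute)
      qed (use t T integrable_subinterval_real[OF md2, of 0 t] in \<open>auto intro!: integral_nonneg\<close>)
      finally have "sqrt ((norm (m t - m 0))\<^sup>2) \<le> sqrt (T / c\<^sub>D * X)" by (intro real_sqrt_le_mono) simp
      then show ?thesis by (simp add: real_sqrt_mult[symmetric])
    qed
    then have mt: "norm (m t) \<le> k * (s + r) + sqrt (T / c\<^sub>D) * sqrt X"
      using m0 norm_triangle_ineq2[of "m t" "m 0"] by linarith
    have "sqrt (\<epsilon> * (norm (md t))\<^sup>2) \<le> sqrt X" using pointwise[OF t] by (rule real_sqrt_le_mono)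
    then have "sqrt \<epsilon> * (sqrt \<epsilon> * norm (md t)) \<le> sqrt \<epsilon> * sqrt X"
      using \<epsilon>0 by (intro mult_left_mono) (auto simp: real_sqrt_mult)
    then have emd: "\<epsilon> * norm (md t) \<le> sqrt \<epsilon> * sqrt X" using \<epsilon>0 by (simp add: mult.assoc[symmetric])
    have "K (z t) = F t - D (m t) - \<epsilon> *\<^sub>R blinfun_inner_right (md t)" using eq2[OF t] by (simp add: algebra_simps)
    then have "norm (K (z t)) \<le> norm (F t) + norm (D (m t)) + \<epsilon> * norm (md t)"
      using norm_triangle_ineq4[of "F t - D (m t)" "\<epsilon> *\<^sub>R blinfun_inner_right (md t)"]
        norm_triangle_ineq4[of "F t" "D (m t)"] \<epsilon>0 by (simp add: norm_blinfun_inner_right)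
    also have "\<dots> \<le> k * s + norm D * (k * (s + r) + sqrt (T / c\<^sub>D) * sqrt X) + sqrt \<epsilon> * sqrt X"
      by (intro add_mono F_le t emd order_trans[OF norm_blinfun] mult_left_mono mt norm_ge_zero)
    also have "\<dots> \<le> (k + norm D * k + norm D * sqrt (T / c\<^sub>D) + 1) * (s + r + sqrt X + sqrt \<epsilon> * sqrt X)"
    proof -
      define d where "d = norm D"
      define g where "g = sqrt (T / c\<^sub>D)"
      define x where "x = sqrt X"
      define ex where "ex = sqrt \<epsilon> * sqrt X"
      have p: "0 \<le> d" "0 \<le> g" "0 \<le> x" "0 \<le> ex" using T c\<^sub>D X0 \<epsilon>0 by (auto simp: d_def g_def x_def ex_def)
      have "0 \<le> k * r" "0 \<le> k * x" "0 \<le> k * ex" "0 \<le> d * k * x" "0 \<le> d * k * ex"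
        "0 \<le> d * g * s" "0 \<le> d * g * r" "0 \<le> d * g * ex" using p ks r0 by auto
      then have "k * s + d * (k * (s + r) + g * x) + ex \<le> (k + d * k + d * g + 1) * (s + r + x + ex)"
        using p(3) ks(2) r0 by (simp add: algebra_simps)
      then show ?thesis unfolding d_def g_def x_def ex_def .
    qed
    finally have "c\<^sub>K * Z \<le> (k + norm D * k + norm D * sqrt (T / c\<^sub>D) + 1) * (s + r + sqrt X + sqrt \<epsilon> * sqrt X)"
      using c\<^sub>K(2)[OF z_V[OF t]] by (simp add: Z_def)
    then show ?thesis unfolding C\<^sub>2 using c\<^sub>K(1) by (simp add: pos_le_divide_eq mult.commute)
  qed
  define C\<^sub>3 where "C\<^sub>3 = 2 * (C\<^sub>1 + C\<^sub>1 * C\<^sub>2 + (C\<^sub>1 * C\<^sub>2)\<^sup>2)"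
  have C3: "0 \<le> C\<^sub>3" using C0 by (simp add: C\<^sub>3_def)
  have X_bd: "X \<le> C\<^sub>3 * ((1 + \<epsilon>) * s\<^sup>2 + r\<^sup>2 / \<epsilon>)"
    unfolding C\<^sub>3_def by (rule absorb_velocity_bound[OF X_le Z_le \<epsilon>0 ks(2) C0 X0])
  \<comment> \<open>For large values of the parameter the pointwise bound is the stronger one.\<close>
  have "\<epsilon> * Q \<le> T * X"
  proof -
    have "integral {0..T} (\<lambda>t. \<epsilon> * (norm (md t))\<^sup>2) \<le> integral {0..T} (\<lambda>_. X)"
      by (rule integral_le) (use md2 pointwise in \<open>auto intro: integrable_on_mult_right\<close>)
    then show ?thesis using T by (simp add: Q_def)
  qed
  moreover have "Q \<le> 1 / c\<^sub>D * X" using QX c\<^sub>D by (simp add: pos_le_divide_eq mult.commute)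
  ultimately have "(1 + \<epsilon>) * Q \<le> (1 / c\<^sub>D + T) * X" by (simp add: algebra_simps)
  also have "\<dots> \<le> (1 / c\<^sub>D + T) * (C\<^sub>3 * ((1 + \<epsilon>) * s\<^sup>2 + r\<^sup>2 / \<epsilon>))"
    using X_bd T c\<^sub>D by (intro mult_left_mono) auto
  also have "\<dots> \<le> (1 / c\<^sub>D + T) * (C\<^sub>3 * ((1 + \<epsilon>) * (s\<^sup>2 + r\<^sup>2 / \<epsilon>)))"
    using T c\<^sub>D C3 \<epsilon>0 by (intro mult_left_mono) (auto simp: algebra_simps add_divide_distrib)
  finally have "(1 + \<epsilon>) * Q \<le> (1 + \<epsilon>) * ((1 / c\<^sub>D + T) * C\<^sub>3 * (s\<^sup>2 + r\<^sup>2 / \<epsilon>))" by (simp only: mult_ac)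
  then show ?thesis unfolding Q_def C\<^sub>3_def[symmetric] using \<epsilon>0 by (simp only: mult_le_cancel_left_pos)
qed

end

text \<open>The classical solution with its derivatives named and the multiplier eliminated by testing with
  the kernel of \<open>B\<close>.\<close>

definition eps_evolution ::
  "real \<Rightarrow> ('p::{real_inner,banach} \<Rightarrow>\<^sub>L 'h::{real_inner,banach}) \<Rightarrow>
   ('h \<Rightarrow>\<^sub>L ('h \<Rightarrow>\<^sub>L real)) \<Rightarrow> ('p \<Rightarrow>\<^sub>L ('m::{real_inner,banach} \<Rightarrow>\<^sub>L real)) \<Rightarrow>
   ('m \<Rightarrow>\<^sub>L ('m \<Rightarrow>\<^sub>L real)) \<Rightarrow> ('p \<Rightarrow>\<^sub>L ('q::{real_inner,banach} \<Rightarrow>\<^sub>L real)) \<Rightarrow>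
   real \<Rightarrow> (real \<Rightarrow> 'p \<Rightarrow>\<^sub>L real) \<Rightarrow> (real \<Rightarrow> 'm \<Rightarrow>\<^sub>L real) \<Rightarrow> (real \<Rightarrow> 'q \<Rightarrow>\<^sub>L real) \<Rightarrow>
   (real \<Rightarrow> 'p) \<Rightarrow> (real \<Rightarrow> 'h) \<Rightarrow> (real \<Rightarrow> 'm) \<Rightarrow> (real \<Rightarrow> 'm) \<Rightarrow> bool" where
  "eps_evolution T \<iota> A K D B \<epsilon> g f h p pd m md \<longleftrightarrow>
     continuous_on {0..T} p \<and> continuous_on {0..T} pd \<and> continuous_on {0..T} md \<and>
     (\<forall>t\<in>{0..T}.
        ((\<lambda>s. \<iota> (p s)) has_vector_derivative pd t) (at t within {0..T}) \<and>
        (m has_vector_derivative md t) (at t within {0..T}) \<and>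
        (\<forall>q\<in>op_ker B. pd t \<bullet> \<iota> q + A (\<iota> (p t)) (\<iota> q) - K q (m t) = g t q) \<and>
        \<epsilon> *\<^sub>R blinfun_inner_right (md t) + K (p t) + D (m t) = f t \<and>
        B (p t) = h t)"

lemma classical_solution_imp_eps_evolution:
  assumes "classical_solution T \<iota> A K D B \<epsilon> g f h p_init m_init p m lam"
  obtains pd md where "eps_evolution T \<iota> A K D B \<epsilon> g f h p pd m md" "p 0 = p_init" "m 0 = m_init"
proof -
  obtain pd md where c: "continuous_on {0..T} pd" "continuous_on {0..T} md"
    and e: "\<And>t. t \<in> {0..T} \<Longrightarrow>
           ((\<lambda>s. \<iota> (p s)) has_vector_derivative pd t) (at t within {0..T}) \<and>
           (m has_vector_derivative md t) (at t within {0..T}) \<and>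
           (blinfun_inner_right (pd t) o\<^sub>L \<iota>) + (A (\<iota> (p t)) o\<^sub>L \<iota>) - dual_op K (m t)
             + dual_op B (lam t) = g t \<and>
           \<epsilon> *\<^sub>R blinfun_inner_right (md t) + K (p t) + D (m t) = f t \<and>
           B (p t) = h t"
    using assms unfolding classical_solution_def by blast
  have "pd t \<bullet> \<iota> q + A (\<iota> (p t)) (\<iota> q) - K q (m t) = g t q" if "t \<in> {0..T}" "q \<in> op_ker B" for t q
  proof -
    have "((blinfun_inner_right (pd t) o\<^sub>L \<iota>) + (A (\<iota> (p t)) o\<^sub>L \<iota>) - dual_op K (m t) + dual_op B (lam t)) q = g t q"
      using e[OF that(1)] by simp
    then show ?thesis using that(2) by (simp add: blinfun.add_left blinfun.diff_left op_ker_def)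
  qed
  then have "eps_evolution T \<iota> A K D B \<epsilon> g f h p pd m md"
    using assms c e unfolding eps_evolution_def classical_solution_def by blast
  then show ?thesis using that assms unfolding classical_solution_def by blast
qed

lemma op_ker_diff: "x \<in> op_ker B \<Longrightarrow> x' \<in> op_ker B \<Longrightarrow> x - x' \<in> op_ker B"
  by (simp add: op_ker_def blinfun.diff_right)

text \<open>The norm of \<open>m(0)\<close> does not belong to the data.  Testing the second equation with \<open>m(0)\<close>, where the
  term \<open>\<langle>K z, m\<rangle>\<close> is known from the compatibility condition, bounds it by the data and the residual.\<close>

lemma initial_flux_bound:
  fixes D :: "'m::real_normed_vector \<Rightarrow>\<^sub>L ('m \<Rightarrow>\<^sub>L real)" and K :: "'p::real_normed_vector \<Rightarrow>\<^sub>L ('m \<Rightarrow>\<^sub>L real)"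
  assumes c: "0 < c\<^sub>D" "0 < c\<^sub>K" and "c\<^sub>D * (norm m)\<^sup>2 \<le> D m m" "c\<^sub>K * norm z \<le> norm (K z)"
    and eq: "K z + D m = \<Phi>" and "\<bar>K z m\<bar> \<le> \<sigma> * norm z" "norm \<Phi> \<le> \<sigma>"
  shows "norm m \<le> ((1 + (norm D + 1) / c\<^sub>K) / c\<^sub>D + 1) * \<sigma>"
proof -
  have \<sigma>: "0 \<le> \<sigma>" using assms(7) norm_ge_zero order_trans by blast
  have z: "norm z \<le> (\<sigma> + norm D * norm m) / c\<^sub>K"
  proof -
    have "K z = \<Phi> - D m" using eq by (simp add: eq_diff_eq)
    then have "norm (K z) \<le> norm \<Phi> + norm (D m)" using norm_triangle_ineq4 by metis
    also have "\<dots> \<le> \<sigma> + norm D * norm m" by (intro add_mono assms norm_blinfun)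
    finally show ?thesis using assms(4) c by (simp add: pos_le_divide_eq mult.commute)
  qed
  have "D m m = \<Phi> m - K z m" using eq by (metis add_diff_cancel_left' blinfun.diff_left)
  also have "\<dots> \<le> \<sigma> * norm m + \<sigma> * ((\<sigma> + norm D * norm m) / c\<^sub>K)"
  proof -
    have "\<Phi> m \<le> norm \<Phi> * norm m" using norm_blinfun[of \<Phi> m] by simp
    also have "\<dots> \<le> \<sigma> * norm m" by (intro mult_right_mono assms) simp
    finally have "\<Phi> m \<le> \<sigma> * norm m" .
    moreover have "\<sigma> * norm z \<le> \<sigma> * ((\<sigma> + norm D * norm m) / c\<^sub>K)" using z \<sigma> by (rule mult_left_mono)
    ultimately show ?thesis using assms(6) by linarith
  qed
  finally have q: "c\<^sub>D * (norm m)\<^sup>2 \<le> \<sigma> * norm m + \<sigma> * ((\<sigma> + norm D * norm m) / c\<^sub>K)" using assms(3) by linarith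
  have C: "0 \<le> (1 + (norm D + 1) / c\<^sub>K) / c\<^sub>D" using c by simp
  show ?thesis
  proof (cases "norm m \<le> \<sigma>")
    case True
    then show ?thesis using mult_nonneg_nonneg[OF C \<sigma>] by (simp add: distrib_right)
  next
    case False
    then have "\<sigma> + norm D * norm m \<le> (norm D + 1) * norm m" by (simp add: algebra_simps)
    then have "\<sigma> * ((\<sigma> + norm D * norm m) / c\<^sub>K) \<le> \<sigma> * ((norm D + 1) * norm m / c\<^sub>K)"
      using \<sigma> c by (intro mult_left_mono divide_right_mono) auto
    with q have "c\<^sub>D * norm m * norm m \<le> (\<sigma> * (1 + (norm D + 1) / c\<^sub>K)) * norm m"
      by (simp add: power2_eq_square algebra_simps)
    moreover have "0 < norm m" using False \<sigma> by linarith
    ultimately have "c\<^sub>D * norm m \<le> \<sigma> * (1 + (norm D + 1) / c\<^sub>K)" by (simp only: mult_le_cancel_right_pos)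
    then have "norm m \<le> \<sigma> * (1 + (norm D + 1) / c\<^sub>K) / c\<^sub>D" using c by (simp add: pos_le_divide_eq mult.commute)
    then show ?thesis using \<sigma> by (simp add: algebra_simps)
  qed
qed

section \<open>The flux velocity in terms of the data\<close>

text \<open>The constraint is removed by subtracting \<open>R h\<close>, whose derivative in time goes into the
  functional on \<open>H\<close>.  The initial velocity \<open>z'(0)\<close> is estimated by testing the first equation with
  the kernel, where \<open>K\<^sup>* m(0) + g1(0)\<close> is replaced by \<open>m_star\<close>; in this way only the norm of
  \<open>\<iota> (p 0)\<close> enters.\<close>

lemma eps_velocity_bound:
  fixes \<iota> :: "'p::{real_inner,banach} \<Rightarrow>\<^sub>L 'h::{real_inner,banach}"
    and A :: "'h \<Rightarrow>\<^sub>L ('h \<Rightarrow>\<^sub>L real)"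
    and K :: "'p \<Rightarrow>\<^sub>L ('m::{real_inner,banach} \<Rightarrow>\<^sub>L real)"
    and D :: "'m \<Rightarrow>\<^sub>L ('m \<Rightarrow>\<^sub>L real)"
    and B :: "'p \<Rightarrow>\<^sub>L ('q::{real_inner,banach} \<Rightarrow>\<^sub>L real)"
  assumes T: "0 < T" and c\<^sub>D: "0 < c\<^sub>D" "\<And>m. c\<^sub>D * (norm m)\<^sup>2 \<le> D m m" and B: "0 < inf_sup_const B"
    and c\<^sub>K: "0 < c\<^sub>K" "\<And>q. q \<in> op_ker B \<Longrightarrow> c\<^sub>K * norm q \<le> norm (K q)"
  obtains C where "0 < C"
    and "\<And>g1 g2 f h m_star \<epsilon> p pd m md.
      \<lbrakk>g1 \<in> sobolev_bochner 2 T; g2 \<in> sobolev_bochner 1 T; f \<in> sobolev_bochner 1 T; h \<in> sobolev_bochner 2 T; 0 < \<epsilon>;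
       eps_evolution T \<iota> A K D B \<epsilon> (\<lambda>t. g1 t + (g2 t o\<^sub>L \<iota>)) f h p pd m md;
       \<And>q. q \<in> op_ker B \<Longrightarrow> m_star \<bullet> \<iota> q = K q (m 0) + g1 0 q\<rbrakk> \<Longrightarrow>
      int_sq {0..T} md \<le> C *
        ((norm (\<iota> (p 0)) + norm m_star + sobolev_norm 2 T g1 + sobolev_norm 1 T g2
          + sobolev_norm 1 T f + sobolev_norm 2 T h)\<^sup>2 + (norm (f 0 - K (p 0) - D (m 0)))\<^sup>2 / \<epsilon>)"
proof -
  obtain R :: "('q \<Rightarrow>\<^sub>L real) \<Rightarrow>\<^sub>L 'p" where R: "\<And>\<phi>. B (R \<phi>) = \<phi>"
    using inf_sup_imp_right_inverse[OF B] by blast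
  define \<kappa> where "\<kappa> = sobolev_const T"
  note emb = sobolev_embedding[OF T, folded \<kappa>_def] and kap = sobolev_const_pos[OF T, folded \<kappa>_def]
  define \<rho> where "\<rho> = norm R"
  \<comment> \<open>Bounds, in units of \<open>s\<close>, \<open>s\<^sup>2\<close> or \<open>s + r\<close>, of \<open>F\<close>, its energy, the energy of \<open>G\<^sub>2\<close>, \<open>y(0)\<close> and \<open>m(0)\<close>.\<close>
  define kF where "kF = \<kappa> + norm K * \<rho> * \<kappa>"
  define kE where "kE = 2 + 2 * (norm K * \<rho>)\<^sup>2"
  define k2 where "k2 = 4 + 4 * (norm \<iota> * \<rho>)\<^sup>2 + 2 * (norm A * norm \<iota> * \<rho>)\<^sup>2"
  define ky where "ky = norm A + 1 + \<kappa> + norm \<iota> * \<rho> * \<kappa>"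
  define km where "km = ((1 + (norm D + 1) / c\<^sub>K) / c\<^sub>D + 1) * (kF + norm \<iota> + \<kappa> + 1)"
  define k where "k = 1 + \<kappa> + kF + kE + k2 + ky + km"
  have nonneg: "0 \<le> \<rho>" "0 \<le> kF" "0 \<le> kE" "0 \<le> k2" "0 \<le> ky" "0 \<le> km"
    using kap c\<^sub>D(1) c\<^sub>K(1)
    by (auto simp: \<rho>_def kF_def kE_def k2_def ky_def km_def)
  then have k: "1 \<le> k" "\<kappa> \<le> k" "kF \<le> k" "kE \<le> k" "k2 \<le> k" "ky \<le> k" "km \<le> k" using kap by (auto simp: k_def)
  define C\<^sub>1 where "C\<^sub>1 = exp ((2 * norm A + 1) * T) * (k\<^sup>2 + 1 + k + k / c\<^sub>D + 2 * (2 * k + sqrt (T * k)))"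
  define C\<^sub>2 where "C\<^sub>2 = (k + norm D * k + norm D * sqrt (T / c\<^sub>D) + 1) / c\<^sub>K"
  define C where "C = (1 / c\<^sub>D + T) * (2 * (C\<^sub>1 + C\<^sub>1 * C\<^sub>2 + (C\<^sub>1 * C\<^sub>2)\<^sup>2))"
  have "0 \<le> C\<^sub>1" "0 \<le> C\<^sub>2" using T c\<^sub>D(1) c\<^sub>K(1) k(1) by (auto simp: C\<^sub>1_def C\<^sub>2_def)
  then have C0: "0 \<le> C" using T c\<^sub>D(1) by (simp add: C_def)
  show ?thesis
  proof (rule that[of "C + 1"])
    show "0 < C + 1" using C0 by simp
    fix g1 :: "real \<Rightarrow> 'p \<Rightarrow>\<^sub>L real" and g2 :: "real \<Rightarrow> 'h \<Rightarrow>\<^sub>L real" and f :: "real \<Rightarrow> 'm \<Rightarrow>\<^sub>L real"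
      and h :: "real \<Rightarrow> 'q \<Rightarrow>\<^sub>L real" and m_star :: 'h and \<epsilon> :: real and p pd m md
    assume g1: "g1 \<in> sobolev_bochner 2 T" and g2: "g2 \<in> sobolev_bochner 1 T" and f: "f \<in> sobolev_bochner 1 T"
      and h: "h \<in> sobolev_bochner 2 T" and \<epsilon>: "0 < \<epsilon>"
      and ev: "eps_evolution T \<iota> A K D B \<epsilon> (\<lambda>t. g1 t + (g2 t o\<^sub>L \<iota>)) f h p pd m md"
      and ms: "\<And>q. q \<in> op_ker B \<Longrightarrow> m_star \<bullet> \<iota> q = K q (m 0) + g1 0 q"
    define s where "s = norm (\<iota> (p 0)) + norm m_star + sobolev_norm 2 T g1 + sobolev_norm 1 T g2
          + sobolev_norm 1 T f + sobolev_norm 2 T h"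
    have n0: "0 \<le> sobolev_norm 2 T g1" "0 \<le> sobolev_norm 1 T g2" "0 \<le> sobolev_norm 1 T f" "0 \<le> sobolev_norm 2 T h"
      by (rule sobolev_norm_nonneg)+
    have s: "0 \<le> s" "norm (\<iota> (p 0)) \<le> s" "norm m_star \<le> s" "sobolev_norm 2 T g1 \<le> s" "sobolev_norm 1 T g2 \<le> s"
      "sobolev_norm 1 T f \<le> s" "sobolev_norm 2 T h \<le> s" using n0 by (auto simp: s_def)
    have sq: "(sobolev_norm 2 T g1)\<^sup>2 \<le> s\<^sup>2" "(sobolev_norm 1 T g2)\<^sup>2 \<le> s\<^sup>2" "(sobolev_norm 1 T f)\<^sup>2 \<le> s\<^sup>2"
      "(sobolev_norm 2 T h)\<^sup>2 \<le> s\<^sup>2" using s n0 by (auto intro: power_mono)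
    have scale: "a \<le> c * s" if "a \<le> c * n" "n \<le> s" "0 < c" for a c n
      using that by (meson less_imp_le mult_left_mono order_trans)
    obtain G' where G': "\<And>t. t \<in> {0..T} \<Longrightarrow> (g1 has_vector_derivative G' t) (at t within {0..T})"
      "h1_energy_le T G' ((sobolev_norm 2 T g1)\<^sup>2)" "\<And>t. t \<in> {0..T} \<Longrightarrow> norm (G' t) \<le> \<kappa> * sobolev_norm 2 T g1"
      using sobolev2_C1[OF T g1] unfolding \<kappa>_def by blast
    obtain H where H: "\<And>t. t \<in> {0..T} \<Longrightarrow> (h has_vector_derivative H t) (at t within {0..T})"
      "h1_energy_le T H ((sobolev_norm 2 T h)\<^sup>2)" "\<And>t. t \<in> {0..T} \<Longrightarrow> norm (H t) \<le> \<kappa> * sobolev_norm 2 T h"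
      using sobolev2_C1[OF T h] unfolding \<kappa>_def by blast
    have pc: "continuous_on {0..T} p" "continuous_on {0..T} pd" "continuous_on {0..T} md"
      using ev by (auto simp: eps_evolution_def)
    have evD: "((\<lambda>s. \<iota> (p s)) has_vector_derivative pd t) (at t within {0..T})"
        "(m has_vector_derivative md t) (at t within {0..T})"
        "\<And>q. q \<in> op_ker B \<Longrightarrow> pd t \<bullet> \<iota> q + A (\<iota> (p t)) (\<iota> q) - K q (m t) = g1 t q + g2 t (\<iota> q)"
        "\<epsilon> *\<^sub>R blinfun_inner_right (md t) + K (p t) + D (m t) = f t" "B (p t) = h t" if "t \<in> {0..T}" for t
      using ev that by (auto simp: eps_evolution_def blinfun.add_left)
    define z where "z t = p t - R (h t)" for t
    define y where "y t = pd t - \<iota> (R (H t))" for t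
    define G\<^sub>2 where "G\<^sub>2 t = (g2 t - blinfun_inner_right (\<iota> (R (H t)))) - A (\<iota> (R (h t)))" for t
    define F where "F t = f t - K (R (h t))" for t
    define E\<^sub>2 where "E\<^sub>2 = 2 * (2 * (sobolev_norm 1 T g2)\<^sup>2 + 2 * ((norm \<iota> * \<rho>)\<^sup>2 * (sobolev_norm 2 T h)\<^sup>2))
      + 2 * ((norm A * norm \<iota> * \<rho>)\<^sup>2 * (sobolev_norm 2 T h)\<^sup>2)"
    define E\<^sub>F where "E\<^sub>F = 2 * (sobolev_norm 1 T f)\<^sup>2 + 2 * ((norm K * \<rho>)\<^sup>2 * (sobolev_norm 2 T h)\<^sup>2)"
    have hc: "continuous_on {0..T} h" using sobolev_continuous[OF h] by simp
    have R_le: "norm (R x) \<le> \<rho> * norm x" for x unfolding \<rho>_def by (rule norm_blinfun)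
    have \<iota>R_le: "norm (\<iota> (R x)) \<le> norm \<iota> * \<rho> * norm x" for x
      using order_trans[OF norm_blinfun[of \<iota> "R x"] mult_left_mono[OF R_le[of x] norm_ge_zero[of \<iota>]]] by (simp add: mult.assoc)
    have A\<iota>R_le: "norm (A (\<iota> (R x))) \<le> norm A * norm \<iota> * \<rho> * norm x" for x
      using order_trans[OF norm_blinfun[of A "\<iota> (R x)"] mult_left_mono[OF \<iota>R_le[of x] norm_ge_zero[of A]]] by (simp add: mult.assoc)
    have KR_le: "norm (K (R x)) \<le> norm K * \<rho> * norm x" for x
      using order_trans[OF norm_blinfun[of K "R x"] mult_left_mono[OF R_le[of x] norm_ge_zero[of K]]] by (simp add: mult.assoc)
    have hE: "h1_energy_le T h ((sobolev_norm 2 T h)\<^sup>2)" by (rule sobolev_h1_energy_le[OF T h]) simp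
    interpret sys: damped_system \<iota> A K D "op_ker B" T c\<^sub>D c\<^sub>K \<epsilon> z y m md g1 G\<^sub>2 F E\<^sub>2 E\<^sub>F
    proof
      show "0 < T" "0 < c\<^sub>D" "0 < c\<^sub>K" "0 \<le> \<epsilon>" using T c\<^sub>D c\<^sub>K \<epsilon> by auto
      show "c\<^sub>D * (norm x)\<^sup>2 \<le> D x x" for x by (rule c\<^sub>D)
      show "x - x' \<in> op_ker B" if "x \<in> op_ker B" "x' \<in> op_ker B" for x x' using that by (rule op_ker_diff)
      show "c\<^sub>K * norm q \<le> norm (K q)" if "q \<in> op_ker B" for q using that by (rule c\<^sub>K)
      show "z t \<in> op_ker B" if "t \<in> {0..T}" for t
        using evD(5)[OF that] by (simp add: z_def op_ker_def blinfun.diff_right R)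
      show "continuous_on {0..T} z" unfolding z_def by (intro continuous_intros pc hc)
      show "continuous_on {0..T} m" by (rule continuous_on_vector_derivative[OF evD(2)])
      show "((\<lambda>s. \<iota> (z s)) has_vector_derivative y t) (at t within {0..T})" if "t \<in> {0..T}" for t
        unfolding z_def y_def blinfun.diff_right
        by (intro has_vector_derivative_diff evD(1) that
            bounded_linear.has_vector_derivative[OF blinfun.bounded_linear_right] H(1))
      show "(m has_vector_derivative md t) (at t within {0..T})" if "t \<in> {0..T}" for t by (rule evD(2)[OF that])
      show "y t \<bullet> \<iota> q + A (\<iota> (z t)) (\<iota> q) - K q (m t) = g1 t q + G\<^sub>2 t (\<iota> q)"
        if "t \<in> {0..T}" "q \<in> op_ker B" for t q
        using evD(3)[OF that] by (simp add: y_def z_def G\<^sub>2_def inner_diff_left blinfun.diff_right blinfun.diff_left)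
      show "\<epsilon> *\<^sub>R blinfun_inner_right (md t) + K (z t) + D (m t) = F t" if "t \<in> {0..T}" for t
        using evD(4)[OF that] by (simp add: z_def F_def blinfun.diff_right algebra_simps)
      show "continuous_on {0..T} g1" using sobolev_continuous[OF g1] by simp
      show "h1_energy_le T G\<^sub>2 E\<^sub>2" unfolding G\<^sub>2_def E\<^sub>2_def
      proof (intro h1_energy_le_diff)
        show "h1_energy_le T g2 ((sobolev_norm 1 T g2)\<^sup>2)" by (rule sobolev_h1_energy_le[OF T g2]) simp
        show "h1_energy_le T (\<lambda>t. blinfun_inner_right (\<iota> (R (H t)))) ((norm \<iota> * \<rho>)\<^sup>2 * (sobolev_norm 2 T h)\<^sup>2)"
        proof (rule h1_energy_le_linear[OF H(2)])
          show "norm (blinfun_inner_right (\<iota> (R x)) - blinfun_inner_right (\<iota> (R x'))) \<le> norm \<iota> * \<rho> * norm (x - x')" for x x'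
          proof -
            have "blinfun_inner_right (\<iota> (R x)) - blinfun_inner_right (\<iota> (R x')) = blinfun_inner_right (\<iota> (R (x - x')))"
              by (rule blinfun_eqI) (simp add: blinfun.diff_left blinfun.diff_right inner_diff_left)
            then show ?thesis using \<iota>R_le[of "x - x'"] by (simp only: norm_blinfun_inner_right)
          qed
        qed
        show "h1_energy_le T (\<lambda>t. A (\<iota> (R (h t)))) ((norm A * norm \<iota> * \<rho>)\<^sup>2 * (sobolev_norm 2 T h)\<^sup>2)"
          by (rule h1_energy_le_linear[OF hE]) (metis A\<iota>R_le blinfun.diff_right)
      qed
      show "h1_energy_le T F E\<^sub>F" unfolding F_def E\<^sub>F_def
      proof (intro h1_energy_le_diff)
        show "h1_energy_le T f ((sobolev_norm 1 T f)\<^sup>2)" by (rule sobolev_h1_energy_le[OF T f]) simp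
        show "h1_energy_le T (\<lambda>t. K (R (h t))) ((norm K * \<rho>)\<^sup>2 * (sobolev_norm 2 T h)\<^sup>2)"
          by (rule h1_energy_le_linear[OF hE]) (metis KR_le blinfun.diff_right)
      qed
    qed
    define r where "r = \<epsilon> * norm (md 0)"
    have z0: "(0::real) \<in> {0..T}" using T by simp
    have r0: "0 \<le> r" using \<epsilon> by (simp add: r_def)
    have "f 0 - K (p 0) - D (m 0) = \<epsilon> *\<^sub>R blinfun_inner_right (md 0)"
      using evD(4)[OF z0] by (simp add: algebra_simps)
    then have r_eq: "norm (f 0 - K (p 0) - D (m 0)) = r"
      using \<epsilon> by (simp only: norm_scaleR norm_blinfun_inner_right r_def abs_of_pos)
    have F_le: "norm (F t) \<le> kF * s" if t: "t \<in> {0..T}" for t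
    proof -
      have "norm (f t) \<le> \<kappa> * s" by (rule scale[OF emb[OF f _ t] s(6) kap]) simp
      moreover have "norm (K (R (h t))) \<le> norm K * \<rho> * (\<kappa> * s)"
      proof (rule order_trans[OF KR_le mult_left_mono])
        show "norm (h t) \<le> \<kappa> * s" by (rule scale[OF emb[OF h _ t] s(7) kap]) simp
      qed (use nonneg in simp)
      ultimately show ?thesis unfolding F_def kF_def
        using norm_triangle_ineq4[of "f t" "K (R (h t))"] by (simp add: algebra_simps)
    qed
    have "int_sq {0..T} md
      \<le> (1 / c\<^sub>D + T) * (2 * (C\<^sub>1 + C\<^sub>1 * C\<^sub>2 + (C\<^sub>1 * C\<^sub>2)\<^sup>2)) * (s\<^sup>2 + r\<^sup>2 / \<epsilon>)"
    proof (rule sys.velocity_bound[OF \<epsilon> _ pc(3) _ _ s(1) _ _ _ _ _ r_def _ _ C\<^sub>1_def C\<^sub>2_def])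
      show "continuous_on {0..T} y" unfolding y_def
        by (intro continuous_intros pc h1_energy_le_continuous[OF H(2)])
      show "0 \<le> k" using k(1) by simp
      show "(g1 has_vector_derivative G' t) (at t within {0..T})" if "t \<in> {0..T}" for t by (rule G'(1)[OF that])
      show "norm (G' t) \<le> k * s" if "t \<in> {0..T}" for t
      proof -
        have "norm (G' t) \<le> \<kappa> * s" by (rule scale[OF G'(3)[OF that] s(4) kap])
        also have "\<dots> \<le> k * s" using k(2) s(1) by (rule mult_right_mono)
        finally show ?thesis .
      qed
      show "h1_energy_le T G' (k * s\<^sup>2)"
        using sq(1) mult_right_mono[OF k(1), of "s\<^sup>2"] by (intro h1_energy_le_trans[OF G'(2)]) simp
      show "E\<^sub>2 \<le> k * s\<^sup>2"
      proof -
        have "(norm \<iota> * \<rho>)\<^sup>2 * (sobolev_norm 2 T h)\<^sup>2 \<le> (norm \<iota> * \<rho>)\<^sup>2 * s\<^sup>2"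
          "(norm A * norm \<iota> * \<rho>)\<^sup>2 * (sobolev_norm 2 T h)\<^sup>2 \<le> (norm A * norm \<iota> * \<rho>)\<^sup>2 * s\<^sup>2"
          using sq(4) by (intro mult_left_mono; simp)+
        moreover have "2 * (2 * x + 2 * y) + 2 * w \<le> 4 * x' + 4 * y' + 2 * w'" if "x \<le> x'" "y \<le> y'" "w \<le> w'"
          for x x' y y' w w' :: real using that by simp
        ultimately have "E\<^sub>2 \<le> 4 * s\<^sup>2 + 4 * ((norm \<iota> * \<rho>)\<^sup>2 * s\<^sup>2) + 2 * ((norm A * norm \<iota> * \<rho>)\<^sup>2 * s\<^sup>2)"
          using sq(2) unfolding E\<^sub>2_def by blast
        also have "\<dots> = k2 * s\<^sup>2" by (simp add: k2_def distrib_right)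
        also have "\<dots> \<le> k * s\<^sup>2" using k(5) by (intro mult_right_mono) auto
        finally show ?thesis .
      qed
      show "E\<^sub>F \<le> k * s\<^sup>2"
      proof -
        have "(norm K * \<rho>)\<^sup>2 * (sobolev_norm 2 T h)\<^sup>2 \<le> (norm K * \<rho>)\<^sup>2 * s\<^sup>2"
          using sq(4) by (intro mult_left_mono) auto
        then have "E\<^sub>F \<le> 2 * s\<^sup>2 + 2 * ((norm K * \<rho>)\<^sup>2 * s\<^sup>2)"
          using sq(3,4) unfolding E\<^sub>F_def by (intro add_mono mult_left_mono) auto
        also have "\<dots> = kE * s\<^sup>2" by (simp add: kE_def distrib_right)
        also have "\<dots> \<le> k * s\<^sup>2" using k(4) by (intro mult_right_mono) auto
        finally show ?thesis .
      qed
      show "norm (F t) \<le> k * s" if "t \<in> {0..T}" for t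
        using F_le[OF that] mult_right_mono[OF k(3) s(1)] by linarith
      have g20: "norm (g2 0) \<le> \<kappa> * s" by (rule scale[OF emb[OF g2 _ z0] s(5) kap]) simp
      have g10: "norm (g1 0) \<le> \<kappa> * s" by (rule scale[OF emb[OF g1 _ z0] s(4) kap]) simp
      have "norm (y 0) \<le> ky * s"
      proof (rule sys.initial_velocity_bound)
        fix q assume q: "q \<in> op_ker B"
        have "norm (H 0) \<le> \<kappa> * s" by (rule scale[OF H(3)[OF z0] s(7) kap])
        then have H0: "norm (\<iota> (R (H 0))) \<le> norm \<iota> * \<rho> * (\<kappa> * s)"
          using nonneg by (intro order_trans[OF \<iota>R_le mult_left_mono]) auto
        have "y 0 \<bullet> \<iota> q = m_star \<bullet> \<iota> q - A (\<iota> (p 0)) (\<iota> q) + g2 0 (\<iota> q) - \<iota> (R (H 0)) \<bullet> \<iota> q"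
          using evD(3)[OF z0 q] ms[OF q] by (simp add: y_def inner_diff_left)
        also have "\<dots> \<le> norm m_star * norm (\<iota> q) + norm A * norm (\<iota> (p 0)) * norm (\<iota> q) + norm (g2 0) * norm (\<iota> q)
            + norm (\<iota> (R (H 0))) * norm (\<iota> q)"
        proof -
          have "\<bar>A (\<iota> (p 0)) (\<iota> q)\<bar> \<le> norm A * norm (\<iota> (p 0)) * norm (\<iota> q)"
            using order_trans[OF norm_blinfun[of "A (\<iota> (p 0))" "\<iota> q"] mult_right_mono[OF norm_blinfun[of A] norm_ge_zero]] by simp
          moreover have "\<bar>g2 0 (\<iota> q)\<bar> \<le> norm (g2 0) * norm (\<iota> q)" using norm_blinfun[of "g2 0" "\<iota> q"] by simp
          ultimately show ?thesis
            using Cauchy_Schwarz_ineq2[of m_star "\<iota> q"] Cauchy_Schwarz_ineq2[of "\<iota> (R (H 0))" "\<iota> q"] by linarith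
        qed
        also have "\<dots> = (norm m_star + norm A * norm (\<iota> (p 0)) + norm (g2 0) + norm (\<iota> (R (H 0)))) * norm (\<iota> q)"
          by (simp add: distrib_right)
        also have "\<dots> \<le> (ky * s) * norm (\<iota> q)"
        proof (rule mult_right_mono)
          have "norm A * norm (\<iota> (p 0)) \<le> norm A * s" using s(2) by (rule mult_left_mono) simp
          then show "norm m_star + norm A * norm (\<iota> (p 0)) + norm (g2 0) + norm (\<iota> (R (H 0))) \<le> ky * s"
            using s(3) g20 H0 unfolding ky_def by (simp add: algebra_simps)
        qed simp
        finally show "y 0 \<bullet> \<iota> q \<le> ky * s * norm (\<iota> q)" .
      qed (use nonneg s in simp)
      then show "norm (y 0) \<le> k * s" using mult_right_mono[OF k(6) s(1)] by linarith
      have "norm (m 0) \<le> ((1 + (norm D + 1) / c\<^sub>K) / c\<^sub>D + 1) * ((kF + norm \<iota> + \<kappa> + 1) * (s + r))"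
      proof (rule initial_flux_bound[OF c\<^sub>D(1) c\<^sub>K(1) c\<^sub>D(2) c\<^sub>K(2)[OF sys.z_V[OF z0]]])
        show "K (z 0) + D (m 0) = F 0 - \<epsilon> *\<^sub>R blinfun_inner_right (md 0)"
          using sys.eq2[OF z0] by (simp add: algebra_simps)
        have "0 \<le> (norm \<iota> + \<kappa> + 1) * s" "0 \<le> (kF + norm \<iota> + \<kappa>) * r" using nonneg s(1) r0 kap by auto
        then show "norm (F 0 - \<epsilon> *\<^sub>R blinfun_inner_right (md 0)) \<le> (kF + norm \<iota> + \<kappa> + 1) * (s + r)"
          using norm_triangle_ineq4[of "F 0" "\<epsilon> *\<^sub>R blinfun_inner_right (md 0)"] F_le[OF z0] \<epsilon>
          by (simp add: norm_blinfun_inner_right r_def algebra_simps)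
        have "K (z 0) (m 0) = m_star \<bullet> \<iota> (z 0) - g1 0 (z 0)" using ms[OF sys.z_V[OF z0]] by simp
        then have "\<bar>K (z 0) (m 0)\<bar> \<le> \<bar>m_star \<bullet> \<iota> (z 0)\<bar> + \<bar>g1 0 (z 0)\<bar>" by linarith
        also have "\<dots> \<le> s * (norm \<iota> * norm (z 0)) + \<kappa> * s * norm (z 0)"
        proof (rule add_mono)
          show "\<bar>m_star \<bullet> \<iota> (z 0)\<bar> \<le> s * (norm \<iota> * norm (z 0))"
            by (rule order_trans[OF Cauchy_Schwarz_ineq2 mult_mono[OF s(3) norm_blinfun]]) (use s in auto)
          show "\<bar>g1 0 (z 0)\<bar> \<le> \<kappa> * s * norm (z 0)"
            using order_trans[OF norm_blinfun[of "g1 0" "z 0"] mult_right_mono[OF g10 norm_ge_zero]] by simp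
        qed
        also have "\<dots> = ((norm \<iota> + \<kappa>) * s) * norm (z 0)" by (simp add: algebra_simps)
        also have "\<dots> \<le> ((kF + norm \<iota> + \<kappa> + 1) * (s + r)) * norm (z 0)"
          by (intro mult_right_mono mult_mono) (use nonneg s r0 kap in auto)
        finally show "\<bar>K (z 0) (m 0)\<bar> \<le> (kF + norm \<iota> + \<kappa> + 1) * (s + r) * norm (z 0)" .
      qed
      also have "\<dots> = km * (s + r)" by (simp add: km_def)
      also have "\<dots> \<le> k * (s + r)" using k(7) s(1) r0 by (intro mult_right_mono) auto
      finally show "norm (m 0) \<le> k * (s + r)" .
    qed
    also have "\<dots> = C * (s\<^sup>2 + r\<^sup>2 / \<epsilon>)" by (simp only: C_def)
    also have "\<dots> \<le> (C + 1) * (s\<^sup>2 + r\<^sup>2 / \<epsilon>)" using \<epsilon> by (intro mult_right_mono add_nonneg_nonneg) auto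
    finally show "int_sq {0..T} md \<le> (C + 1) *
        ((norm (\<iota> (p 0)) + norm m_star + sobolev_norm 2 T g1 + sobolev_norm 1 T g2
          + sobolev_norm 1 T f + sobolev_norm 2 T h)\<^sup>2 + (norm (f 0 - K (p 0) - D (m 0)))\<^sup>2 / \<epsilon>)"
      unfolding r_eq s_def .
  qed
qed

section \<open>The error of the limit system\<close>

lemma AE_interval_negligible:
  assumes "AE t in lebesgue_on {0..T::real}. P t"
  obtains N where "negligible N" "\<And>t. t \<in> {0..T} \<Longrightarrow> t \<notin> N \<Longrightarrow> P t"
proof -
  obtain N where N: "{t \<in> space (lebesgue_on {0..T}). \<not> P t} \<subseteq> N" "N \<in> null_sets (lebesgue_on {0..T})"
    using assms unfolding eventually_ae_filter by blast
  then have "negligible N"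
    using null_sets_restrict_space[of "{0..T}" lebesgue N] by (simp add: negligible_iff_null_sets)
  with N(1) show ?thesis using that[of N] by auto
qed

lemma bochner_L2_blinfun:
  fixes \<phi> :: "'x::real_normed_vector \<Rightarrow>\<^sub>L real"
  assumes "u \<in> bochner_L2 T" shows "(\<lambda>t. \<phi> (u t)) \<in> bochner_L2 T"
proof (rule bochner_L2_dominated)
  show "(\<lambda>t. \<phi> (u t)) measurable_on {0..T}"
    using measurable_on_compose_continuous_0[OF bochner_L2_measurable[OF assms], of \<phi>]
    by (simp add: o_def blinfun.continuous_on continuous_on_id)
  show "(\<lambda>t. (norm \<phi>)\<^sup>2 * (norm (u t))\<^sup>2) integrable_on {0..T}"
    by (intro integrable_on_mult_right bochner_L2_sq_integrable assms)
  show "(norm (\<phi> (u t)))\<^sup>2 \<le> (norm \<phi>)\<^sup>2 * (norm (u t))\<^sup>2" for t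
    using power_mono[OF norm_blinfun[of \<phi> "u t"] norm_ge_zero, of 2] by (simp add: power_mult_distrib)
qed

text \<open>The weak equation of the limit system, tested with a fixed element of the kernel, is integrated in
  time.  Hence the primitives of \<open>p - p0\<close> and \<open>m - m0\<close> satisfy, pointwise in time, the
  homogeneous system with \<open>\<epsilon> = 0\<close> and right-hand side \<open>- \<epsilon> (m - m(0))\<close> in the second equation; the
  energy of this right-hand side is \<open>\<epsilon>\<^sup>2 \<integral> \<parallel>m'\<parallel>\<^sup>2\<close>.\<close>

lemma limit_error_estimate:
  fixes \<iota> :: "'p::{real_inner,banach} \<Rightarrow>\<^sub>L 'h::{real_inner,banach}"
    and A :: "'h \<Rightarrow>\<^sub>L ('h \<Rightarrow>\<^sub>L real)"
    and K :: "'p \<Rightarrow>\<^sub>L ('m::{real_inner,banach} \<Rightarrow>\<^sub>L real)"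
    and D :: "'m \<Rightarrow>\<^sub>L ('m \<Rightarrow>\<^sub>L real)"
    and B :: "'p \<Rightarrow>\<^sub>L ('q::{real_inner,banach} \<Rightarrow>\<^sub>L real)"
    and g :: "real \<Rightarrow> 'p \<Rightarrow>\<^sub>L real"
  assumes T: "0 < T" and c\<^sub>D: "0 < c\<^sub>D" "\<And>m. c\<^sub>D * (norm m)\<^sup>2 \<le> D m m"
    and c\<^sub>K: "0 < c\<^sub>K" "\<And>q. q \<in> op_ker B \<Longrightarrow> c\<^sub>K * norm q \<le> norm (K q)"
    and g: "\<And>q. continuous_on {0..T} (\<lambda>t. g t q)"
    and ev: "eps_evolution T \<iota> A K D B \<epsilon> g f h p pd m md"
    and wk: "weak_limit_solution T \<iota> A K D B g f h (p 0) p0 u0 m0"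
    and X: "X = exp ((2 * norm A + 1) * T) * (\<epsilon>\<^sup>2 * int_sq {0..T} md / c\<^sub>D)"
    and \<tau>: "\<tau> \<in> {0..T}"
  shows "(norm (\<iota> (p \<tau>) - u0 \<tau>))\<^sup>2 \<le> X"
    and "c\<^sub>D * integral {0..\<tau>} (\<lambda>t. (norm (m t - m0 t))\<^sup>2) \<le> X"
    and "c\<^sub>K\<^sup>2 * integral {0..\<tau>} (\<lambda>t. (norm (p t - p0 t))\<^sup>2)
      \<le> 2 * (\<epsilon>\<^sup>2 * int_sq {0..T} md) + 2 * (norm D)\<^sup>2 * X / c\<^sub>D"
proof -
  have pc: "continuous_on {0..T} p" "continuous_on {0..T} pd" "continuous_on {0..T} md"
    using ev by (auto simp: eps_evolution_def)
  have evD: "((\<lambda>s. \<iota> (p s)) has_vector_derivative pd t) (at t within {0..T})"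
      "(m has_vector_derivative md t) (at t within {0..T})"
      "\<And>q. q \<in> op_ker B \<Longrightarrow> pd t \<bullet> \<iota> q + A (\<iota> (p t)) (\<iota> q) - K q (m t) = g t q"
      "\<epsilon> *\<^sub>R blinfun_inner_right (md t) + K (p t) + D (m t) = f t" "B (p t) = h t" if "t \<in> {0..T}" for t
    using ev that by (auto simp: eps_evolution_def)
  have u0: "continuous_on {0..T} u0" "u0 0 = \<iota> (p 0)" and p0: "p0 \<in> bochner_L2 T" and m0: "m0 \<in> bochner_L2 T"
    and wd: "\<And>q. q \<in> op_ker B \<Longrightarrow> has_weak_deriv T 1 (\<lambda>t. u0 t \<bullet> \<iota> q)
        (\<lambda>t. (g t - (A (u0 t) o\<^sub>L \<iota>) + dual_op K (m0 t)) q)"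
    and ae: "AE t in lebesgue_on {0..T}. \<iota> (p0 t) = u0 t" "AE t in lebesgue_on {0..T}. K (p0 t) + D (m0 t) = f t"
      "AE t in lebesgue_on {0..T}. B (p0 t) = h t"
    using wk by (auto simp: weak_limit_solution_def)
  obtain N where N: "negligible N"
    and aeN: "\<And>t. t \<in> {0..T} \<Longrightarrow> t \<notin> N \<Longrightarrow> \<iota> (p0 t) = u0 t \<and> K (p0 t) + D (m0 t) = f t \<and> B (p0 t) = h t"
    using AE_interval_negligible[OF AE_conjI[OF ae(1) AE_conjI[OF ae(2,3)]]] by metis
  have mc: "continuous_on {0..T} m" by (rule continuous_on_vector_derivative[OF evD(2)])
  define ez where "ez t = p t - p0 t" for t
  define em where "em t = m t - m0 t" for t
  define y where "y t = \<iota> (p t) - u0 t" for t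
  define M where "M t = m t - m 0" for t
  define Q where "Q = int_sq {0..T} md"
  have ez: "ez \<in> bochner_L2 T" and em: "em \<in> bochner_L2 T"
    unfolding ez_def em_def by (intro bochner_L2_diff continuous_in_bochner_L2 pc mc p0 m0)+
  obtain z where z: "weak_primitive T ez z" using weak_primitive_exists[OF ez] by blast
  obtain w where w: "weak_primitive T em w" using weak_primitive_exists[OF em] by blast
  have yc: "continuous_on {0..T} y"
    unfolding y_def by (intro continuous_intros pc u0 blinfun.continuous_on)
  have ezN: "\<iota> (ez t) = y t" "B (ez t) = 0" "K (ez t) + D (em t) = - \<epsilon> *\<^sub>R blinfun_inner_right (md t)"
    if "t \<in> {0..T}" "t \<notin> N" for t
  proof -
    note e = aeN[OF that]
    show "\<iota> (ez t) = y t" using e by (simp add: ez_def y_def blinfun.diff_right)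
    show "B (ez t) = 0" using e evD(5)[OF that(1)] by (simp add: ez_def blinfun.diff_right)
    have "K (ez t) + D (em t) = (K (p t) + D (m t)) - (K (p0 t) + D (m0 t))"
      by (simp add: ez_def em_def blinfun.diff_right)
    also have "\<dots> = (f t - \<epsilon> *\<^sub>R blinfun_inner_right (md t)) - f t"
      using e evD(4)[OF that(1)] by (simp add: eq_diff_eq algebra_simps)
    finally show "K (ez t) + D (em t) = - \<epsilon> *\<^sub>R blinfun_inner_right (md t)" by simp
  qed
  have spike: "(f2 has_integral I) {0..t}" if "(f1 has_integral I) {0..t}" "t \<in> {0..T}"
    "\<And>s. s \<in> {0..T} \<Longrightarrow> s \<notin> N \<Longrightarrow> f2 s = f1 s" for f1 f2 :: "real \<Rightarrow> real" and I t
    by (rule has_integral_spike[OF N _ that(1)]) (use that(2,3) in auto)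
  have z_ker: "z t \<in> op_ker B" if t: "t \<in> {0..T}" for t
  proof -
    have "B (z t) \<mu> = 0" for \<mu>
    proof -
      have "((\<lambda>s. dual_op B \<mu> (ez s)) has_integral dual_op B \<mu> (z t)) {0..t}"
        by (rule weak_primitiveD[OF z]) (use t in auto)
      from spike[OF this t, of "\<lambda>_. 0"] have "((\<lambda>_. 0) has_integral B (z t) \<mu>) {0..t}" using ezN(2) by simp
      then show ?thesis by (metis has_integral_0 has_integral_unique)
    qed
    then show ?thesis by (simp add: op_ker_def blinfun_eqI)
  qed
  have \<iota>z: "\<iota> (z t) = integral {0..t} y" if t: "t \<in> {0..T}" for t
  proof -
    have "x \<bullet> \<iota> (z t) = x \<bullet> integral {0..t} y" for x
    proof -
      have "((\<lambda>s. (blinfun_inner_right x o\<^sub>L \<iota>) (ez s)) has_integral (blinfun_inner_right x o\<^sub>L \<iota>) (z t)) {0..t}"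
        by (rule weak_primitiveD[OF z]) (use t in auto)
      from spike[OF this t, of "\<lambda>s. x \<bullet> y s"] have "((\<lambda>s. x \<bullet> y s) has_integral x \<bullet> \<iota> (z t)) {0..t}" using ezN(1) by simp
      moreover have "((\<lambda>s. x \<bullet> y s) has_integral x \<bullet> integral {0..t} y) {0..t}"
        using weak_primitiveD[OF weak_primitive_continuous_integral[OF yc], of t "blinfun_inner_right x"] t by simp
      ultimately show ?thesis by (rule has_integral_unique)
    qed
    then show ?thesis using vector_eq_ldot by blast
  qed
  have evolution: "y t \<bullet> \<iota> q + A (\<iota> (z t)) (\<iota> q) - K q (w t) = 0" if t: "t \<in> {0..T}" and q: "q \<in> op_ker B" for t q
  proof -
    let ?v = "\<lambda>t. (g t - (A (u0 t) o\<^sub>L \<iota>) + dual_op K (m0 t)) q"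
    have Ac: "continuous_on {0..T} (\<lambda>t. A (F t) (\<iota> q))" if "continuous_on {0..T} F" for F
      by (intro continuous_intros blinfun.continuous_on that)
    have "(\<lambda>t. (g t q - A (u0 t) (\<iota> q)) - (- K q) (m0 t)) \<in> bochner_L2 T"
      by (intro bochner_L2_diff bochner_L2_blinfun continuous_in_bochner_L2 continuous_intros g Ac u0 m0)
    then have vL2: "?v \<in> bochner_L2 T" by (simp add: blinfun.add_left blinfun.diff_left blinfun.minus_left)
    have vi: "?v integrable_on {0..T}" using bochner_L2_blinfun_integrable[OF vL2, of id_blinfun] by simp
    have "u0 t \<bullet> \<iota> q - u0 0 \<bullet> \<iota> q = integral {0..t} ?v"
      by (rule weak_deriv1_imp_integral[OF T _ wd[OF q] vL2])
        (use t in \<open>auto intro!: continuous_intros u0\<close>)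
    moreover have "?v integrable_on {0..t}" by (rule integrable_subinterval_real[OF vi]) (use t in auto)
    ultimately have h0: "(?v has_integral u0 t \<bullet> \<iota> q - u0 0 \<bullet> \<iota> q) {0..t}" by (simp add: has_integral_iff)
    have "((\<lambda>s. pd s \<bullet> \<iota> q) has_integral \<iota> (p t) \<bullet> \<iota> q - \<iota> (p 0) \<bullet> \<iota> q) {0..t}"
      using t by (intro fundamental_theorem_of_calculus)
        (auto intro!: has_vector_derivative_within_subset[OF bounded_linear.has_vector_derivative[OF bounded_linear_inner_left evD(1)]])
    from has_integral_diff[OF this h0]
    have "((\<lambda>s. pd s \<bullet> \<iota> q - ?v s) has_integral y t \<bullet> \<iota> q) {0..t}"
      by (simp add: y_def inner_diff_left u0(2))
    then have 1: "((\<lambda>s. K q (em s) - A (y s) (\<iota> q)) has_integral y t \<bullet> \<iota> q) {0..t}"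
    proof (rule has_integral_eq[rotated])
      fix s assume "s \<in> {0..t}"
      with t have "pd s \<bullet> \<iota> q + A (\<iota> (p s)) (\<iota> q) - K q (m s) = g s q" using evD(3)[OF _ q, of s] by auto
      then show "pd s \<bullet> \<iota> q - ?v s = K q (em s) - A (y s) (\<iota> q)"
        by (simp add: em_def y_def blinfun.add_left blinfun.diff_left blinfun.diff_right)
    qed
    have "((\<lambda>s. K q (em s)) has_integral K q (w t)) {0..t}" by (rule weak_primitiveD[OF w]) (use t in auto)
    moreover have "((\<lambda>s. A (y s) (\<iota> q)) has_integral A (\<iota> (z t)) (\<iota> q)) {0..t}"
      using weak_primitiveD[OF weak_primitive_continuous_integral[OF yc], of t "dual_op A (\<iota> q)"] t \<iota>z[OF t] by simp
    ultimately have "((\<lambda>s. K q (em s) - A (y s) (\<iota> q)) has_integral K q (w t) - A (\<iota> (z t)) (\<iota> q)) {0..t}"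
      by (rule has_integral_diff)
    from has_integral_unique[OF 1 this] show ?thesis by simp
  qed
  have flux: "K (z t) + D (w t) = - \<epsilon> *\<^sub>R blinfun_inner_right (M t)" if t: "t \<in> {0..T}" for t
  proof (rule blinfun_eqI)
    fix x
    have "((\<lambda>s. dual_op K x (ez s) + dual_op D x (em s)) has_integral dual_op K x (z t) + dual_op D x (w t)) {0..t}"
      by (intro has_integral_add weak_primitiveD[OF z] weak_primitiveD[OF w]) (use t in auto)
    moreover have "- \<epsilon> * (md s \<bullet> x) = dual_op K x (ez s) + dual_op D x (em s)" if "s \<in> {0..T}" "s \<notin> N" for s
    proof -
      have "(K (ez s) + D (em s)) x = (- \<epsilon> *\<^sub>R blinfun_inner_right (md s)) x" by (simp only: ezN(3)[OF that])
      then show ?thesis by (simp add: blinfun.add_left blinfun.scaleR_left blinfun.minus_left)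
    qed
    ultimately have "((\<lambda>s. - \<epsilon> * (md s \<bullet> x)) has_integral K (z t) x + D (w t) x) {0..t}"
      using spike[OF _ t, of _ _ "\<lambda>s. - \<epsilon> * (md s \<bullet> x)"] by simp
    moreover have "((\<lambda>s. - \<epsilon> * (md s \<bullet> x)) has_integral - \<epsilon> * (M t \<bullet> x)) {0..t}"
      using has_integral_mult_right[OF weak_primitiveD[OF weak_primitive_of_derivative[OF evD(2)], of t "blinfun_inner_right x"], of "- \<epsilon>"] t
      by (simp add: M_def inner_commute)
    ultimately have "K (z t) x + D (w t) x = - \<epsilon> * (M t \<bullet> x)" by (rule has_integral_unique)
    then show "(K (z t) + D (w t)) x = (- \<epsilon> *\<^sub>R blinfun_inner_right (M t)) x"
      by (simp add: blinfun.add_left blinfun.scaleR_left blinfun.minus_left)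
  qed
  interpret sys: damped_system \<iota> A K D "op_ker B" T c\<^sub>D c\<^sub>K 0 z y w "\<lambda>_. 0" "\<lambda>_. 0" "\<lambda>_. 0"
    "\<lambda>t. - \<epsilon> *\<^sub>R blinfun_inner_right (M t)" 0 "\<epsilon>\<^sup>2 * Q"
  proof
    show "0 < T" "0 < c\<^sub>D" "0 < c\<^sub>K" "(0::real) \<le> 0" using T c\<^sub>D c\<^sub>K by auto
    show "c\<^sub>D * (norm x)\<^sup>2 \<le> D x x" for x by (rule c\<^sub>D)
    show "x - x' \<in> op_ker B" if "x \<in> op_ker B" "x' \<in> op_ker B" for x x' using that by (rule op_ker_diff)
    show "c\<^sub>K * norm q \<le> norm (K q)" if "q \<in> op_ker B" for q using that by (rule c\<^sub>K)
    show "z t \<in> op_ker B" if "t \<in> {0..T}" for t by (rule z_ker[OF that])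
    show "continuous_on {0..T} z" "continuous_on {0..T} w"
      using h1_energy_le_continuous weak_primitive_h1_energy_le[OF z ez] weak_primitive_h1_energy_le[OF w em] by blast+
    show "((\<lambda>s. \<iota> (z s)) has_vector_derivative y t) (at t within {0..T})" if t: "t \<in> {0..T}" for t
      using has_vector_derivative_transform[OF t _ integral_has_vector_derivative[OF yc t], of "\<lambda>s. \<iota> (z s)"] \<iota>z by simp
    show "y t \<bullet> \<iota> q + A (\<iota> (z t)) (\<iota> q) - K q (w t) = blinfun_apply 0 q + blinfun_apply 0 (\<iota> q)"
      if "t \<in> {0..T}" "q \<in> op_ker B" for t q using evolution[OF that] by simp
    show "0 *\<^sub>R blinfun_inner_right 0 + K (z t) + D (w t) = - \<epsilon> *\<^sub>R blinfun_inner_right (M t)" if "t \<in> {0..T}" for t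
      using flux[OF that] by simp
    show "h1_energy_le T (\<lambda>_. 0 :: 'h \<Rightarrow>\<^sub>L real) 0"
      using h1_energy_le_Lipschitz[of T "\<lambda>_. 0 :: 'h \<Rightarrow>\<^sub>L real" 0] T by simp
    have "h1_energy_le T M Q" unfolding M_def Q_def
      by (rule weak_primitive_h1_energy_le[OF weak_primitive_of_derivative[OF evD(2)] continuous_in_bochner_L2[OF pc(3)]])
    then have "h1_energy_le T (\<lambda>t. - \<epsilon> *\<^sub>R blinfun_inner_right (M t)) (\<bar>\<epsilon>\<bar>\<^sup>2 * Q)"
    proof (rule h1_energy_le_linear)
      show "norm (- \<epsilon> *\<^sub>R blinfun_inner_right x - - \<epsilon> *\<^sub>R blinfun_inner_right x') \<le> \<bar>\<epsilon>\<bar> * norm (x - x')" for x x' :: 'm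
      proof -
        have "- \<epsilon> *\<^sub>R blinfun_inner_right x - - \<epsilon> *\<^sub>R blinfun_inner_right x' = - \<epsilon> *\<^sub>R blinfun_inner_right (x - x')"
          by (rule blinfun_eqI) (simp add: blinfun.diff_left blinfun.scaleR_left blinfun.minus_left inner_diff_left algebra_simps)
        then show ?thesis by (simp add: norm_blinfun_inner_right)
      qed
    qed
    then show "h1_energy_le T (\<lambda>t. - \<epsilon> *\<^sub>R blinfun_inner_right (M t)) (\<epsilon>\<^sup>2 * Q)" by simp
  qed (use T in auto)
  have y0: "y 0 = 0" by (simp add: y_def u0(2))
  note est = sys.stationary_flux_error_estimate[OF refl refl refl yc y0 ez z em w X[folded Q_def] \<tau>]
  show "(norm (\<iota> (p \<tau>) - u0 \<tau>))\<^sup>2 \<le> X" using est(1) by (simp add: y_def)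
  show "c\<^sub>D * integral {0..\<tau>} (\<lambda>t. (norm (m t - m0 t))\<^sup>2) \<le> X" using est(2) by (simp add: em_def)
  show "c\<^sub>K\<^sup>2 * integral {0..\<tau>} (\<lambda>t. (norm (p t - p0 t))\<^sup>2)
      \<le> 2 * (\<epsilon>\<^sup>2 * int_sq {0..T} md) + 2 * (norm D)\<^sup>2 * X / c\<^sub>D"
    using est(3) by (simp add: ez_def Q_def)
qed

theorem theorem4p1:
  fixes \<iota> :: "'p::{real_inner,banach} \<Rightarrow>\<^sub>L 'h::{real_inner,banach}"
    and A :: "'h \<Rightarrow>\<^sub>L ('h \<Rightarrow>\<^sub>L real)"
    and K :: "'p \<Rightarrow>\<^sub>L ('m::{real_inner,banach} \<Rightarrow>\<^sub>L real)"
    and D :: "'m \<Rightarrow>\<^sub>L ('m \<Rightarrow>\<^sub>L real)"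
    and B :: "'p \<Rightarrow>\<^sub>L ('q::{real_inner,banach} \<Rightarrow>\<^sub>L real)"
    and T c\<^sub>D c\<^sub>K c\<^sub>L :: real
  assumes "gelfand_embedding \<iota>"
    and "0 < c\<^sub>D" and "\<And>m. c\<^sub>D * (norm m)\<^sup>2 \<le> D m m"
    and "0 < inf_sup_const B"
    and "0 < c\<^sub>K" and "\<And>q. q \<in> op_ker B \<Longrightarrow> c\<^sub>K * norm q \<le> norm (K q)"
    and "0 < c\<^sub>L" and "\<And>q. q \<in> op_ker B \<Longrightarrow> c\<^sub>L * (norm q)\<^sup>2 \<le> op_L K D q q"
    and "0 < T"
  shows "\<exists>c>0. \<exists>C_data :: real \<Rightarrow> real \<Rightarrow> real \<Rightarrow> real \<Rightarrow> real \<Rightarrow> real \<Rightarrow> real.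
    \<forall>(g1 :: real \<Rightarrow> 'p \<Rightarrow>\<^sub>L real) (g2 :: real \<Rightarrow> 'h \<Rightarrow>\<^sub>L real)
     (f :: real \<Rightarrow> 'm \<Rightarrow>\<^sub>L real) (h :: real \<Rightarrow> 'q \<Rightarrow>\<^sub>L real)
     (p_init :: 'p) (m_init :: 'm) (m_star :: 'h).
      g1 \<in> sobolev_bochner 2 T \<longrightarrow> g2 \<in> sobolev_bochner 1 T \<longrightarrow>
      f \<in> sobolev_bochner 1 T \<longrightarrow> h \<in> sobolev_bochner 2 T \<longrightarrow>
      B p_init = h 0 \<longrightarrow>
      m_star \<in> closure (\<iota> ` op_ker B) \<longrightarrow>
      (\<forall>q\<in>op_ker B. m_star \<bullet> \<iota> q = (dual_op K m_init + g1 0) q) \<longrightarrow>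
      (\<forall>\<epsilon>>0. \<forall>p m lam p0 u0 m0.
        classical_solution T \<iota> A K D B \<epsilon> (\<lambda>t. g1 t + (g2 t o\<^sub>L \<iota>)) f h p_init m_init p m lam \<longrightarrow>
        weak_limit_solution T \<iota> A K D B (\<lambda>t. g1 t + (g2 t o\<^sub>L \<iota>)) f h p_init p0 u0 m0 \<longrightarrow>
        (\<forall>t\<in>{0..T}.
          (norm (\<iota> (p t) - u0 t))\<^sup>2
            + c\<^sub>L * integral {0..t} (\<lambda>s. (norm (p s - p0 s))\<^sup>2)
            + c\<^sub>D * integral {0..t} (\<lambda>s. (norm (m s - m0 s))\<^sup>2)
          \<le> c * (\<epsilon> * exp ((1 + 4 * norm A) * t) * (norm (f 0 - K p_init - D m_init))\<^sup>2
               + \<epsilon>\<^sup>2 * exp ((1 + 4 * norm A) * t) *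
                 C_data (norm (\<iota> p_init)) (norm m_star) (sobolev_norm 2 T g1)
                   (sobolev_norm 1 T g2) (sobolev_norm 1 T f) (sobolev_norm 2 T h))))"
proof -
  note T = \<open>0 < T\<close> and c\<^sub>D = assms(2,3) and c\<^sub>K = assms(5,6) and c\<^sub>L = assms(7)
  obtain C where C: "0 < C"
    "\<And>g1 g2 f h m_star \<epsilon> p pd m md.
      \<lbrakk>g1 \<in> sobolev_bochner 2 T; g2 \<in> sobolev_bochner 1 T; f \<in> sobolev_bochner 1 T; h \<in> sobolev_bochner 2 T; 0 < \<epsilon>;
       eps_evolution T \<iota> A K D B \<epsilon> (\<lambda>t. g1 t + (g2 t o\<^sub>L \<iota>)) f h p pd m md;
       \<And>q. q \<in> op_ker B \<Longrightarrow> m_star \<bullet> \<iota> q = K q (m 0) + g1 0 q\<rbrakk> \<Longrightarrow>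
      integral {0..T} (\<lambda>t. (norm (md t))\<^sup>2) \<le> C *
        ((norm (\<iota> (p 0)) + norm m_star + sobolev_norm 2 T g1 + sobolev_norm 1 T g2
          + sobolev_norm 1 T f + sobolev_norm 2 T h)\<^sup>2 + (norm (f 0 - K (p 0) - D (m 0)))\<^sup>2 / \<epsilon>)"
    using eps_velocity_bound[OF T c\<^sub>D assms(4) c\<^sub>K, of \<iota> A] by blast
  \<comment> \<open>The error estimate bounds each of the first and the last term by \<open>e \<epsilon>\<^sup>2 \<integral> \<parallel>m'\<parallel>\<^sup>2\<close>.\<close>
  define e where "e = exp ((2 * norm A + 1) * T) / c\<^sub>D"
  define k where "k = 2 * e + c\<^sub>L * ((2 + 2 * (norm D)\<^sup>2 * e / c\<^sub>D) / c\<^sub>K\<^sup>2)"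
  define C_data :: "real \<Rightarrow> real \<Rightarrow> real \<Rightarrow> real \<Rightarrow> real \<Rightarrow> real \<Rightarrow> real"
    where "C_data = (\<lambda>a1 a2 a3 a4 a5 a6. (a1 + a2 + a3 + a4 + a5 + a6)\<^sup>2)"
  have e: "0 < e" using c\<^sub>D(1) by (simp add: e_def)
  have k: "0 < k" unfolding k_def using e c\<^sub>L c\<^sub>D(1) by (intro add_pos_nonneg) auto
  have "(norm (\<iota> (p t) - u0 t))\<^sup>2
            + c\<^sub>L * integral {0..t} (\<lambda>s. (norm (p s - p0 s))\<^sup>2)
            + c\<^sub>D * integral {0..t} (\<lambda>s. (norm (m s - m0 s))\<^sup>2)
          \<le> (k * C) * (\<epsilon> * exp ((1 + 4 * norm A) * t) * (norm (f 0 - K p_init - D m_init))\<^sup>2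
               + \<epsilon>\<^sup>2 * exp ((1 + 4 * norm A) * t) *
                 C_data (norm (\<iota> p_init)) (norm m_star) (sobolev_norm 2 T g1)
                   (sobolev_norm 1 T g2) (sobolev_norm 1 T f) (sobolev_norm 2 T h))"
    if g1: "g1 \<in> sobolev_bochner 2 T" and g2: "g2 \<in> sobolev_bochner 1 T" and f: "f \<in> sobolev_bochner 1 T"
      and h: "h \<in> sobolev_bochner 2 T"
      and ms: "\<forall>q\<in>op_ker B. m_star \<bullet> \<iota> q = (dual_op K m_init + g1 0) q" and \<epsilon>: "0 < \<epsilon>"
      and cl: "classical_solution T \<iota> A K D B \<epsilon> (\<lambda>t. g1 t + (g2 t o\<^sub>L \<iota>)) f h p_init m_init p m lam"
      and wk: "weak_limit_solution T \<iota> A K D B (\<lambda>t. g1 t + (g2 t o\<^sub>L \<iota>)) f h p_init p0 u0 m0"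
      and t: "t \<in> {0..T}"
    for g1 :: "real \<Rightarrow> 'p \<Rightarrow>\<^sub>L real" and g2 :: "real \<Rightarrow> 'h \<Rightarrow>\<^sub>L real" and f :: "real \<Rightarrow> 'm \<Rightarrow>\<^sub>L real"
      and h :: "real \<Rightarrow> 'q \<Rightarrow>\<^sub>L real" and p_init m_init m_star \<epsilon> p m lam p0 u0 m0 t
  proof -
    obtain pd md where ev: "eps_evolution T \<iota> A K D B \<epsilon> (\<lambda>t. g1 t + (g2 t o\<^sub>L \<iota>)) f h p pd m md"
      and init: "p 0 = p_init" "m 0 = m_init"
      using classical_solution_imp_eps_evolution[OF cl] by blast
    define Q where "Q = integral {0..T} (\<lambda>t. (norm (md t))\<^sup>2)"
    define X where "X = exp ((2 * norm A + 1) * T) * (\<epsilon>\<^sup>2 * Q / c\<^sub>D)"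
    define r where "r = norm (f 0 - K p_init - D m_init)"
    define S where "S = C_data (norm (\<iota> p_init)) (norm m_star) (sobolev_norm 2 T g1)
                   (sobolev_norm 1 T g2) (sobolev_norm 1 T f) (sobolev_norm 2 T h)"
    have gc: "continuous_on {0..T} (\<lambda>t. (g1 t + (g2 t o\<^sub>L \<iota>)) q)" for q
      using sobolev_continuous[OF g1] sobolev_continuous[OF g2]
      by (auto simp: blinfun.add_left intro!: continuous_intros)
    note err = limit_error_estimate[OF T c\<^sub>D c\<^sub>K gc ev wk[folded init(1)] X_def[unfolded Q_def] t, folded Q_def]
    have XQ: "X = e * (\<epsilon>\<^sup>2 * Q)" by (simp add: X_def e_def)
    have "integral {0..t} (\<lambda>s. (norm (p s - p0 s))\<^sup>2) \<le> (2 + 2 * (norm D)\<^sup>2 * e / c\<^sub>D) / c\<^sub>K\<^sup>2 * (\<epsilon>\<^sup>2 * Q)"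
    proof -
      have "integral {0..t} (\<lambda>s. (norm (p s - p0 s))\<^sup>2) \<le> (2 * (\<epsilon>\<^sup>2 * Q) + 2 * (norm D)\<^sup>2 * X / c\<^sub>D) / c\<^sub>K\<^sup>2"
        using err(3) c\<^sub>K(1) by (simp add: pos_le_divide_eq mult.commute)
      also have "\<dots> = (2 + 2 * (norm D)\<^sup>2 * e / c\<^sub>D) / c\<^sub>K\<^sup>2 * (\<epsilon>\<^sup>2 * Q)"
        unfolding XQ by (simp add: distrib_right add_divide_distrib)
      finally show ?thesis .
    qed
    then have bp: "c\<^sub>L * integral {0..t} (\<lambda>s. (norm (p s - p0 s))\<^sup>2)
        \<le> c\<^sub>L * ((2 + 2 * (norm D)\<^sup>2 * e / c\<^sub>D) / c\<^sub>K\<^sup>2 * (\<epsilon>\<^sup>2 * Q))"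
      using c\<^sub>L by (intro mult_left_mono) auto
    then have "(norm (\<iota> (p t) - u0 t))\<^sup>2 + c\<^sub>L * integral {0..t} (\<lambda>s. (norm (p s - p0 s))\<^sup>2)
        + c\<^sub>D * integral {0..t} (\<lambda>s. (norm (m s - m0 s))\<^sup>2) \<le> k * (\<epsilon>\<^sup>2 * Q)"
    proof -
      have "k * (\<epsilon>\<^sup>2 * Q) = 2 * (e * (\<epsilon>\<^sup>2 * Q)) + c\<^sub>L * ((2 + 2 * (norm D)\<^sup>2 * e / c\<^sub>D) / c\<^sub>K\<^sup>2 * (\<epsilon>\<^sup>2 * Q))"
        by (simp only: k_def distrib_right mult.assoc)
      with bp err(1,2) show ?thesis unfolding XQ by linarith
    qed
    also have "\<dots> \<le> k * (\<epsilon>\<^sup>2 * (C * (S + r\<^sup>2 / \<epsilon>)))"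
    proof (intro mult_left_mono)
      show "Q \<le> C * (S + r\<^sup>2 / \<epsilon>)"
        using C(2)[OF g1 g2 f h \<epsilon> ev, of m_star] ms init
        by (simp add: Q_def S_def C_data_def r_def blinfun.add_left)
    qed (use k in auto)
    also have "\<dots> = (k * C) * (\<epsilon> * 1 * r\<^sup>2 + \<epsilon>\<^sup>2 * 1 * S)"
      using \<epsilon> by (simp add: power2_eq_square algebra_simps)
    \<comment> \<open>The growth in time is already contained in \<open>k\<close>, through the value of the exponential at \<open>T\<close>.\<close>
    also have "\<dots> \<le> (k * C) * (\<epsilon> * exp ((1 + 4 * norm A) * t) * r\<^sup>2 + \<epsilon>\<^sup>2 * exp ((1 + 4 * norm A) * t) * S)"
      using k C(1) \<epsilon> t by (intro mult_left_mono add_mono mult_right_mono) (auto simp: S_def C_data_def)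
    finally show ?thesis unfolding r_def S_def .
  qed
  moreover have "0 < k * C" using k C(1) by simp
  ultimately show ?thesis by (intro exI[of _ "k * C"] exI[of _ C_data]) blast
qed

end
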